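(* Assume that $\lambda$ is chosen sufficiently large so that $\mathcal{T}_{\lambda,\epsilon}$ is a contraction on $\mathcal{A}$ with respect to the norm $\|\cdot\|_{\lambda,\epsilon}$. Then $\mathcal{T}_{\lambda,\epsilon}$ admits a unique fixed point $(\mathbf{U}^\ast,\mathbf{P}^\ast)\in\mathcal{A}$, that is, $\mathcal{T}_{\lambda,\epsilon}(\mathbf{U}^\ast,\mathbf{P}^\ast)=(\mathbf{U}^\ast,\mathbf{P}^\ast)$. Moreover, for any initial guess $(\mathbf{U}^{(0)},\mathbf{P}^{(0)})\in\mathcal{A}$, the sequence $$(\mathbf{U}^{(n+1)},\mathbf{P}^{(n+1)})=\mathcal{T}_{\lambda,\epsilon}(\mathbf{U}^{(n)},\mathbf{P}^{(n)}),\qquad n\ge0,$$ converges in the norm $\|\cdot\|_{\lambda,\epsilon}$ to $(\mathbf{U}^\ast,\mathbf{P}^\ast)$ as $n\to\infty$.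
   Context: Setting. Let $d\ge2$, let $\Omega\subset\mathbb{R}^d$ be a domain with outward unit normal $\nu$ on $\partial\Omega$, let $T>0$, $\mu>0$ and $N\in\mathbb{N}$. Basis. Let $P_n$ be the Legendre polynomial of degree $n$ on $(-1,1)$, $P_n(x)=\frac{1}{2^n n!}\frac{d^n}{dx^n}(x^2-1)^n$, and for $t\in(0,T)$ set $Q_n(t)=\sqrt{\frac{2n+1}{T}}\,P_n\!\left(\frac{2t}{T}-1\right)$, $\Psi_n(t)=e^tQ_n(t)$, $n\ge0$. For $m,k,n\in\{0,\dots,N\}$ define $$s_{mn}=\int_0^Te^{-2t}\Psi_n'\Psi_m\,dt,\quad r_{mn}=\int_0^Te^{-2t}\Psi_n''\Psi_m\,dt,\quad c_{mkn}=\int_0^Te^{-2t}\Psi_n'\Psi_k\Psi_m\,dt,$$ $S_N=[s_{mn}]_{m,n=0}^N$, $R_N=[r_{mn}]_{m,n=0}^N$. The matrix $S_N$ is upper triangular with ones on the diagonal, hence invertible. These matrices act on the coefficient index: e.g. for $\mathbf{V}=(\mathbf{v}_0,\dots,\mathbf{v}_N)$ with $\mathbf{v}_n:\Omega\to\mathbb{R}^d$, the $m$-th block of $R_N\mathbf{V}$ is $\sum_n r_{mn}\mathbf{v}_n$; for $\mathbf{Q}=(q_0,\dots,q_N)$ with $q_n:\Omega\to\mathbb{R}$, the $m$-th block of $S_N(\nabla\mathbf{Q})$ is $\sum_n s_{mn}\nabla q_n$; $(\mu S_N)^{-1}$ and $S_N^{-1}$ act likewise. Nonlinear terms. For $\mathbf{V}=(\mathbf{v}_0,\dots,\mathbf{v}_N)$,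 $\mathbf{F}^N(\mathbf{x},\mathbf{V},\nabla\mathbf{V})=(\mathbf{F}_0,\dots,\mathbf{F}_N)$ and $G^N(\mathbf{x},\mathbf{V},\nabla\mathbf{V})=(G_0,\dots,G_N)$, where $$\mathbf{F}_m=\sum_{k,n=0}^Nc_{mkn}(\mathbf{v}_n\cdot\nabla)\mathbf{v}_k+\sum_{k,n=0}^Nc_{mkn}(\mathbf{v}_k\cdot\nabla)\mathbf{v}_n,$$ $$G_m=-\sum_{k,n=0}^Nc_{mkn}\nabla\mathbf{v}_n:(\nabla\mathbf{v}_k)^\top-\sum_{k,n=0}^Nc_{mkn}\nabla\mathbf{v}_k:(\nabla\mathbf{v}_n)^\top .$$ Boundary data. Given lateral data $\mathbf{g}:\partial\Omega\times(0,T)\to\mathbb{R}^d$ and $h_1,h_2:\partial\Omega\times(0,T)\to\mathbb{R}$ (these are $\partial_\nu\mathbf{u}$, $p$, $\partial_\nu p$ on $\partial\Omega\times(0,T)$ for a velocity $\mathbf{u}$, vanishing on $\partial\Omega$, and a pressure $p$ solving the incompressible Navier--Stokes system with viscosity $\mu$ and a time-independent body force), let $\boldsymbol{\Gamma}^N$, $\mathbf{H}_1^N$, $\mathbf{H}_2^N$ be the vectors on $\partial\Omega$ with $n$-th entries $\int_0^Te^{-2t}\mathbf{g}\Psi_n\,dt$, $\int_0^Te^{-2t}h_1\Psi_n\,dt$, $\int_0^Te^{-2t}h_2\Psi_n\,dt$, $n=0,\dots,N$. Admissible set. Let $s>\frac d2+2$ be chosen so that $H^s(\Omega)$ is continuously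 embedded into $C^2(\overline\Omega)$, let $H=[H^s(\Omega)]^{d(N+1)}\times[H^s(\Omega)]^{N+1}$, and let $M>0$ be a sufficiently large constant. Set $$\mathcal{A}=\{(\mathbf{V},\mathbf{Q})\in H:\ \|\mathbf{V}\|_{L^\infty(\Omega)}\le M,\ \|\mathbf{Q}\|_{L^\infty(\Omega)}\le M,\ \mathbf{V}|_{\partial\Omega}=\mathbf{0},\ \partial_\nu\mathbf{V}|_{\partial\Omega}=\boldsymbol{\Gamma}^N,\ \mathbf{Q}|_{\partial\Omega}=\mathbf{H}_1^N,\ \partial_\nu\mathbf{Q}|_{\partial\Omega}=\mathbf{H}_2^N\}.$$ It is assumed throughout that $\mathcal{A}$ is nonempty; it is a closed convex subset of $H$. Carleman weight and parameters. Let $\mathbf{x}_0\in\mathbb{R}^d\setminus\overline\Omega$ be such that $|\mathbf{x}-\mathbf{x}_0|>1$ for all $\mathbf{x}\in\Omega$, and for $\beta>0$ let $\mu_\beta(\mathbf{x})=|\mathbf{x}-\mathbf{x}_0|^{-\beta}$ (not to be confused with the viscosity $\mu$). The following known Carleman estimate fixes constants $\beta_0$ and $\lambda_0$: there exist $\beta_0>0$ depending only on $\mathbf{x}_0,\Omega,d$, and, for each $\beta\ge\beta_0$, constants $\lambda_0=\lambda_0(\mathbf{x}_0,\Omega,d,\beta)>0$ and $C=C(\mathbf{x}_0,\Omega,d,\beta)>0$ such that for all $\lambda\ge\lambda_0$ and all $v\in C^2(\overline\Omega)$ with $v=\partial_\nu v=0$ on $\partial\Omega$, $$\int_\Omega e^{2\lambda\mu_\beta}|\Delta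 v|^2\,d\mathbf{x}\ge C\lambda\int_\Omega e^{2\lambda\mu_\beta}|\nabla v|^2\,d\mathbf{x}+C\lambda^3\int_\Omega e^{2\lambda\mu_\beta}|v|^2\,d\mathbf{x}.$$ Throughout, $\beta>\beta_0$ is fixed, $\lambda>\lambda_0$ and $\epsilon>0$. Operator. For $(\mathbf{V},\mathbf{Q})\in\mathcal{A}$, $\mathcal{T}_{\lambda,\epsilon}(\mathbf{V},\mathbf{Q})\in\mathcal{A}$ is the unique minimizer over $(\mathbf{W},\mathbf{R})\in\mathcal{A}$ of $$J_{\lambda,\epsilon}(\mathbf{W},\mathbf{R};\mathbf{V},\mathbf{Q})=\int_\Omega e^{2\lambda\mu_\beta}\left|\Delta\mathbf{W}-(\mu S_N)^{-1}[R_N\mathbf{W}+\mathbf{F}^N(\mathbf{x},\mathbf{V},\nabla\mathbf{V})+S_N(\nabla\mathbf{Q})]\right|^2d\mathbf{x}+\int_\Omega e^{2\lambda\mu_\beta}\left|\Delta\mathbf{R}-S_N^{-1}G^N(\mathbf{x},\mathbf{V},\nabla\mathbf{V})\right|^2d\mathbf{x}+\epsilon\|(\mathbf{W},\mathbf{R})\|_H^2$$ (the minimizer exists and is unique because $J_{\lambda,\epsilon}$ is strictly convex in $(\mathbf{W},\mathbf{R})$ and $\mathcal{A}$ is closed and convex). Norm. For $(\mathbf{V},\mathbf{Q})\in H$, $$\|(\mathbf{V},\mathbf{Q})\|_{\lambda,\epsilon}^2=\int_\Omega e^{2\lambda\mu_\beta}\left(|\mathbf{V}|^2+|\nabla\mathbf{V}|^2+|\mathbf{Q}|^2+|\nabla\mathbf{Q}|^2\right)d\mathbf{x}+\frac{\epsilon}{\lambda}\|(\mathbf{V},\mathbf{Q})\|_H^2.$$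 A map $\mathcal{T}:\mathcal{A}\to\mathcal{A}$ is a contraction with respect to this norm if there is $\theta\in(0,1)$ with $\|\mathcal{T}(a)-\mathcal{T}(b)\|_{\lambda,\epsilon}\le\theta\|a-b\|_{\lambda,\epsilon}$ for all $a,b\in\mathcal{A}$. *)

theory Defs
  imports
    "HOL-Analysis.Analysis"
    "HOL-Library.Multiset"
    "HOL-Probability.Essential_Supremum"
begin

section \<open>Domains and classical derivatives\<close>

text \<open>
  \<open>n\<close> is the outward unit normal at the boundary point \<open>x\<close>: near \<open>x\<close>, every open cone around the
  direction \<open>- n\<close> of half-angle less than a right angle lies inside \<open>\<Omega>\<close>, and every such cone
  around \<open>n\<close> lies outside. For a domain with a boundary of class C1 this is the usual normal.
\<close>
definition outward_unit_normal :: "'a::euclidean_space set \<Rightarrow> 'a \<Rightarrow> 'a \<Rightarrow> bool" where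
  "outward_unit_normal \<Omega> x n \<longleftrightarrow>
     norm n = 1 \<and>
     (\<forall>e>0. \<exists>r>0. \<forall>y\<in>ball x r.
        ((y - x) \<bullet> n < - e * norm (y - x) \<longrightarrow> y \<in> \<Omega>) \<and>
        ((y - x) \<bullet> n > e * norm (y - x) \<longrightarrow> y \<notin> \<Omega>))"

definition pderiv_dir :: "'a::euclidean_space \<Rightarrow> ('a \<Rightarrow> real) \<Rightarrow> 'a \<Rightarrow> real" where
  "pderiv_dir b f x = frechet_derivative f (at x) b"

primrec iter_pderiv :: "'a::euclidean_space list \<Rightarrow> ('a \<Rightarrow> real) \<Rightarrow> 'a \<Rightarrow> real" where
  "iter_pderiv [] f = f"
| "iter_pderiv (b # bs) f = pderiv_dir b (iter_pderiv bs f)"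

definition grad :: "('a::euclidean_space \<Rightarrow> real) \<Rightarrow> 'a \<Rightarrow> 'a" where
  "grad q x = (\<Sum>i\<in>Basis. pderiv_dir i q x *\<^sub>R i)"

definition laplacian :: "('a::euclidean_space \<Rightarrow> real) \<Rightarrow> 'a \<Rightarrow> real" where
  "laplacian q x = (\<Sum>i\<in>Basis. iter_pderiv [i, i] q x)"

definition component :: "'a::euclidean_space \<Rightarrow> ('b \<Rightarrow> 'a) \<Rightarrow> 'b \<Rightarrow> real" where
  "component i v = (\<lambda>x. v x \<bullet> i)"

definition vec_laplacian :: "('a::euclidean_space \<Rightarrow> 'a) \<Rightarrow> 'a \<Rightarrow> 'a" where
  "vec_laplacian v x = (\<Sum>i\<in>Basis. laplacian (component i v) x *\<^sub>R i)"

text \<open>\<open>(v \<cdot> \<nabla>) w\<close>\<close>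
definition advect :: "('a::euclidean_space \<Rightarrow> 'a) \<Rightarrow> ('a \<Rightarrow> 'a) \<Rightarrow> 'a \<Rightarrow> 'a" where
  "advect v w x = (\<Sum>i\<in>Basis. (\<Sum>j\<in>Basis. component j v x * pderiv_dir j (component i w) x) *\<^sub>R i)"

text \<open>\<open>\<nabla>v : (\<nabla>w)\<^sup>T\<close>\<close>
definition grad_dot_grad_transpose ::
    "('a::euclidean_space \<Rightarrow> 'a) \<Rightarrow> ('a \<Rightarrow> 'a) \<Rightarrow> 'a \<Rightarrow> real" where
  "grad_dot_grad_transpose v w x =
     (\<Sum>i\<in>Basis. \<Sum>j\<in>Basis. pderiv_dir j (component i v) x * pderiv_dir i (component j w) x)"

text \<open>On the boundary, the gradient is the limit of the gradient from inside \<open>\<Omega>\<close>.\<close>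
definition normal_deriv ::
    "'a::euclidean_space set \<Rightarrow> ('a \<Rightarrow> 'a) \<Rightarrow> ('a \<Rightarrow> real) \<Rightarrow> 'a \<Rightarrow> real" where
  "normal_deriv \<Omega> \<nu> q x = \<nu> x \<bullet> Lim (at x within \<Omega>) (grad q)"

definition vec_normal_deriv ::
    "'a::euclidean_space set \<Rightarrow> ('a \<Rightarrow> 'a) \<Rightarrow> ('a \<Rightarrow> 'a) \<Rightarrow> 'a \<Rightarrow> 'a" where
  "vec_normal_deriv \<Omega> \<nu> v x = (\<Sum>i\<in>Basis. normal_deriv \<Omega> \<nu> (component i v) x *\<^sub>R i)"

text \<open>
  \<open>C\<^sup>2\<close> up to the boundary: twice continuously differentiable in \<open>\<Omega>\<close>, with all derivatives of order at
  most two extending continuously to the closure.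
\<close>
definition C2_closure :: "'a::euclidean_space set \<Rightarrow> ('a \<Rightarrow> real) set" where
  "C2_closure \<Omega> = {u.
     continuous_on (closure \<Omega>) u \<and>
     (\<forall>bs\<in>lists Basis. length bs \<le> 1 \<longrightarrow> (\<forall>x\<in>\<Omega>. iter_pderiv bs u differentiable (at x))) \<and>
     (\<forall>bs\<in>lists Basis. length bs \<le> 2 \<longrightarrow>
        (\<exists>h. continuous_on (closure \<Omega>) h \<and> (\<forall>x\<in>\<Omega>. h x = iter_pderiv bs u x)))}"


section \<open>Sobolev spaces of real order\<close>

definition square_integrable :: "'a::euclidean_space set \<Rightarrow> ('a \<Rightarrow> real) \<Rightarrow> bool" where
  "square_integrable \<Omega> f \<longleftrightarrow>
     set_borel_measurable lborel \<Omega> f \<and> set_integrable lborel \<Omega> (\<lambda>x. (f x)\<^sup>2)"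

text \<open>
  Smooth functions with compact support in \<open>\<Omega>\<close>; a function all of whose iterated partial derivatives
  are (Frechet) differentiable everywhere is smooth.
\<close>
definition test_functions :: "'a::euclidean_space set \<Rightarrow> ('a \<Rightarrow> real) set" where
  "test_functions \<Omega> = {\<phi>.
     (\<forall>bs\<in>lists Basis. \<forall>x. iter_pderiv bs \<phi> differentiable (at x)) \<and>
     compact (closure {x. \<phi> x \<noteq> 0}) \<and> closure {x. \<phi> x \<noteq> 0} \<subseteq> \<Omega>}"

text \<open>
  A multi-index is a multiset of basis vectors: the multiplicity of a basis vector is the order of
  differentiation in that direction, and the size is the order of the multi-index. The lists \<open>bs\<close>
  below are the possible orders of differentiation; for smooth functions they all give the same result.
\<close>
definition multi_indices :: "nat \<Rightarrow> 'a::euclidean_space multiset set" where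
  "multi_indices k = {\<alpha>. set_mset \<alpha> \<subseteq> Basis \<and> size \<alpha> \<le> k}"

definition is_weak_deriv ::
    "'a::euclidean_space set \<Rightarrow> 'a multiset \<Rightarrow> ('a \<Rightarrow> real) \<Rightarrow> ('a \<Rightarrow> real) \<Rightarrow> bool" where
  "is_weak_deriv \<Omega> \<alpha> u w \<longleftrightarrow>
     (\<forall>\<phi>\<in>test_functions \<Omega>. \<forall>bs. mset bs = \<alpha> \<longrightarrow>
        (LINT x:\<Omega>|lborel. u x * iter_pderiv bs \<phi> x) =
        (-1) ^ size \<alpha> * (LINT x:\<Omega>|lborel. w x * \<phi> x))"

text \<open>A weak derivative is determined up to a null set, so norms do not depend on the choice made here.\<close>
definition weak_deriv ::
    "'a::euclidean_space set \<Rightarrow> 'a multiset \<Rightarrow> ('a \<Rightarrow> real) \<Rightarrow> 'a \<Rightarrow> real" where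
  "weak_deriv \<Omega> \<alpha> u = (SOME w. square_integrable \<Omega> w \<and> is_weak_deriv \<Omega> \<alpha> u w)"

definition gagliardo_quotient ::
    "real \<Rightarrow> ('a::euclidean_space \<Rightarrow> real) \<Rightarrow> 'a \<times> 'a \<Rightarrow> real" where
  "gagliardo_quotient \<sigma> f = (\<lambda>(x, y). (f x - f y)\<^sup>2 / norm (x - y) powr (real DIM('a) + 2 * \<sigma>))"

text \<open>
  \<open>H\<^sup>s(\<Omega>)\<close> for real \<open>s \<ge> 0\<close> (Sobolev--Slobodeckij). Membership depends only on the equivalence class
  of \<open>u\<close> modulo equality almost everywhere in \<open>\<Omega>\<close>.
\<close>
definition sobolev :: "'a::euclidean_space set \<Rightarrow> real \<Rightarrow> ('a \<Rightarrow> real) set" where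
  "sobolev \<Omega> s = {u.
     square_integrable \<Omega> u \<and>
     (\<forall>\<alpha>\<in>multi_indices (nat \<lfloor>s\<rfloor>). \<exists>w. square_integrable \<Omega> w \<and> is_weak_deriv \<Omega> \<alpha> u w) \<and>
     (frac s > 0 \<longrightarrow>
        (\<forall>\<alpha>\<in>multi_indices (nat \<lfloor>s\<rfloor>). size \<alpha> = nat \<lfloor>s\<rfloor> \<longrightarrow>
           set_integrable (lborel \<Otimes>\<^sub>M lborel) (\<Omega> \<times> \<Omega>)
             (gagliardo_quotient (frac s) (weak_deriv \<Omega> \<alpha> u))))}"

definition sobolev_norm2 :: "'a::euclidean_space set \<Rightarrow> real \<Rightarrow> ('a \<Rightarrow> real) \<Rightarrow> real" where
  "sobolev_norm2 \<Omega> s u =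
     (\<Sum>\<alpha>\<in>multi_indices (nat \<lfloor>s\<rfloor>). LINT x:\<Omega>|lborel. (weak_deriv \<Omega> \<alpha> u x)\<^sup>2) +
     (if frac s > 0 then
        (\<Sum>\<alpha>\<in>{\<alpha>\<in>multi_indices (nat \<lfloor>s\<rfloor>). size \<alpha> = nat \<lfloor>s\<rfloor>}.
           LINT z:\<Omega> \<times> \<Omega>|lborel \<Otimes>\<^sub>M lborel. gagliardo_quotient (frac s) (weak_deriv \<Omega> \<alpha> u) z)
      else 0)"

text \<open>
  Continuous embedding of \<open>H\<^sup>s(\<Omega>)\<close> into \<open>C\<^sup>2\<close> of the closure, normed by the suprema of the derivatives
  of order at most two.
\<close>
definition embeds_into_C2 :: "'a::euclidean_space set \<Rightarrow> real \<Rightarrow> bool" where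
  "embeds_into_C2 \<Omega> s \<longleftrightarrow>
     (\<exists>C. \<forall>u\<in>sobolev \<Omega> s. \<exists>v\<in>C2_closure \<Omega>.
        (AE x in lborel. x \<in> \<Omega> \<longrightarrow> v x = u x) \<and>
        (\<forall>bs\<in>lists Basis. length bs \<le> 2 \<longrightarrow>
           (\<forall>x\<in>\<Omega>. \<bar>iter_pderiv bs v x\<bar> \<le> C * sqrt (sobolev_norm2 \<Omega> s u))))"

text \<open>
  When \<open>H\<^sup>s(\<Omega>)\<close> embeds into \<open>C\<^sup>2\<close> of the closure, every class in \<open>H\<^sup>s(\<Omega>)\<close> has exactly one
  representative that is \<open>C\<^sup>2\<close> up to the boundary and zero off the closure. Working with these
  representatives, equality in \<open>H\<^sup>s(\<Omega>)\<close> is equality of functions and boundary values are values.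
\<close>
definition Hs :: "'a::euclidean_space set \<Rightarrow> real \<Rightarrow> ('a \<Rightarrow> real) set" where
  "Hs \<Omega> s = {u \<in> sobolev \<Omega> s. u \<in> C2_closure \<Omega> \<and> (\<forall>x. x \<notin> closure \<Omega> \<longrightarrow> u x = 0)}"

text \<open>
  A pair \<open>(V, Q)\<close> of coefficient vectors indexed by \<open>{0..N}\<close>; entries with index above \<open>N\<close> are
  normalised to zero. Differences of states are taken pointwise.
\<close>
type_synonym 'a state = "(nat \<Rightarrow> 'a \<Rightarrow> 'a) \<times> (nat \<Rightarrow> 'a \<Rightarrow> real)"

definition H_space :: "'a::euclidean_space set \<Rightarrow> real \<Rightarrow> nat \<Rightarrow> 'a state set" where
  "H_space \<Omega> s N = {(V, Q).
     (\<forall>n\<le>N. (\<forall>i\<in>Basis. component i (V n) \<in> Hs \<Omega> s) \<and> Q n \<in> Hs \<Omega> s) \<and>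
     (\<forall>n>N. V n = (\<lambda>_. 0) \<and> Q n = (\<lambda>_. 0))}"

definition H_norm2 :: "'a::euclidean_space set \<Rightarrow> real \<Rightarrow> nat \<Rightarrow> 'a state \<Rightarrow> real" where
  "H_norm2 \<Omega> s N = (\<lambda>(V, Q).
     (\<Sum>n\<le>N. (\<Sum>i\<in>Basis. sobolev_norm2 \<Omega> s (component i (V n))) + sobolev_norm2 \<Omega> s (Q n)))"


section \<open>The Legendre-exponential basis and its matrices\<close>

definition legendre :: "nat \<Rightarrow> real \<Rightarrow> real" where
  "legendre n x = 1 / (2 ^ n * fact n) * (deriv ^^ n) (\<lambda>y. (y\<^sup>2 - 1) ^ n) x"

definition Q_basis :: "real \<Rightarrow> nat \<Rightarrow> real \<Rightarrow> real" where
  "Q_basis T n t = sqrt ((2 * real n + 1) / T) * legendre n (2 * t / T - 1)"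

definition Psi :: "real \<Rightarrow> nat \<Rightarrow> real \<Rightarrow> real" where
  "Psi T n t = exp t * Q_basis T n t"

definition s_coeff :: "real \<Rightarrow> nat \<Rightarrow> nat \<Rightarrow> real" where
  "s_coeff T m n = (LINT t:{0<..<T}|lborel. exp (- 2 * t) * deriv (Psi T n) t * Psi T m t)"

definition r_coeff :: "real \<Rightarrow> nat \<Rightarrow> nat \<Rightarrow> real" where
  "r_coeff T m n = (LINT t:{0<..<T}|lborel. exp (- 2 * t) * deriv (deriv (Psi T n)) t * Psi T m t)"

definition c_coeff :: "real \<Rightarrow> nat \<Rightarrow> nat \<Rightarrow> nat \<Rightarrow> real" where
  "c_coeff T m k n =
     (LINT t:{0<..<T}|lborel. exp (- 2 * t) * deriv (Psi T n) t * Psi T k t * Psi T m t)"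

text \<open>
  Matrices with rows and columns indexed by \<open>{0..N}\<close> are functions of two indices. The two-sided
  inverse is normalised to zero outside the index range, which makes it unique.
\<close>
definition mat_inverse :: "nat \<Rightarrow> (nat \<Rightarrow> nat \<Rightarrow> real) \<Rightarrow> nat \<Rightarrow> nat \<Rightarrow> real" where
  "mat_inverse N A = (THE B.
     (\<forall>i j. i > N \<or> j > N \<longrightarrow> B i j = 0) \<and>
     (\<forall>i\<le>N. \<forall>j\<le>N.
        (\<Sum>k\<le>N. A i k * B k j) = (if i = j then 1 else 0) \<and>
        (\<Sum>k\<le>N. B i k * A k j) = (if i = j then 1 else 0)))"

definition mat_act ::
    "nat \<Rightarrow> (nat \<Rightarrow> nat \<Rightarrow> real) \<Rightarrow> (nat \<Rightarrow> 'b::real_vector) \<Rightarrow> nat \<Rightarrow> 'b" where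
  "mat_act N A v m = (\<Sum>n\<le>N. A m n *\<^sub>R v n)"


section \<open>The nonlinear terms, the admissible set and the operator\<close>

definition F_term ::
    "real \<Rightarrow> nat \<Rightarrow> (nat \<Rightarrow> 'a::euclidean_space \<Rightarrow> 'a) \<Rightarrow> nat \<Rightarrow> 'a \<Rightarrow> 'a" where
  "F_term T N V m x =
     (\<Sum>k\<le>N. \<Sum>n\<le>N. c_coeff T m k n *\<^sub>R advect (V n) (V k) x) +
     (\<Sum>k\<le>N. \<Sum>n\<le>N. c_coeff T m k n *\<^sub>R advect (V k) (V n) x)"

definition G_term ::
    "real \<Rightarrow> nat \<Rightarrow> (nat \<Rightarrow> 'a::euclidean_space \<Rightarrow> 'a) \<Rightarrow> nat \<Rightarrow> 'a \<Rightarrow> real" where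
  "G_term T N V m x =
     - (\<Sum>k\<le>N. \<Sum>n\<le>N. c_coeff T m k n * grad_dot_grad_transpose (V n) (V k) x)
     - (\<Sum>k\<le>N. \<Sum>n\<le>N. c_coeff T m k n * grad_dot_grad_transpose (V k) (V n) x)"

definition data_coeff ::
    "real \<Rightarrow> ('a \<Rightarrow> real \<Rightarrow> 'b::{banach, second_countable_topology}) \<Rightarrow> nat \<Rightarrow> 'a \<Rightarrow> 'b" where
  "data_coeff T g n x = (LINT t:{0<..<T}|lborel. (exp (- 2 * t) * Psi T n t) *\<^sub>R g x t)"

definition Linf_norm :: "'a::euclidean_space set \<Rightarrow> ('a \<Rightarrow> real) \<Rightarrow> ereal" where
  "Linf_norm \<Omega> f = esssup (restrict_space lborel \<Omega>) (\<lambda>x. ereal \<bar>f x\<bar>)"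

definition admissible ::
    "'a::euclidean_space set \<Rightarrow> ('a \<Rightarrow> 'a) \<Rightarrow> real \<Rightarrow> nat \<Rightarrow> real \<Rightarrow> real \<Rightarrow>
     ('a \<Rightarrow> real \<Rightarrow> 'a) \<Rightarrow> ('a \<Rightarrow> real \<Rightarrow> real) \<Rightarrow> ('a \<Rightarrow> real \<Rightarrow> real) \<Rightarrow> 'a state set" where
  "admissible \<Omega> \<nu> s N M T g h\<^sub>1 h\<^sub>2 = {(V, Q) \<in> H_space \<Omega> s N.
     Linf_norm \<Omega> (\<lambda>x. sqrt (\<Sum>n\<le>N. (norm (V n x))\<^sup>2)) \<le> ereal M \<and>
     Linf_norm \<Omega> (\<lambda>x. sqrt (\<Sum>n\<le>N. (Q n x)\<^sup>2)) \<le> ereal M \<and>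
     (\<forall>n\<le>N. \<forall>x\<in>frontier \<Omega>.
        V n x = 0 \<and>
        vec_normal_deriv \<Omega> \<nu> (V n) x = data_coeff T g n x \<and>
        Q n x = data_coeff T h\<^sub>1 n x \<and>
        normal_deriv \<Omega> \<nu> (Q n) x = data_coeff T h\<^sub>2 n x)}"

definition carleman_exponent :: "'a::euclidean_space \<Rightarrow> real \<Rightarrow> 'a \<Rightarrow> real" where
  "carleman_exponent x\<^sub>0 \<beta> x = norm (x - x\<^sub>0) powr (- \<beta>)"

definition carleman_weight :: "'a::euclidean_space \<Rightarrow> real \<Rightarrow> real \<Rightarrow> 'a \<Rightarrow> real" where
  "carleman_weight x\<^sub>0 \<beta> lam x = exp (2 * lam * carleman_exponent x\<^sub>0 \<beta> x)"

definition carleman_estimate ::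
    "'a::euclidean_space set \<Rightarrow> ('a \<Rightarrow> 'a) \<Rightarrow> 'a \<Rightarrow> real \<Rightarrow> (real \<Rightarrow> real) \<Rightarrow> bool" where
  "carleman_estimate \<Omega> \<nu> x\<^sub>0 \<beta>\<^sub>0 lam\<^sub>0 \<longleftrightarrow>
     \<beta>\<^sub>0 > 0 \<and>
     (\<forall>\<beta>\<ge>\<beta>\<^sub>0. lam\<^sub>0 \<beta> > 0 \<and>
        (\<exists>C>0. \<forall>lam\<ge>lam\<^sub>0 \<beta>. \<forall>v\<in>C2_closure \<Omega>.
           (\<forall>x\<in>frontier \<Omega>. v x = 0 \<and> normal_deriv \<Omega> \<nu> v x = 0) \<longrightarrow>
           (\<integral>\<^sup>+x\<in>\<Omega>. ennreal (carleman_weight x\<^sub>0 \<beta> lam x * (laplacian v x)\<^sup>2) \<partial>lborel) \<ge>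
             ennreal (C * lam) *
               (\<integral>\<^sup>+x\<in>\<Omega>. ennreal (carleman_weight x\<^sub>0 \<beta> lam x * (norm (grad v x))\<^sup>2) \<partial>lborel) +
             ennreal (C * lam ^ 3) *
               (\<integral>\<^sup>+x\<in>\<Omega>. ennreal (carleman_weight x\<^sub>0 \<beta> lam x * (v x)\<^sup>2) \<partial>lborel)))"

text \<open>The first state argument is \<open>(V, Q)\<close>, the second one is the variable \<open>(W, R)\<close> of minimisation.\<close>
definition J_functional ::
    "'a::euclidean_space set \<Rightarrow> real \<Rightarrow> nat \<Rightarrow> real \<Rightarrow> real \<Rightarrow> 'a \<Rightarrow> real \<Rightarrow> real \<Rightarrow> real \<Rightarrow>
     'a state \<Rightarrow> 'a state \<Rightarrow> real" where
  "J_functional \<Omega> s N T \<mu> x\<^sub>0 \<beta> lam \<epsilon> = (\<lambda>(V, Q) (W, R).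
     (LINT x:\<Omega>|lborel. carleman_weight x\<^sub>0 \<beta> lam x *
        (\<Sum>m\<le>N. (norm (vec_laplacian (W m) x -
           mat_act N (mat_inverse N (\<lambda>i j. \<mu> * s_coeff T i j))
             (\<lambda>l. mat_act N (r_coeff T) (\<lambda>n. W n x) l + F_term T N V l x +
                  mat_act N (s_coeff T) (\<lambda>n. grad (Q n) x) l) m))\<^sup>2)) +
     (LINT x:\<Omega>|lborel. carleman_weight x\<^sub>0 \<beta> lam x *
        (\<Sum>m\<le>N. (laplacian (R m) x -
           mat_act N (mat_inverse N (s_coeff T)) (\<lambda>l. G_term T N V l x) m)\<^sup>2)) +
     \<epsilon> * H_norm2 \<Omega> s N (W, R))"

definition T_operator ::
    "'a::euclidean_space set \<Rightarrow> real \<Rightarrow> nat \<Rightarrow> real \<Rightarrow> real \<Rightarrow> 'a \<Rightarrow> real \<Rightarrow> real \<Rightarrow> real \<Rightarrow>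
     'a state set \<Rightarrow> 'a state \<Rightarrow> 'a state" where
  "T_operator \<Omega> s N T \<mu> x\<^sub>0 \<beta> lam \<epsilon> A a =
     (THE w. is_arg_min (J_functional \<Omega> s N T \<mu> x\<^sub>0 \<beta> lam \<epsilon> a) (\<lambda>b. b \<in> A) w)"

definition weighted_norm ::
    "'a::euclidean_space set \<Rightarrow> real \<Rightarrow> nat \<Rightarrow> 'a \<Rightarrow> real \<Rightarrow> real \<Rightarrow> real \<Rightarrow> 'a state \<Rightarrow> real" where
  "weighted_norm \<Omega> s N x\<^sub>0 \<beta> lam \<epsilon> = (\<lambda>(V, Q). sqrt (
     (LINT x:\<Omega>|lborel. carleman_weight x\<^sub>0 \<beta> lam x *
        (\<Sum>n\<le>N. (norm (V n x))\<^sup>2 + (\<Sum>i\<in>Basis. (norm (grad (component i (V n)) x))\<^sup>2) +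
                (Q n x)\<^sup>2 + (norm (grad (Q n) x))\<^sup>2)) +
     \<epsilon> / lam * H_norm2 \<Omega> s N (V, Q)))"

definition contraction_wrt ::
    "('b::minus \<Rightarrow> real) \<Rightarrow> 'b set \<Rightarrow> ('b \<Rightarrow> 'b) \<Rightarrow> bool" where
  "contraction_wrt nrm A f \<longleftrightarrow>
     (\<exists>\<theta>\<in>{0<..<1}. \<forall>a\<in>A. \<forall>b\<in>A. nrm (f a - f b) \<le> \<theta> * nrm (a - b))"

end

theory Submission
  imports Defs
begin

text \<open>
  The statement is the Banach fixed-point theorem for \<open>T_operator\<close> on the admissible set. What has to
  be supplied is that the operator is well defined, i.e. that the Tikhonov-regularised least-squares
  functional has exactly one minimiser over the admissible set, and that the admissible set is
  complete for the weighted norm. Both rest on one fact: \<open>H\<^sup>s(\<Omega>)\<close> is complete, and inside it the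
  admissible set is closed and convex.

  Completeness of \<open>H\<^sup>s(\<Omega>)\<close> (\<open>sobolev_complete\<close>) is the usual argument: the weak derivatives of a
  Cauchy sequence converge in \<open>L\<^sup>2\<close>, the limits are again weak derivatives, and the Gagliardo
  differences converge because an almost everywhere convergent subsequence identifies their limit.
  The norm is defined through a choice of weak derivatives, so even its homogeneity needs weak
  derivatives to be unique almost everywhere. This is the fundamental lemma of the calculus of
  variations (\<open>fundamental_lemma_calculus_of_variations\<close>), for which smooth bump functions are built
  from \<open>exp (- 1 / t)\<close>. The embedding into \<open>C\<^sup>2\<close> turns limits into continuous representatives
  (\<open>Hs_complete\<close>) and makes values and normal derivatives on the boundary continuous functionals, so
  the admissible set is closed (\<open>admissible_closed\<close>); it contains midpoints because all its
  constraints are convex (\<open>admissible_midpoint\<close>).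

  Existence of the minimiser (\<open>admissible_minimizer\<close>) does not go through weak compactness. By the
  parallelogram identity the functional at the midpoint of two states lies below the mean of its
  values by at least a quarter of \<open>\<epsilon>\<close> times the squared \<open>H\<close>-distance, so a minimising sequence is
  Cauchy. To treat the affine residuals like linear ones, the functional is homogenised: it is the
  restriction to \<open>\<tau> = 1\<close> of a quadratic form on pairs \<open>(X, \<tau>)\<close>. For this form to be finite and bounded
  by the \<open>H\<close>-norm, classical derivatives of order at most two must be square integrable. They are,
  because integration by parts against test functions (\<open>integration_by_parts_test_function\<close>)
  identifies them with the weak ones; the nonlinear terms are products of a bounded and a square
  integrable function.

  Finally, the Carleman weight lies between \<open>0\<close> and \<open>exp (2 * lam)\<close> on \<open>\<Omega>\<close>, so the squared weighted
  norm is at most a multiple of the squared \<open>H\<close>-norm, and its last term is \<open>\<epsilon> / lam\<close> times the squared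
  \<open>H\<close>-norm. Hence the admissible set is complete for it, and the contraction has a unique fixed point
  to which the iteration converges (\<open>contraction_fixed_point_admissible\<close>).
\<close>

section \<open>Quadratic forms on sets closed under linear combinations\<close>

text \<open>
  A nonnegative quadratic form, together with closure of its domain under linear combinations. The
  combination operator is a parameter so that the same facts apply to real functions, to states, and
  to pairs of a state and a number. The mixed term only has to exist for each pair of arguments,
  which makes sums, scalings, pullbacks and integrals of forms immediate; it would be the polar
  bilinear form.
\<close>
definition quad_form :: "(real \<Rightarrow> 'v \<Rightarrow> real \<Rightarrow> 'v \<Rightarrow> 'v) \<Rightarrow> 'v set \<Rightarrow> ('v \<Rightarrow> real) \<Rightarrow> bool" where
  "quad_form cmb S q \<longleftrightarrow>
     (\<forall>u\<in>S. 0 \<le> q u) \<and>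
     (\<forall>u\<in>S. \<forall>v\<in>S. \<forall>a b. cmb a u b v \<in> S) \<and>
     (\<forall>u\<in>S. \<forall>v\<in>S. \<exists>B. \<forall>a b. q (cmb a u b v) = a\<^sup>2 * q u + 2 * a * b * B + b\<^sup>2 * q v)"

lemma quad_form_nonneg: "quad_form cmb S q \<Longrightarrow> u \<in> S \<Longrightarrow> 0 \<le> q u"
  by (auto simp: quad_form_def)

lemma quad_form_closed: "quad_form cmb S q \<Longrightarrow> u \<in> S \<Longrightarrow> v \<in> S \<Longrightarrow> cmb a u b v \<in> S"
  by (auto simp: quad_form_def)

lemma quad_formE:
  assumes "quad_form cmb S q" "u \<in> S" "v \<in> S"
  obtains B where "\<And>a b. q (cmb a u b v) = a\<^sup>2 * q u + 2 * a * b * B + b\<^sup>2 * q v"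
  using assms unfolding quad_form_def by meson

text \<open>
  A quadratic polynomial without sign change has nonpositive discriminant; applied to mixed terms
  this is the Cauchy--Schwarz inequality.
\<close>
lemma discriminant_bound:
  fixes p q B :: real
  assumes nonneg: "\<And>a b. 0 \<le> a\<^sup>2 * p + 2 * a * b * B + b\<^sup>2 * q"
  shows "\<bar>B\<bar> \<le> sqrt p * sqrt q"
proof -
  have p: "0 \<le> p" and q: "0 \<le> q"
    using nonneg[of 1 0] nonneg[of 0 1] by auto
  have "B\<^sup>2 \<le> p * q"
  proof (cases "q = 0")
    case True
    \<comment> \<open>For \<open>q = 0\<close> and \<open>a = 1\<close> the form is affine in \<open>b\<close>, with slope \<open>2 * B\<close>.\<close>
    have "B = 0"
    proof (rule ccontr)
      assume "B \<noteq> 0"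
      then show False
        using nonneg[of 1 "- (p + 1) / (2 * B)"] True by (simp add: field_simps)
    qed
    then show ?thesis using True by simp
  next
    case False
    have "0 \<le> q * (p * q - B\<^sup>2)"
      using nonneg[of q "- B"] by (simp add: power2_eq_square algebra_simps)
    then show ?thesis
      using False q by (simp add: zero_le_mult_iff)
  qed
  then have "sqrt (B\<^sup>2) \<le> sqrt (p * q)"
    by (rule real_sqrt_le_mono)
  then show ?thesis
    by (simp add: real_sqrt_mult)
qed

lemma quad_form_triangle:
  assumes q: "quad_form cmb S q" and u: "u \<in> S" and v: "v \<in> S"
  shows "sqrt (q (cmb a u b v)) \<le> \<bar>a\<bar> * sqrt (q u) + \<bar>b\<bar> * sqrt (q v)"
proof -
  obtain B where B: "\<And>a b. q (cmb a u b v) = a\<^sup>2 * q u + 2 * a * b * B + b\<^sup>2 * q v"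
    using quad_formE[OF q u v] by blast
  have "0 \<le> a\<^sup>2 * q u + 2 * a * b * B + b\<^sup>2 * q v" for a b
    using quad_form_nonneg[OF q quad_form_closed[OF q u v]] B by metis
  then have "\<bar>B\<bar> \<le> sqrt (q u) * sqrt (q v)"
    by (rule discriminant_bound)
  then have "\<bar>a * b\<bar> * \<bar>B\<bar> \<le> \<bar>a * b\<bar> * (sqrt (q u) * sqrt (q v))"
    by (rule mult_left_mono) simp
  then have "a * b * B \<le> \<bar>a\<bar> * \<bar>b\<bar> * (sqrt (q u) * sqrt (q v))"
    using abs_ge_self[of "a * b * B"] by (simp add: abs_mult)
  then have "q (cmb a u b v) \<le> (\<bar>a\<bar> * sqrt (q u) + \<bar>b\<bar> * sqrt (q v))\<^sup>2"
    using quad_form_nonneg[OF q u] quad_form_nonneg[OF q v]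
    by (simp add: B power2_sum power_mult_distrib algebra_simps)
  then show ?thesis
    by (rule real_le_lsqrt[rotated])
       (use quad_form_nonneg[OF q u] quad_form_nonneg[OF q v] in auto)
qed

text \<open>
  The identity behind strict convexity: the defect of midpoint convexity is the form at the
  difference.
\<close>
lemma quad_form_parallelogram:
  assumes q: "quad_form cmb S q" and u: "u \<in> S" and v: "v \<in> S"
  shows "q (cmb (1/2) u (1/2) v) = (q u + q v) / 2 - q (cmb 1 u (- 1) v) / 4"
proof -
  obtain B where B: "\<And>a b. q (cmb a u b v) = a\<^sup>2 * q u + 2 * a * b * B + b\<^sup>2 * q v"
    using quad_formE[OF q u v] by blast
  show ?thesis by (simp add: B power2_eq_square field_simps)
qed

lemma quad_form_add:
  assumes "quad_form cmb S p" "quad_form cmb S q"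
  shows "quad_form cmb S (\<lambda>u. p u + q u)"
  unfolding quad_form_def
proof (intro conjI ballI allI)
  fix u v a b assume uv: "u \<in> S" "v \<in> S"
  show "cmb a u b v \<in> S" using quad_form_closed[OF assms(1) uv] .
  obtain B1 where B1: "\<And>a b. p (cmb a u b v) = a\<^sup>2 * p u + 2 * a * b * B1 + b\<^sup>2 * p v"
    using quad_formE[OF assms(1) uv] by blast
  obtain B2 where B2: "\<And>a b. q (cmb a u b v) = a\<^sup>2 * q u + 2 * a * b * B2 + b\<^sup>2 * q v"
    using quad_formE[OF assms(2) uv] by blast
  show "\<exists>B. \<forall>a b. p (cmb a u b v) + q (cmb a u b v) =
      a\<^sup>2 * (p u + q u) + 2 * a * b * B + b\<^sup>2 * (p v + q v)"
    by (rule exI[of _ "B1 + B2"]) (simp add: B1 B2 algebra_simps)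
qed (use quad_form_nonneg[OF assms(1)] quad_form_nonneg[OF assms(2)] in auto)

lemma quad_form_scale:
  assumes q: "quad_form cmb S q" and c: "0 \<le> c"
  shows "quad_form cmb S (\<lambda>u. c * q u)"
  unfolding quad_form_def
proof (intro conjI ballI allI)
  fix u v a b assume uv: "u \<in> S" "v \<in> S"
  show "cmb a u b v \<in> S" using quad_form_closed[OF q uv] .
  obtain B where B: "\<And>a b. q (cmb a u b v) = a\<^sup>2 * q u + 2 * a * b * B + b\<^sup>2 * q v"
    using quad_formE[OF q uv] by blast
  show "\<exists>B. \<forall>a b. c * q (cmb a u b v) = a\<^sup>2 * (c * q u) + 2 * a * b * B + b\<^sup>2 * (c * q v)"
    by (rule exI[of _ "c * B"]) (simp add: B algebra_simps)
qed (use c quad_form_nonneg[OF q] in auto)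

lemma quad_form_sum:
  assumes ne: "\<And>u v a b. u \<in> S \<Longrightarrow> v \<in> S \<Longrightarrow> cmb a u b v \<in> S"
    and q: "\<And>i. i \<in> I \<Longrightarrow> quad_form cmb S (q i)"
  shows "quad_form cmb S (\<lambda>u. \<Sum>i\<in>I. q i u)"
proof -
  have zero: "quad_form cmb S (\<lambda>u. 0)"
    unfolding quad_form_def using ne by auto
  show ?thesis
    using q by (induction I rule: infinite_finite_induct) (auto simp: zero intro: quad_form_add)
qed

lemma quad_form_pullback:
  assumes q: "quad_form cmb' S' q"
    and closed: "\<And>u v a b. u \<in> S \<Longrightarrow> v \<in> S \<Longrightarrow> cmb a u b v \<in> S"
    and f: "\<And>u. u \<in> S \<Longrightarrow> f u \<in> S'"
    and lin: "\<And>u v a b. u \<in> S \<Longrightarrow> v \<in> S \<Longrightarrow> f (cmb a u b v) = cmb' a (f u) b (f v)"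
  shows "quad_form cmb S (\<lambda>u. q (f u))"
  using q closed f unfolding quad_form_def by (auto simp: lin)

text \<open>
  Densities that are quadratic only almost everywhere suffice, with an exceptional set depending on
  the coefficients. This is what linearity of weak derivatives provides.
\<close>
lemma quad_form_integral:
  fixes p :: "'v \<Rightarrow> 'x \<Rightarrow> real"
  assumes closed: "\<And>u v a b. u \<in> S \<Longrightarrow> v \<in> S \<Longrightarrow> cmb a u b v \<in> S"
    and int: "\<And>u. u \<in> S \<Longrightarrow> integrable M (p u)"
    and nonneg: "\<And>u. u \<in> S \<Longrightarrow> AE x in M. 0 \<le> p u x"
    and quad: "\<And>u v. u \<in> S \<Longrightarrow> v \<in> S \<Longrightarrow>
      \<exists>\<beta>. \<forall>a b. AE x in M. p (cmb a u b v) x = a\<^sup>2 * p u x + 2 * a * b * \<beta> x + b\<^sup>2 * p v x"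
  shows "quad_form cmb S (\<lambda>u. \<integral>x. p u x \<partial>M)"
  unfolding quad_form_def
proof (intro conjI ballI allI)
  fix u assume "u \<in> S" then show "0 \<le> (\<integral>x. p u x \<partial>M)"
    using nonneg by (intro integral_nonneg_AE) auto
next
  fix u v a b assume uv: "u \<in> S" "v \<in> S"
  then show "cmb a u b v \<in> S" by (rule closed)
  obtain \<beta> where \<beta>: "\<And>a b. AE x in M. p (cmb a u b v) x = a\<^sup>2 * p u x + 2 * a * b * \<beta> x + b\<^sup>2 * p v x"
    using quad[OF uv] by blast
  \<comment> \<open>The mixed term is itself a combination of integrable functions.\<close>
  define m where "m x = (p (cmb 1 u 1 v) x - p u x - p v x) / 2" for x
  have m: "integrable M m"
    unfolding m_def using int[OF uv(1)] int[OF uv(2)] int[OF closed[OF uv]] by auto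
  have "(\<integral>x. p (cmb a u b v) x \<partial>M) =
      a\<^sup>2 * (\<integral>x. p u x \<partial>M) + 2 * a * b * (\<integral>x. m x \<partial>M) + b\<^sup>2 * (\<integral>x. p v x \<partial>M)" for a b
  proof -
    have "(\<integral>x. p (cmb a u b v) x \<partial>M) = (\<integral>x. a\<^sup>2 * p u x + 2 * a * b * m x + b\<^sup>2 * p v x \<partial>M)"
    proof (rule integral_cong_AE)
      show "p (cmb a u b v) \<in> borel_measurable M"
        using int[OF closed[OF uv]] by (rule borel_measurable_integrable)
      show "(\<lambda>x. a\<^sup>2 * p u x + 2 * a * b * m x + b\<^sup>2 * p v x) \<in> borel_measurable M"
        using int[OF uv(1)] int[OF uv(2)] m by auto
      show "AE x in M. p (cmb a u b v) x = a\<^sup>2 * p u x + 2 * a * b * m x + b\<^sup>2 * p v x"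
        using \<beta>[of a b] \<beta>[of 1 1] by eventually_elim (simp add: m_def)
    qed
    then show ?thesis
      using int[OF uv(1)] int[OF uv(2)] m by simp
  qed
  then show "\<exists>B. \<forall>a b. (\<integral>x. p (cmb a u b v) x \<partial>M) =
      a\<^sup>2 * (\<integral>x. p u x \<partial>M) + 2 * a * b * B + b\<^sup>2 * (\<integral>x. p v x \<partial>M)" by blast
qed

section \<open>Minimisation and contraction\<close>

lemma is_arg_min_cong:
  assumes eq: "\<And>x. x \<in> A \<Longrightarrow> f x = g x"
  shows "is_arg_min f (\<lambda>b. b \<in> A) = is_arg_min g (\<lambda>b. b \<in> A)"
proof
  fix x
  have "(\<exists>y. y \<in> A \<and> f y < f x) \<longleftrightarrow> (\<exists>y. y \<in> A \<and> g y < g x)" if "x \<in> A"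
    by (intro ex_cong1 conj_cong refl) (simp only: eq that)
  then show "is_arg_min f (\<lambda>b. b \<in> A) x = is_arg_min g (\<lambda>b. b \<in> A) x"
    unfolding is_arg_min_def by blast
qed

text \<open>
  The uniform convexity estimate bounds the distance of two almost minimal points by the excess of
  their values over the infimum. A minimising sequence is therefore Cauchy, and two minimisers
  agree. Completeness and continuity of the functional enter together, as one condition on Cauchy
  sequences.
\<close>
lemma uniformly_convex_minimizer:
  fixes J :: "'v \<Rightarrow> real" and D :: "'v \<Rightarrow> 'v \<Rightarrow> real" and m :: "'v \<Rightarrow> 'v \<Rightarrow> 'v"
  assumes ne: "A \<noteq> {}" and J: "\<And>u. u \<in> A \<Longrightarrow> 0 \<le> J u" and c: "0 < c"
    and mid: "\<And>u v. u \<in> A \<Longrightarrow> v \<in> A \<Longrightarrow> m u v \<in> A \<and> J (m u v) \<le> (J u + J v) / 2 - c * D u v"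
    and definite: "\<And>u v. u \<in> A \<Longrightarrow> v \<in> A \<Longrightarrow> D u v \<le> 0 \<Longrightarrow> u = v"
    and complete: "\<And>X. (\<And>n. X n \<in> A) \<Longrightarrow> (\<And>e. 0 < e \<Longrightarrow> \<exists>K. \<forall>i\<ge>K. \<forall>j\<ge>K. D (X i) (X j) < e) \<Longrightarrow>
      \<exists>a\<in>A. (\<lambda>n. J (X n)) \<longlonglongrightarrow> J a"
  shows "\<exists>!w. is_arg_min J (\<lambda>b. b \<in> A) w"
proof -
  define I where "I = Inf (J ` A)"
  have bdd: "bdd_below (J ` A)" using J by (auto intro: bdd_belowI[of _ 0])
  have I_le: "I \<le> J u" if "u \<in> A" for u
    unfolding I_def using bdd that by (auto intro: cINF_lower)
  have ex: "\<exists>u\<in>A. J u < I + 1 / real (Suc n)" for n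
  proof (rule ccontr)
    assume "\<not> ?thesis"
    then have "I + 1 / real (Suc n) \<le> I"
      unfolding I_def[symmetric] by (subst (2) I_def, intro cINF_greatest) (use ne in \<open>auto simp: not_less\<close>)
    then show False by (simp add: field_simps)
  qed
  then obtain X where X: "\<And>n. X n \<in> A" "\<And>n. J (X n) < I + 1 / real (Suc n)"
    by metis
  have D_bound: "c * D u v \<le> (J u + J v) / 2 - I" if "u \<in> A" "v \<in> A" for u v
    using mid[OF that] I_le[of "m u v"] by linarith
  have "\<exists>a\<in>A. (\<lambda>n. J (X n)) \<longlonglongrightarrow> J a"
  proof (rule complete)
    fix e :: real assume e: "0 < e"
    obtain K where K: "1 / real (Suc K) < c * e"
      using reals_Archimedean[of "c * e"] c e by (auto simp: inverse_eq_divide)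
    have "D (X i) (X j) < e" if "i \<ge> K" "j \<ge> K" for i j
    proof -
      have Jn: "J (X n) < I + 1 / real (Suc K)" if "n \<ge> K" for n
        using X(2)[of n] that frac_le[of 1 1 "real (Suc K)" "real (Suc n)"] by force
      have "c * D (X i) (X j) < c * e"
        using D_bound[OF X(1)[of i] X(1)[of j]] K Jn[OF that(1)] Jn[OF that(2)] by argo
      then show ?thesis using c by simp
    qed
    then show "\<exists>K. \<forall>i\<ge>K. \<forall>j\<ge>K. D (X i) (X j) < e" by blast
  qed (rule X)
  then obtain a where a: "a \<in> A" "(\<lambda>n. J (X n)) \<longlonglongrightarrow> J a" by blast
  have lim: "(\<lambda>n. I + 1 / real (Suc n)) \<longlonglongrightarrow> I + 0"
    by (intro tendsto_add tendsto_const) (rule LIMSEQ_Suc, rule lim_1_over_n)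
  have "J a \<le> I + 0"
    by (rule LIMSEQ_le[OF a(2) lim]) (use X(2) less_imp_le in blast)
  then have Ja: "J a = I" using I_le[OF a(1)] by simp
  show ?thesis
  proof (rule ex1I)
    show "is_arg_min J (\<lambda>b. b \<in> A) a"
      unfolding is_arg_min_def using a(1) Ja I_le by (auto simp: not_less)
    fix w assume w: "is_arg_min J (\<lambda>b. b \<in> A) w"
    then have "w \<in> A" "J w = I"
      using a(1) Ja I_le[of w] by (auto simp: is_arg_min_def not_less)
    then have "c * D w a \<le> 0"
      using D_bound[of w a] a(1) Ja by simp
    then have "D w a \<le> 0" using c by (simp add: mult_le_0_iff)
    then show "w = a" using definite \<open>w \<in> A\<close> a(1) by blast
  qed
qed

text \<open>
  Banach's theorem for a distance that is a metric on \<open>A\<close> only. To apply the theorem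
  for metric spaces, whose distance must be nonnegative and symmetric on the whole type, the
  distance is reset to \<open>0\<close> outside \<open>A\<close>. The geometric estimate gives
  convergence of the iteration from every starting point.
\<close>
lemma contraction_fixed_point:
  fixes d :: "'v \<Rightarrow> 'v \<Rightarrow> real"
  assumes ne: "A \<noteq> {}" and f: "\<And>a. a \<in> A \<Longrightarrow> f a \<in> A"
    and nonneg: "\<And>a b. a \<in> A \<Longrightarrow> b \<in> A \<Longrightarrow> 0 \<le> d a b"
    and sym: "\<And>a b. a \<in> A \<Longrightarrow> b \<in> A \<Longrightarrow> d a b = d b a"
    and zero: "\<And>a b. a \<in> A \<Longrightarrow> b \<in> A \<Longrightarrow> d a b = 0 \<longleftrightarrow> a = b"
    and tri: "\<And>a b c. a \<in> A \<Longrightarrow> b \<in> A \<Longrightarrow> c \<in> A \<Longrightarrow> d a c \<le> d a b + d b c"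
    and complete: "\<And>X. (\<And>n. X n \<in> A) \<Longrightarrow> (\<And>e. 0 < e \<Longrightarrow> \<exists>K. \<forall>i\<ge>K. \<forall>j\<ge>K. d (X i) (X j) < e) \<Longrightarrow>
      \<exists>a\<in>A. (\<lambda>n. d (X n) a) \<longlonglongrightarrow> 0"
    and \<theta>: "0 < \<theta>" "\<theta> < 1"
    and contr: "\<And>a b. a \<in> A \<Longrightarrow> b \<in> A \<Longrightarrow> d (f a) (f b) \<le> \<theta> * d a b"
  shows "\<exists>a\<in>A. f a = a \<and> (\<forall>b\<in>A. f b = b \<longrightarrow> b = a) \<and>
    (\<forall>X. X 0 \<in> A \<and> (\<forall>n. X (Suc n) = f (X n)) \<longrightarrow> (\<lambda>n. d (X n) a) \<longlonglongrightarrow> 0)"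
proof -
  define d' where "d' a b = (if a \<in> A \<and> b \<in> A then d a b else 0)" for a b
  have d': "d' a b = d a b" if "a \<in> A" "b \<in> A" for a b using that by (simp add: d'_def)
  interpret M: Metric_space A d'
    by unfold_locales (auto simp: d'_def nonneg sym zero tri)
  have mcomplete: M.mcomplete
    unfolding M.mcomplete_def
  proof (intro allI impI)
    fix X assume X: "M.MCauchy X"
    then have XA: "X n \<in> A" for n by (auto simp: M.MCauchy_def)
    have "\<exists>a\<in>A. (\<lambda>n. d (X n) a) \<longlonglongrightarrow> 0"
      by (rule complete[OF XA]) (use X XA in \<open>simp add: M.MCauchy_def d'\<close>)
    then obtain a where a: "a \<in> A" "(\<lambda>n. d (X n) a) \<longlonglongrightarrow> 0" by blast
    then show "\<exists>a. limitin M.mtopology X a sequentially"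
      using XA nonneg
      by (intro exI[of _ a]) (auto simp: M.limitin_metric d' tendsto_iff)
  qed
  obtain a where a: "a \<in> A" "f a = a"
    by (rule M.Banach_fixedpoint_thm[OF mcomplete ne, of f \<theta>]) (use f \<theta> contr in \<open>auto simp: d'\<close>)
  have "b = a" if b: "b \<in> A" "f b = b" for b
  proof -
    have "d b a \<le> \<theta> * d b a" using contr[OF b(1) a(1)] a b by simp
    then have "(1 - \<theta>) * d b a \<le> 0" by (simp add: algebra_simps)
    then have "d b a = 0" using \<theta> nonneg[OF b(1) a(1)] by (simp add: mult_le_0_iff)
    then show ?thesis using zero[OF b(1) a(1)] by simp
  qed
  moreover have "(\<lambda>n. d (X n) a) \<longlonglongrightarrow> 0" if X: "X 0 \<in> A" "\<And>n. X (Suc n) = f (X n)" for X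
  proof -
    have XA: "X n \<in> A" for n by (induction n) (auto simp: X f)
    have bound: "d (X n) a \<le> \<theta> ^ n * d (X 0) a" for n
    proof (induction n)
      case (Suc n)
      have "d (X (Suc n)) a \<le> \<theta> * d (X n) a"
        using contr[OF XA[of n] a(1)] a X by simp
      also have "\<dots> \<le> \<theta> * (\<theta> ^ n * d (X 0) a)"
        using Suc \<theta> by (intro mult_left_mono) auto
      finally show ?case by simp
    qed simp
    have "(\<lambda>n. \<theta> ^ n * d (X 0) a) \<longlonglongrightarrow> 0 * d (X 0) a"
      using \<theta> by (intro tendsto_mult tendsto_const LIMSEQ_realpow_zero) auto
    then show ?thesis
      by (rule_tac tendsto_sandwich[OF _ _ tendsto_const, rotated 2])
         (use bound nonneg[OF XA a(1)] in auto)
  qed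
  ultimately show ?thesis using a by blast
qed

text \<open>
  Passes the Cauchy property from a norm to each of its summands.
\<close>
lemma Cauchy_bound_mono:
  fixes p q :: "nat \<Rightarrow> nat \<Rightarrow> real"
  assumes "\<And>i j. p i j \<le> q i j" "\<exists>K. \<forall>i\<ge>K. \<forall>j\<ge>K. q i j < e"
  shows "\<exists>K. \<forall>i\<ge>K. \<forall>j\<ge>K. p i j < e"
  using assms order.strict_trans1 by blast

section \<open>Square-integrable functions\<close>

definition L2 :: "'x measure \<Rightarrow> ('x \<Rightarrow> 'e::euclidean_space) \<Rightarrow> bool" where
  "L2 M f \<longleftrightarrow> f \<in> borel_measurable M \<and> integrable M (\<lambda>x. (norm (f x))\<^sup>2)"

lemma L2_measurable [measurable_dest]: "L2 M f \<Longrightarrow> f \<in> borel_measurable M"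
  by (simp add: L2_def)

lemma L2_integrable_norm2: "L2 M f \<Longrightarrow> integrable M (\<lambda>x. (norm (f x))\<^sup>2)"
  by (simp add: L2_def)

lemma L2_integrable_square:
  fixes f :: "'x \<Rightarrow> real"
  shows "L2 M f \<Longrightarrow> integrable M (\<lambda>x. (f x)\<^sup>2)"
  by (simp add: L2_def)

lemma norm_add_square_le:
  fixes x y :: "'e::real_normed_vector"
  shows "(norm (x + y))\<^sup>2 \<le> 2 * (norm x)\<^sup>2 + 2 * (norm y)\<^sup>2"
proof -
  have "(norm (x + y))\<^sup>2 \<le> (norm x + norm y)\<^sup>2"
    by (intro power_mono norm_triangle_ineq) auto
  also have "\<dots> \<le> 2 * (norm x)\<^sup>2 + 2 * (norm y)\<^sup>2"
    using zero_le_power2[of "norm x - norm y"] by (simp add: power2_eq_square algebra_simps)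
  finally show ?thesis .
qed

lemma L2_dominated:
  assumes f: "f \<in> borel_measurable M" and g: "integrable M g"
    and bound: "AE x in M. (norm (f x))\<^sup>2 \<le> g x"
  shows "L2 M f"
  unfolding L2_def
proof
  show "integrable M (\<lambda>x. (norm (f x))\<^sup>2)"
    by (rule Bochner_Integration.integrable_bound[OF g])
       (use f bound in \<open>auto elim!: eventually_mono\<close>)
qed (rule f)

lemma L2_add:
  assumes f: "L2 M f" and g: "L2 M g"
  shows "L2 M (\<lambda>x. f x + g x)"
  by (rule L2_dominated[where g = "\<lambda>x. 2 * (norm (f x))\<^sup>2 + 2 * (norm (g x))\<^sup>2"])
     (use f g in \<open>auto simp: L2_def norm_add_square_le\<close>)

lemma L2_bounded_linear:
  fixes T :: "'e::euclidean_space \<Rightarrow> 'f::euclidean_space"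
  assumes f: "L2 M f" and T: "bounded_linear T"
  shows "L2 M (\<lambda>x. T (f x))"
proof -
  obtain K where K: "\<And>y. norm (T y) \<le> norm y * K" using bounded_linear.bounded[OF T] by blast
  show ?thesis
  proof (rule L2_dominated[where g = "\<lambda>x. K\<^sup>2 * (norm (f x))\<^sup>2"])
    show "(\<lambda>x. T (f x)) \<in> borel_measurable M"
      by (rule measurable_compose[OF L2_measurable[OF f] borel_measurable_continuous_onI])
         (rule linear_continuous_on[OF T])
    show "integrable M (\<lambda>x. K\<^sup>2 * (norm (f x))\<^sup>2)"
      by (intro integrable_mult_right L2_integrable_norm2 f)
    have "(norm (T y))\<^sup>2 \<le> K\<^sup>2 * (norm y)\<^sup>2" for y
      using power_mono[OF K norm_ge_zero, of y 2] by (simp add: power_mult_distrib mult.commute)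
    then show "AE x in M. (norm (T (f x)))\<^sup>2 \<le> K\<^sup>2 * (norm (f x))\<^sup>2" by simp
  qed
qed

lemma L2_scaleR: "L2 M f \<Longrightarrow> L2 M (\<lambda>x. c *\<^sub>R f x)"
  by (rule L2_bounded_linear[OF _ bounded_linear_scaleR_right])

lemma L2_scaleR_vector: "L2 M h \<Longrightarrow> L2 M (\<lambda>x. h x *\<^sub>R v)" for v :: "'e::euclidean_space"
  by (rule L2_bounded_linear[OF _ bounded_linear_scaleR_left])

lemma L2_mult: "L2 M f \<Longrightarrow> L2 M (\<lambda>x. c * f x :: real)"
  using L2_scaleR[of M f c] by simp

lemma L2_uminus: "L2 M f \<Longrightarrow> L2 M (\<lambda>x. - f x)"
  by (auto simp: L2_def)

lemma L2_diff: "L2 M f \<Longrightarrow> L2 M g \<Longrightarrow> L2 M (\<lambda>x. f x - g x)"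
  using L2_add[OF _ L2_uminus, of M f g] by simp

lemma L2_zero: "L2 M (\<lambda>x. 0)"
  by (simp add: L2_def)

lemma L2_sum: "(\<And>i. i \<in> I \<Longrightarrow> L2 M (f i)) \<Longrightarrow> L2 M (\<lambda>x. \<Sum>i\<in>I. f i x)"
  by (induction I rule: infinite_finite_induct) (auto simp: L2_zero intro: L2_add)

lemma L2_bounded_mult:
  fixes f g :: "'x \<Rightarrow> real"
  assumes f: "L2 M f" and g: "g \<in> borel_measurable M" and C: "\<And>x. x \<in> space M \<Longrightarrow> \<bar>g x\<bar> \<le> C"
  shows "L2 M (\<lambda>x. g x * f x)"
proof (rule L2_dominated[where g = "\<lambda>x. C\<^sup>2 * (f x)\<^sup>2"])
  have "(g x * f x)\<^sup>2 \<le> C\<^sup>2 * (f x)\<^sup>2" if "x \<in> space M" for x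
    using C[OF that] by (simp add: power_mult_distrib abs_le_square_iff[symmetric] mult_right_mono)
  then show "AE x in M. (norm (g x * f x))\<^sup>2 \<le> C\<^sup>2 * (f x)\<^sup>2" by simp
qed (use f g in \<open>auto simp: L2_def\<close>)

lemma L2_cong_AE:
  assumes "L2 M f" "g \<in> borel_measurable M" "AE x in M. g x = f x"
  shows "L2 M g"
  using assms by (intro L2_dominated[where g = "\<lambda>x. (norm (f x))\<^sup>2"]) (auto simp: L2_def)

lemma L2_integral_cong:
  fixes f g :: "'x \<Rightarrow> real"
  assumes "L2 M f" "L2 M g" "AE x in M. f x = g x"
  shows "(\<integral>x. (f x)\<^sup>2 \<partial>M) = (\<integral>x. (g x)\<^sup>2 \<partial>M)"
proof (rule integral_cong_AE)
  show "AE x in M. (f x)\<^sup>2 = (g x)\<^sup>2" using assms(3) by eventually_elim simp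
qed (intro borel_measurable_power L2_measurable assms)+

lemma L2_integrable_product:
  fixes f g :: "'x \<Rightarrow> real"
  assumes f: "L2 M f" and g: "L2 M g"
  shows "integrable M (\<lambda>x. f x * g x)"
proof (rule Bochner_Integration.integrable_bound[where f = "\<lambda>x. (f x)\<^sup>2 + (g x)\<^sup>2"])
  have "\<bar>a * b\<bar> \<le> a\<^sup>2 + b\<^sup>2" for a b :: real
  proof -
    have "0 \<le> \<bar>a\<bar> * \<bar>b\<bar>" by simp
    moreover have "2 * (\<bar>a\<bar> * \<bar>b\<bar>) \<le> a\<^sup>2 + b\<^sup>2"
      using zero_le_power2[of "\<bar>a\<bar> - \<bar>b\<bar>"] by (simp add: power2_diff)
    ultimately show ?thesis unfolding abs_mult by linarith
  qed
  then show "AE x in M. norm (f x * g x) \<le> norm ((f x)\<^sup>2 + (g x)\<^sup>2)"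
    by simp
qed (use f g in \<open>auto simp: L2_def\<close>)

lemma L2_Cauchy_Schwarz:
  fixes f g :: "'x \<Rightarrow> real"
  assumes f: "L2 M f" and g: "L2 M g"
  shows "\<bar>\<integral>x. f x * g x \<partial>M\<bar> \<le> sqrt (\<integral>x. (f x)\<^sup>2 \<partial>M) * sqrt (\<integral>x. (g x)\<^sup>2 \<partial>M)"
proof (rule discriminant_bound)
  fix a b :: real
  have "0 \<le> (\<integral>x. (a * f x + b * g x)\<^sup>2 \<partial>M)" by simp
  also have "\<dots> = (\<integral>x. a\<^sup>2 * (f x)\<^sup>2 + 2 * a * b * (f x * g x) + b\<^sup>2 * (g x)\<^sup>2 \<partial>M)"
    by (rule Bochner_Integration.integral_cong) (auto simp: power2_eq_square algebra_simps)
  also have "\<dots> = a\<^sup>2 * (\<integral>x. (f x)\<^sup>2 \<partial>M) + 2 * a * b * (\<integral>x. f x * g x \<partial>M) + b\<^sup>2 * (\<integral>x. (g x)\<^sup>2 \<partial>M)"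
    using f g L2_integrable_product[OF f g] by (simp add: L2_def)
  finally show "0 \<le> \<dots>" .
qed

lemma L2_limit_integral:
  fixes f :: "nat \<Rightarrow> 'x \<Rightarrow> real"
  assumes f: "\<And>n. L2 M (f n)" and h: "L2 M h" and \<phi>: "L2 M \<phi>"
    and lim: "(\<lambda>n. \<integral>x. (f n x - h x)\<^sup>2 \<partial>M) \<longlonglongrightarrow> 0"
  shows "(\<lambda>n. \<integral>x. f n x * \<phi> x \<partial>M) \<longlonglongrightarrow> (\<integral>x. h x * \<phi> x \<partial>M)"
proof (rule LIM_zero_cancel, rule Lim_null_comparison)
  have eq: "(\<integral>x. f n x * \<phi> x \<partial>M) - (\<integral>x. h x * \<phi> x \<partial>M) = (\<integral>x. (f n x - h x) * \<phi> x \<partial>M)" for n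
    unfolding left_diff_distrib
    using L2_integrable_product[OF f \<phi>] L2_integrable_product[OF h \<phi>]
    by (simp add: Bochner_Integration.integral_diff)
  show "\<forall>\<^sub>F n in sequentially. norm ((\<integral>x. f n x * \<phi> x \<partial>M) - (\<integral>x. h x * \<phi> x \<partial>M)) \<le>
      sqrt (\<integral>x. (f n x - h x)\<^sup>2 \<partial>M) * sqrt (\<integral>x. (\<phi> x)\<^sup>2 \<partial>M)"
    unfolding eq using L2_Cauchy_Schwarz[OF L2_diff[OF f h] \<phi>] by simp
  have "(\<lambda>n. sqrt (\<integral>x. (f n x - h x)\<^sup>2 \<partial>M) * sqrt (\<integral>x. (\<phi> x)\<^sup>2 \<partial>M))
      \<longlonglongrightarrow> sqrt 0 * sqrt (\<integral>x. (\<phi> x)\<^sup>2 \<partial>M)"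
    by (intro tendsto_mult tendsto_const tendsto_real_sqrt lim)
  then show "(\<lambda>n. sqrt (\<integral>x. (f n x - h x)\<^sup>2 \<partial>M) * sqrt (\<integral>x. (\<phi> x)\<^sup>2 \<partial>M)) \<longlonglongrightarrow> 0"
    by simp
qed

lemma quad_form_L2_AE:
  fixes D :: "'v \<Rightarrow> 'x \<Rightarrow> real"
  assumes closed: "\<And>u v a b. u \<in> S \<Longrightarrow> v \<in> S \<Longrightarrow> cmb a u b v \<in> S"
    and L2: "\<And>u. u \<in> S \<Longrightarrow> L2 M (D u)"
    and lin: "\<And>u v a b. u \<in> S \<Longrightarrow> v \<in> S \<Longrightarrow> AE x in M. D (cmb a u b v) x = a * D u x + b * D v x"
  shows "quad_form cmb S (\<lambda>u. \<integral>x. (D u x)\<^sup>2 \<partial>M)"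
proof (rule quad_form_integral[OF closed])
  fix u v assume uv: "u \<in> S" "v \<in> S"
  have "AE x in M. (D (cmb a u b v) x)\<^sup>2 = a\<^sup>2 * (D u x)\<^sup>2 + 2 * a * b * (D u x * D v x) + b\<^sup>2 * (D v x)\<^sup>2" for a b
    using lin[OF uv, of a b] by eventually_elim (simp add: power2_eq_square algebra_simps)
  then show "\<exists>\<beta>. \<forall>a b. AE x in M. (D (cmb a u b v) x)\<^sup>2 = a\<^sup>2 * (D u x)\<^sup>2 + 2 * a * b * \<beta> x + b\<^sup>2 * (D v x)\<^sup>2"
    by (intro exI[of _ "\<lambda>x. D u x * D v x"] allI)
qed (use L2_integrable_square[OF L2] in auto)

text \<open>
  Fatou's lemma applied to \<open>(f n - f (r k))\<^sup>2\<close> as \<open>k\<close> grows. A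
  pointwise limit along a subsequence is thus the limit in \<open>L\<^sup>2\<close> of the whole
  sequence. This identifies limits whose pointwise form is known, such as the Gagliardo difference
  of a limit of weak derivatives.
\<close>
lemma L2_Cauchy_AE_limit:
  fixes f :: "nat \<Rightarrow> 'x \<Rightarrow> real"
  assumes f: "\<And>n. L2 M (f n)"
    and Cauchy: "\<And>e. 0 < e \<Longrightarrow> \<exists>K. \<forall>i\<ge>K. \<forall>j\<ge>K. (\<integral>x. (f i x - f j x)\<^sup>2 \<partial>M) < e"
    and r: "strict_mono r" and h: "h \<in> borel_measurable M"
    and lim: "AE x in M. (\<lambda>n. f (r n) x) \<longlonglongrightarrow> h x"
  shows "L2 M h" "(\<lambda>n. \<integral>x. (f n x - h x)\<^sup>2 \<partial>M) \<longlonglongrightarrow> 0"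
proof -
  have [measurable]: "f n \<in> borel_measurable M" for n using f by (rule L2_measurable)
  note [measurable] = h
  have diff: "L2 M (\<lambda>x. f i x - f j x)" for i j using f by (intro L2_diff)
  have fatou: "(\<integral>\<^sup>+x. ennreal ((f n x - h x)\<^sup>2) \<partial>M) \<le> ennreal e"
    if e: "0 < e" and K: "\<And>i j. i \<ge> K \<Longrightarrow> j \<ge> K \<Longrightarrow> (\<integral>x. (f i x - f j x)\<^sup>2 \<partial>M) < e" and n: "n \<ge> K"
    for n e K
  proof -
    have "(\<integral>\<^sup>+x. ennreal ((f n x - h x)\<^sup>2) \<partial>M) =
        (\<integral>\<^sup>+x. liminf (\<lambda>k. ennreal ((f n x - f (r k) x)\<^sup>2)) \<partial>M)"
    proof (rule nn_integral_cong_AE)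
      show "AE x in M. ennreal ((f n x - h x)\<^sup>2) = liminf (\<lambda>k. ennreal ((f n x - f (r k) x)\<^sup>2))"
        using lim
      proof eventually_elim
        case (elim x)
        then have "(\<lambda>k. ennreal ((f n x - f (r k) x)\<^sup>2)) \<longlonglongrightarrow> ennreal ((f n x - h x)\<^sup>2)"
          by (intro tendsto_intros)
        then show ?case using lim_imp_Liminf[OF sequentially_bot] by metis
      qed
    qed
    also have "\<dots> \<le> liminf (\<lambda>k. \<integral>\<^sup>+x. ennreal ((f n x - f (r k) x)\<^sup>2) \<partial>M)"
      by (rule nn_integral_liminf) measurable
    also have "\<dots> \<le> ennreal e"
    proof (rule Liminf_le)
      have "(\<integral>\<^sup>+x. ennreal ((f n x - f (r k) x)\<^sup>2) \<partial>M) \<le> ennreal e" if "k \<ge> K" for k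
      proof -
        have "r k \<ge> K" using seq_suble[OF r, of k] that by simp
        then show ?thesis
          using K[OF n, of "r k"] L2_integrable_square[OF diff[of n "r k"]]
          by (simp add: nn_integral_eq_integral ennreal_leI)
      qed
      then show "\<forall>\<^sub>F k in sequentially. (\<integral>\<^sup>+x. ennreal ((f n x - f (r k) x)\<^sup>2) \<partial>M) \<le> ennreal e"
        by (auto simp: eventually_sequentially)
    qed simp
    finally show ?thesis .
  qed
  have L2d: "L2 M (\<lambda>x. f n x - h x)" 
    if "0 < e" "\<And>i j. i \<ge> K \<Longrightarrow> j \<ge> K \<Longrightarrow> (\<integral>x. (f i x - f j x)\<^sup>2 \<partial>M) < e" "n \<ge> K" for n e K
    using order.strict_trans1[OF fatou[OF that] ennreal_less_top]
    by (simp add: L2_def integrable_iff_bounded)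
  obtain K where K: "\<And>i j. i \<ge> K \<Longrightarrow> j \<ge> K \<Longrightarrow> (\<integral>x. (f i x - f j x)\<^sup>2 \<partial>M) < 1"
    using Cauchy[of 1] by auto
  have "L2 M (\<lambda>x. f K x - (f K x - h x))"
    by (rule L2_diff[OF f L2d[OF _ K]]) auto
  then show h2: "L2 M h" by simp
  show "(\<lambda>n. \<integral>x. (f n x - h x)\<^sup>2 \<partial>M) \<longlonglongrightarrow> 0"
  proof (rule LIMSEQ_I)
    fix e :: real assume e: "0 < e"
    obtain K where K: "\<And>i j. i \<ge> K \<Longrightarrow> j \<ge> K \<Longrightarrow> (\<integral>x. (f i x - f j x)\<^sup>2 \<partial>M) < e/2"
      using Cauchy[of "e/2"] e by auto
    have "norm ((\<integral>x. (f n x - h x)\<^sup>2 \<partial>M) - 0) < e" if "n \<ge> K" for n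
    proof -
      have "ennreal (\<integral>x. (f n x - h x)\<^sup>2 \<partial>M) = (\<integral>\<^sup>+x. ennreal ((f n x - h x)\<^sup>2) \<partial>M)"
        using L2_integrable_square[OF L2_diff[OF f h2]]
        by (simp add: nn_integral_eq_integral)
      also have "\<dots> \<le> ennreal (e/2)" by (rule fatou[OF _ K that]) (use e in auto)
      finally show ?thesis using e by simp
    qed
    then show "\<exists>no. \<forall>n\<ge>no. norm ((\<integral>x. (f n x - h x)\<^sup>2 \<partial>M) - 0) < e" by blast
  qed
qed

lemma ennreal_term_le_suminf: "g n \<le> (\<Sum>n. g n)" for g :: "nat \<Rightarrow> ennreal"
  using sum_le_suminf[of g "{n}"] by simp

text \<open>
  Choose the subsequence with squared steps below \<open>16\<^sup>-\<^sup>n\<close>. Then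
  \<open>\<Sum>n. 4\<^sup>n (d n x)\<^sup>2\<close> has finite integral, so it is finite almost
  everywhere, where the steps \<open>d n x\<close> are dominated by a geometric series.
\<close>
lemma L2_Cauchy_AE_subsequence:
  fixes f :: "nat \<Rightarrow> 'x \<Rightarrow> real"
  assumes f: "\<And>n. L2 M (f n)"
    and Cauchy: "\<And>e. 0 < e \<Longrightarrow> \<exists>K. \<forall>i\<ge>K. \<forall>j\<ge>K. (\<integral>x. (f i x - f j x)\<^sup>2 \<partial>M) < e"
  obtains r where "strict_mono r" "AE x in M. convergent (\<lambda>n. f (r n) x)"
proof -
  have [measurable]: "f n \<in> borel_measurable M" for n using f by (rule L2_measurable)
  obtain K where K: "\<And>n i j. i \<ge> K n \<Longrightarrow> j \<ge> K n \<Longrightarrow> (\<integral>x. (f i x - f j x)\<^sup>2 \<partial>M) < (1/16) ^ n"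
  proof -
    have "\<forall>n. \<exists>K. \<forall>i\<ge>K. \<forall>j\<ge>K. (\<integral>x. (f i x - f j x)\<^sup>2 \<partial>M) < (1/16) ^ n"
      using Cauchy by simp
    then show ?thesis using that by metis
  qed
  define r where "r n = (\<Sum>i\<le>n. K i) + n" for n
  have r: "strict_mono r" by (rule strict_monoI_Suc) (simp add: r_def)
  have rK: "r n \<ge> K n" for n unfolding r_def by (simp add: member_le_sum trans_le_add1)
  define d where "d n x = f (r (Suc n)) x - f (r n) x" for n x
  have [measurable]: "d n \<in> borel_measurable M" for n unfolding d_def by measurable
  have d: "(\<integral>\<^sup>+x. ennreal (4 ^ n * (d n x)\<^sup>2) \<partial>M) \<le> ennreal ((1/4) ^ n)" for n
  proof -
    have "r (Suc n) \<ge> K n" using rK[of n] strict_monoD[OF r, of n "Suc n"] by simp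
    then have "(\<integral>x. (d n x)\<^sup>2 \<partial>M) < (1/16) ^ n" unfolding d_def by (intro K rK)
    then have "4 ^ n * (\<integral>x. (d n x)\<^sup>2 \<partial>M) \<le> 4 ^ n * (1/16) ^ n" by simp
    also have "\<dots> = (1/4) ^ n" by (simp add: power_mult_distrib[symmetric])
    finally have "(\<integral>x. 4 ^ n * (d n x)\<^sup>2 \<partial>M) \<le> (1/4) ^ n" by simp
    moreover have "integrable M (\<lambda>x. (d n x)\<^sup>2)"
      unfolding d_def by (intro L2_integrable_square L2_diff f)
    ultimately show ?thesis by (simp add: nn_integral_eq_integral ennreal_leI)
  qed
  have "(\<integral>\<^sup>+x. (\<Sum>n. ennreal (4 ^ n * (d n x)\<^sup>2)) \<partial>M) = (\<Sum>n. \<integral>\<^sup>+x. ennreal (4 ^ n * (d n x)\<^sup>2) \<partial>M)"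
    by (rule nn_integral_suminf) measurable
  also have "\<dots> \<le> (\<Sum>n. ennreal ((1/4) ^ n))" by (rule suminf_le) (auto intro: d)
  also have "\<dots> = ennreal (\<Sum>n. (1/4) ^ n)"
    by (rule suminf_ennreal2) (auto intro: summable_geometric)
  finally have "(\<integral>\<^sup>+x. (\<Sum>n. ennreal (4 ^ n * (d n x)\<^sup>2)) \<partial>M) \<noteq> \<infinity>"
    by (auto simp: top_unique)
  then have "AE x in M. (\<Sum>n. ennreal (4 ^ n * (d n x)\<^sup>2)) \<noteq> \<infinity>"
    by (intro nn_integral_PInf_AE) auto
  then have "AE x in M. convergent (\<lambda>n. f (r n) x)"
  proof eventually_elim
    case (elim x)
    define B where "B = enn2real (\<Sum>n. ennreal (4 ^ n * (d n x)\<^sup>2))"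
    have "\<bar>d n x\<bar> \<le> sqrt B * (1/2) ^ n" for n
    proof -
      have B: "ennreal B = (\<Sum>n. ennreal (4 ^ n * (d n x)\<^sup>2))"
        unfolding B_def by (rule ennreal_enn2real) (use elim in \<open>simp add: top.not_eq_extremum\<close>)
      have "ennreal (4 ^ n * (d n x)\<^sup>2) \<le> ennreal B"
        unfolding B by (rule ennreal_term_le_suminf)
      then have "4 ^ n * (d n x)\<^sup>2 \<le> B"
        using ennreal_le_iff[of B] by (metis B_def enn2real_nonneg)
      moreover have four: "(4::real) ^ n = 2 ^ n * 2 ^ n"
        by (subst power_mult_distrib[symmetric]) simp
      ultimately have "(2 ^ n * \<bar>d n x\<bar>)\<^sup>2 \<le> B"
        unfolding power2_eq_square four by (simp add: algebra_simps)
      then have "2 ^ n * \<bar>d n x\<bar> \<le> sqrt B" by (rule real_le_rsqrt)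
      then have "\<bar>d n x\<bar> \<le> sqrt B / 2 ^ n"
        by (subst pos_le_divide_eq) (simp_all add: mult.commute)
      then show ?thesis by (simp add: power_divide)
    qed
    then have dn: "norm (d n x) \<le> sqrt B * (1/2) ^ n" for n
      unfolding real_norm_def .
    have "summable (\<lambda>n. sqrt B * (1/2) ^ n)"
      by (rule summable_mult, rule summable_geometric) simp
    then have "summable (\<lambda>n. d n x)"
      by (rule summable_comparison_test') (rule dn)
    then have "(\<lambda>n. \<Sum>i<n. d i x) \<longlonglongrightarrow> (\<Sum>i. d i x)" by (rule summable_LIMSEQ)
    then have "(\<lambda>n. f (r 0) x + (\<Sum>i<n. d i x)) \<longlonglongrightarrow> f (r 0) x + (\<Sum>i. d i x)"
      by (intro tendsto_intros)
    moreover have "f (r 0) x + (\<Sum>i<n. d i x) = f (r n) x" for n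
      unfolding d_def using sum_lessThan_telescope[of "\<lambda>n. f (r n) x" n] by simp
    ultimately show ?case by (auto simp: convergent_def)
  qed
  then show ?thesis using r that by blast
qed

lemma L2_complete:
  fixes f :: "nat \<Rightarrow> 'x \<Rightarrow> real"
  assumes f: "\<And>n. L2 M (f n)"
    and Cauchy: "\<And>e. 0 < e \<Longrightarrow> \<exists>K. \<forall>i\<ge>K. \<forall>j\<ge>K. (\<integral>x. (f i x - f j x)\<^sup>2 \<partial>M) < e"
  obtains h r where "L2 M h" "(\<lambda>n. \<integral>x. (f n x - h x)\<^sup>2 \<partial>M) \<longlonglongrightarrow> 0"
    "strict_mono r" "AE x in M. (\<lambda>n. f (r n) x) \<longlonglongrightarrow> h x"
proof -
  have [measurable]: "f n \<in> borel_measurable M" for n using f by (rule L2_measurable)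
  obtain r where r: "strict_mono r" "AE x in M. convergent (\<lambda>n. f (r n) x)"
    using L2_Cauchy_AE_subsequence[OF f Cauchy] by blast
  define h where "h x = lim (\<lambda>n. f (r n) x)" for x
  have h: "h \<in> borel_measurable M" unfolding h_def by measurable
  have lim: "AE x in M. (\<lambda>n. f (r n) x) \<longlonglongrightarrow> h x"
    using r(2) by eventually_elim (simp add: h_def convergent_LIMSEQ_iff)
  show ?thesis
    using that[OF L2_Cauchy_AE_limit[OF f Cauchy r(1) h lim] r(1) lim] .
qed

section \<open>Smooth bump functions\<close>

text \<open>
  For \<open>t > 0\<close> this is \<open>t\<^sup>-\<^sup>k exp (- 1 / t)\<close>, in the form of a
  power divided by an exponential in \<open>1 / t\<close>. The derivatives of \<open>exp (- 1 /
  t)\<close>, extended by zero, are combinations of these functions.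
\<close>
definition flat :: "nat \<Rightarrow> real \<Rightarrow> real" where
  "flat k t = (if 0 < t then (1 / t) ^ k / exp (1 / t) else 0)"

lemma flat_tendsto_0: "(flat k \<longlongrightarrow> 0) (at 0)"
proof -
  have "((\<lambda>t. (1 / t) ^ k / exp (1 / t)) \<longlongrightarrow> 0) (at_right (0::real))"
    using filterlim_compose[OF tendsto_power_div_exp_0 filterlim_inverse_at_top_right, of k]
    by (simp add: inverse_eq_divide)
  then have "(flat k \<longlongrightarrow> 0) (at_right 0)"
    by (rule Lim_transform_eventually)
       (auto simp: flat_def eventually_at_filter)
  moreover have "(flat k \<longlongrightarrow> 0) (at_left 0)"
    by (rule Lim_transform_eventually[OF tendsto_const])
       (auto simp: flat_def eventually_at_filter)
  ultimately show ?thesis by (simp add: filterlim_at_split)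
qed

text \<open>
  At \<open>0\<close> the difference quotient of \<open>flat k\<close> is \<open>flat (k +
  1)\<close>, which tends to \<open>0\<close>.
\<close>
lemma DERIV_flat:
  "(flat k has_real_derivative flat (k + 2) t - real k * flat (k + 1) t) (at t)"
proof -
  consider "t > 0" | "t < 0" | "t = 0" by linarith
  then show ?thesis
  proof cases
    case 1
    have "((\<lambda>t. (1 / t) ^ k * exp (- (1 / t))) has_real_derivative
        flat (k + 2) t - real k * flat (k + 1) t) (at t)"
      using 1 
      apply (auto intro!: derivative_eq_intros simp: flat_def exp_minus)
      apply (cases k)
      apply (auto simp: field_simps power2_eq_square)
      done
    then show ?thesis
      by (rule has_field_derivative_transform_within_open[where S = "{0<..}"])
         (use 1 in \<open>auto simp: flat_def exp_minus divide_inverse\<close>)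
  next
    case 2
    have "((\<lambda>t. 0) has_real_derivative flat (k + 2) t - real k * flat (k + 1) t) (at t)"
      using 2 by (auto simp: flat_def)
    then show ?thesis
      by (rule has_field_derivative_transform_within_open[where S = "{..<0}"])
         (use 2 in \<open>auto simp: flat_def\<close>)
  next
    case 3
    have "((\<lambda>h. flat (k + 1) h) \<longlongrightarrow> 0) (at 0)" by (rule flat_tendsto_0)
    moreover have "flat (k + 1) h = (flat k (0 + h) - flat k 0) / h" for h
      by (auto simp: flat_def divide_simps)
    ultimately show ?thesis
      unfolding DERIV_def using 3 by (simp add: flat_def)
  qed
qed

lemma flat_0_bounds: "0 \<le> flat 0 t" "flat 0 t \<le> 1" "flat 0 t > 0 \<longleftrightarrow> t > 0"
  by (auto simp: flat_def)

text \<open>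
  An algebra that is closed under directional derivatives and contains bump functions. Smoothness of
  its members is then one induction, with no bookkeeping of orders of differentiation.
\<close>
inductive_set smooth_algebra :: "('a::euclidean_space \<Rightarrow> real) set" where
  const: "(\<lambda>x. c) \<in> smooth_algebra"
| coord: "(\<lambda>x. x \<bullet> b) \<in> smooth_algebra"
| flat: "q \<in> smooth_algebra \<Longrightarrow> (\<lambda>x. flat k (q x)) \<in> smooth_algebra"
| add: "p \<in> smooth_algebra \<Longrightarrow> q \<in> smooth_algebra \<Longrightarrow> (\<lambda>x. p x + q x) \<in> smooth_algebra"
| mult: "p \<in> smooth_algebra \<Longrightarrow> q \<in> smooth_algebra \<Longrightarrow> (\<lambda>x. p x * q x) \<in> smooth_algebra"

lemma smooth_algebra_cmult: "p \<in> smooth_algebra \<Longrightarrow> (\<lambda>x. c * p x) \<in> smooth_algebra"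
  by (intro smooth_algebra.mult smooth_algebra.const)

lemma smooth_algebra_diff:
  "p \<in> smooth_algebra \<Longrightarrow> q \<in> smooth_algebra \<Longrightarrow> (\<lambda>x. p x - q x) \<in> smooth_algebra"
  using smooth_algebra.add[of p "\<lambda>x. - 1 * q x"] smooth_algebra_cmult[of q "- 1"] by simp

lemma smooth_algebra_power: "p \<in> smooth_algebra \<Longrightarrow> (\<lambda>x. p x ^ n) \<in> smooth_algebra"
  by (induction n) (auto intro: smooth_algebra.intros)

lemma smooth_algebra_prod:
  "(\<And>i. i \<in> I \<Longrightarrow> p i \<in> smooth_algebra) \<Longrightarrow> (\<lambda>x. \<Prod>i\<in>I. p i x) \<in> smooth_algebra"
  by (induction I rule: infinite_finite_induct) (auto intro: smooth_algebra.intros)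

lemma pderiv_dirI: "(f has_derivative D) (at x) \<Longrightarrow> pderiv_dir b f x = D b"
  unfolding pderiv_dir_def using frechet_derivative_at[of f D x] by simp

lemma differentiable_has_derivative:
  "f differentiable (at x) \<Longrightarrow> (f has_derivative (\<lambda>h. pderiv_dir h f x)) (at x)"
  unfolding pderiv_dir_def using frechet_derivative_works by (metis (no_types) eta_contract_eq)

lemma smooth_algebra_derivative:
  assumes "f \<in> smooth_algebra"
  shows "(\<forall>x. f differentiable (at x)) \<and> pderiv_dir b f \<in> smooth_algebra"
  using assms
proof induction
  case (const c)
  have "((\<lambda>x. c) has_derivative (\<lambda>h. 0)) (at x)" for x :: 'a by simp
  then have "pderiv_dir b (\<lambda>x. c) = (\<lambda>x. 0)" using pderiv_dirI by fastforce
  then show ?case by (auto intro: smooth_algebra.const)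
next
  case (coord c)
  have *: "((\<lambda>x. x \<bullet> c) has_derivative (\<lambda>h. h \<bullet> c)) (at x)" for x :: 'a
    by (auto intro!: derivative_eq_intros)
  then have "pderiv_dir b (\<lambda>x. x \<bullet> c) = (\<lambda>x. b \<bullet> c)" using pderiv_dirI by fastforce
  then show ?case using * by (auto intro: smooth_algebra.const simp: differentiable_def)
next
  case (flat q k)
  have *: "((\<lambda>x. flat k (q x)) has_derivative
      (\<lambda>h. (flat (k + 2) (q x) - real k * flat (k + 1) (q x)) * pderiv_dir h q x)) (at x)" for x
    using has_derivative_compose[OF differentiable_has_derivative[of q x]
        DERIV_flat[of k "q x", unfolded has_field_derivative_def]] flat.IH
    by simp
  then have "pderiv_dir b (\<lambda>x. flat k (q x)) =
      (\<lambda>x. (flat (k + 2) (q x) - real k * flat (k + 1) (q x)) * pderiv_dir b q x)"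
    using pderiv_dirI[OF *] by fastforce
  moreover have "\<dots> \<in> smooth_algebra"
    using flat by (intro smooth_algebra.mult smooth_algebra_diff smooth_algebra_cmult smooth_algebra.flat) auto
  ultimately show ?case using * by (auto simp: differentiable_def)
next
  case (add p q)
  have *: "((\<lambda>x. p x + q x) has_derivative (\<lambda>h. pderiv_dir h p x + pderiv_dir h q x)) (at x)" for x
    using add.IH by (intro has_derivative_add differentiable_has_derivative) auto
  then have "pderiv_dir b (\<lambda>x. p x + q x) = (\<lambda>x. pderiv_dir b p x + pderiv_dir b q x)"
    using pderiv_dirI[OF *] by fastforce
  then show ?case using * add by (auto intro: smooth_algebra.add simp: differentiable_def)
next
  case (mult p q)
  have *: "((\<lambda>x. p x * q x) has_derivative
      (\<lambda>h. p x * pderiv_dir h q x + pderiv_dir h p x * q x)) (at x)" for x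
    using mult.IH by (intro has_derivative_mult differentiable_has_derivative) auto
  then have "pderiv_dir b (\<lambda>x. p x * q x) = (\<lambda>x. p x * pderiv_dir b q x + pderiv_dir b p x * q x)"
    using pderiv_dirI[OF *] by fastforce
  then show ?case
    using * mult by (auto intro!: smooth_algebra.add smooth_algebra.mult simp: differentiable_def)
qed

lemma smooth_algebra_iter_pderiv: "f \<in> smooth_algebra \<Longrightarrow> iter_pderiv bs f \<in> smooth_algebra"
  by (induction bs) (auto dest: smooth_algebra_derivative)

lemma smooth_algebra_test_function:
  assumes "f \<in> smooth_algebra" "compact K" "{x. f x \<noteq> 0} \<subseteq> K" "K \<subseteq> \<Omega>"
  shows "f \<in> test_functions \<Omega>"
proof -
  have sub: "closure {x. f x \<noteq> 0} \<subseteq> K"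
    using assms by (intro closure_minimal compact_imp_closed)
  then have "compact (closure {x. f x \<noteq> 0})"
    using compact_Int_closed[OF assms(2) closed_closure[of "{x. f x \<noteq> 0}"]] by (simp add: Int_absorb1)
  then show ?thesis
    using sub assms(4) smooth_algebra_derivative[OF smooth_algebra_iter_pderiv[OF assms(1)]]
    by (simp add: test_functions_def subset_trans)
qed

section \<open>Test functions\<close>

lemma test_function_differentiable: "\<phi> \<in> test_functions \<Omega> \<Longrightarrow> \<phi> differentiable (at x)"
proof -
  assume "\<phi> \<in> test_functions \<Omega>"
  then have "\<forall>bs\<in>lists Basis. \<forall>x. iter_pderiv bs \<phi> differentiable (at x)"
    by (simp add: test_functions_def)
  from bspec[OF this, of "[]"] show ?thesis by simp
qed

lemma iter_pderiv_append: "iter_pderiv (as @ bs) f = iter_pderiv as (iter_pderiv bs f)"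
  by (induction as) auto

lemma pderiv_dir_zero_off_support:
  assumes "x \<notin> closure {x. f x \<noteq> 0}"
  shows "pderiv_dir b f x = 0"
proof (rule pderiv_dirI[where D = "\<lambda>h. 0"])
  have "((\<lambda>x. 0) has_derivative (\<lambda>h. 0)) (at x)" by simp
  then show "(f has_derivative (\<lambda>h. 0)) (at x)"
    by (rule has_derivative_transform_within_open[where s = "- closure {x. f x \<noteq> 0}"])
       (use assms closure_subset[of "{x. f x \<noteq> 0}"] in auto)
qed

lemma test_function_iter_pderiv:
  assumes \<phi>: "\<phi> \<in> test_functions \<Omega>" and bs: "bs \<in> lists Basis"
  shows "iter_pderiv bs \<phi> \<in> test_functions \<Omega>"
proof -
  have sub: "{x. iter_pderiv bs \<phi> x \<noteq> 0} \<subseteq> closure {x. \<phi> x \<noteq> 0}" for bs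
  proof (induction bs)
    case Nil then show ?case by (simp add: closure_subset)
  next
    case (Cons b bs)
    have "x \<in> closure {x. \<phi> x \<noteq> 0}" if "pderiv_dir b (iter_pderiv bs \<phi>) x \<noteq> 0" for x
      using that pderiv_dir_zero_off_support[of x "iter_pderiv bs \<phi>" b]
        closure_minimal[OF Cons closed_closure] by blast
    then show ?case by auto
  qed
  have sub: "closure {x. iter_pderiv bs \<phi> x \<noteq> 0} \<subseteq> closure {x. \<phi> x \<noteq> 0}"
    using sub by (intro closure_minimal) auto
  have "compact (closure {x. iter_pderiv bs \<phi> x \<noteq> 0})"
    using compact_Int_closed[of "closure {x. \<phi> x \<noteq> 0}" "closure {x. iter_pderiv bs \<phi> x \<noteq> 0}"] \<phi> sub
    by (simp add: test_functions_def Int_absorb1)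
  moreover have "iter_pderiv as (iter_pderiv bs \<phi>) differentiable (at x)" if "as \<in> lists Basis" for as x
  proof -
    have "as @ bs \<in> lists Basis" using that bs by simp
    then show ?thesis
      using \<phi> unfolding iter_pderiv_append[symmetric] by (simp add: test_functions_def)
  qed
  moreover have "closure {x. \<phi> x \<noteq> 0} \<subseteq> \<Omega>" using \<phi> by (simp add: test_functions_def)
  ultimately show ?thesis
    using sub by (simp add: test_functions_def subset_trans)
qed

lemma test_function_continuous: "\<phi> \<in> test_functions \<Omega> \<Longrightarrow> continuous_on A \<phi>"
  by (intro continuous_at_imp_continuous_on ballI differentiable_imp_continuous_within test_function_differentiable)

lemma test_function_support:
  assumes "\<phi> \<in> test_functions \<Omega>"
  obtains K where "compact K" "K \<subseteq> \<Omega>" "\<And>x. x \<notin> K \<Longrightarrow> \<phi> x = 0"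
proof (rule that[of "closure {x. \<phi> x \<noteq> 0}"])
  show "\<phi> x = 0" if "x \<notin> closure {x. \<phi> x \<noteq> 0}" for x
    using that closure_subset[of "{x. \<phi> x \<noteq> 0}"] by blast
qed (use assms in \<open>simp_all add: test_functions_def\<close>)

section \<open>The fundamental lemma of the calculus of variations\<close>

text \<open>
  Boxes are closed under intersection and generate the Borel sets. So the finite measures whose
  densities are the positive and the negative part of \<open>f\<close> agree on all Borel sets.
\<close>
lemma AE_zero_of_integral_boxes:
  fixes f :: "'a::euclidean_space \<Rightarrow> real"
  assumes f: "integrable lborel f"
    and boxes: "\<And>a b. (\<integral>x. indicator (box a b) x * f x \<partial>lborel) = 0"
  shows "AE x in lborel. f x = 0"
proof -
  have [measurable]: "f \<in> borel_measurable borel"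
    using f borel_measurable_integrable by force
  define P where "P x = ennreal (max 0 (f x))" for x
  define N where "N x = ennreal (max 0 (- f x))" for x
  have [measurable]: "P \<in> borel_measurable borel" "N \<in> borel_measurable borel"
    unfolding P_def N_def by measurable
  let ?E = "range (\<lambda>(a, b). box a b :: 'a set)"
  have em: "emeasure (density lborel P) (box a b) = ennreal (\<integral>x. max 0 (f x) * indicator (box a b) x \<partial>lborel)"
     "emeasure (density lborel N) (box a b) = ennreal (\<integral>x. max 0 (- f x) * indicator (box a b) x \<partial>lborel)"
     for a b
    unfolding P_def N_def
    by (subst emeasure_density; simp add: ennreal_indicator[symmetric] ennreal_mult'[symmetric];
        subst nn_integral_eq_integral; auto intro!: integrable_real_mult_indicator f)+
  have "density lborel P = density lborel N"
  proof (rule measure_eqI_generator_eq[where E = ?E and \<Omega> = UNIV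
        and A = "\<lambda>i::nat. box (- (real i *\<^sub>R One)) (real i *\<^sub>R One)"])
    show "Int_stable ?E" by (auto simp: Int_stable_def box_Int_box)
    fix X assume "X \<in> ?E"
    then obtain a b where X: "X = box a b" by auto
    have "(\<integral>x. max 0 (f x) * indicator X x \<partial>lborel) - (\<integral>x. max 0 (- f x) * indicator X x \<partial>lborel) =
        (\<integral>x. max 0 (f x) * indicator X x - max 0 (- f x) * indicator X x \<partial>lborel)"
      unfolding X
      by (rule Bochner_Integration.integral_diff[symmetric])
         (auto intro!: integrable_real_mult_indicator f)
    also have "\<dots> = (\<integral>x. indicator X x * f x \<partial>lborel)"
      by (rule Bochner_Integration.integral_cong) (auto simp: indicator_def max_def)
    also have "\<dots> = 0" unfolding X by (rule boxes)
    finally show "emeasure (density lborel P) X = emeasure (density lborel N) X"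
      unfolding X em by simp
  next
    show "sets (density lborel P) = sigma_sets UNIV ?E" "sets (density lborel N) = sigma_sets UNIV ?E"
      by (simp_all add: borel_eq_box)
  qed (use UN_box_eq_UNIV in \<open>auto simp: em\<close>)
  then have "AE x in lborel. P x = N x"
    by (subst (asm) sigma_finite_measure.density_unique_iff[OF sigma_finite_lborel]) auto
  then show ?thesis
    by eventually_elim (auto simp: P_def N_def max_def split: if_splits)
qed

text \<open>
  A bump function \<open>\<psi>\<close> with values in \<open>[0, 1]\<close> that is positive
  exactly on the box yields test functions \<open>1 - (1 - \<psi>)\<^sup>n\<close>, which increase
  to the indicator of the box.
\<close>
lemma integral_box_zero_of_test_functions:
  fixes f :: "'a::euclidean_space \<Rightarrow> real"
  assumes f: "integrable lborel (\<lambda>x. indicator (cbox a b) x * f x)"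
    and sub: "cbox a b \<subseteq> \<Omega>"
    and test: "\<And>\<phi>. \<phi> \<in> test_functions \<Omega> \<Longrightarrow> (LINT x:\<Omega>|lborel. f x * \<phi> x) = 0"
  shows "(\<integral>x. indicator (box a b) x * f x \<partial>lborel) = 0"
proof -
  define \<psi> where "\<psi> x = (\<Prod>i\<in>Basis. flat 0 (x \<bullet> i - a \<bullet> i) * flat 0 (b \<bullet> i - x \<bullet> i))" for x
  have \<psi>: "\<psi> \<in> smooth_algebra" "0 \<le> \<psi> x" "\<psi> x \<le> 1" "\<psi> x = 0 \<longleftrightarrow> x \<notin> box a b" for x
  proof -
    show "\<psi> \<in> smooth_algebra"
      unfolding \<psi>_def
      by (intro smooth_algebra_prod smooth_algebra.mult smooth_algebra.flat smooth_algebra_diff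
          smooth_algebra.const smooth_algebra.coord)
    show "0 \<le> \<psi> x" "\<psi> x \<le> 1"
      unfolding \<psi>_def by (auto intro!: prod_nonneg prod_le_1 mult_le_one simp: flat_0_bounds)
    have "flat 0 t = 0 \<longleftrightarrow> t \<le> 0" for t using flat_0_bounds[of t] by linarith
    then show "\<psi> x = 0 \<longleftrightarrow> x \<notin> box a b"
      unfolding \<psi>_def by (auto simp: mem_box not_less)
  qed
  define \<phi> where "\<phi> n x = 1 - (1 - \<psi> x) ^ n" for n :: nat and x
  have \<phi>0: "\<phi> n x = 0" if "x \<notin> box a b" for n x
    using that \<psi>(4)[of x] by (simp add: \<phi>_def)
  have \<phi>: "\<phi> n \<in> test_functions \<Omega>" for n
  proof (rule smooth_algebra_test_function[OF _ compact_cbox _ sub])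
    show "\<phi> n \<in> smooth_algebra"
      unfolding \<phi>_def by (intro smooth_algebra_diff smooth_algebra_power smooth_algebra.const \<psi>)
    show "{x. \<phi> n x \<noteq> 0} \<subseteq> cbox a b" using \<phi>0 box_subset_cbox by blast
  qed
  have bounds: "0 \<le> \<phi> n x \<and> \<phi> n x \<le> 1" for n x
    unfolding \<phi>_def using \<psi>(2,3)[of x] by (auto intro: power_le_one)
  have zero: "(\<integral>x. indicator (cbox a b) x * f x * \<phi> n x \<partial>lborel) = 0" for n
  proof -
    have "(\<integral>x. indicator (cbox a b) x * f x * \<phi> n x \<partial>lborel) = (LINT x:\<Omega>|lborel. f x * \<phi> n x)"
      unfolding set_lebesgue_integral_def
      using sub \<phi>0 box_subset_cbox[of a b]
      by (intro Bochner_Integration.integral_cong) (auto simp: indicator_def)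
    then show ?thesis using test[OF \<phi>] by simp
  qed
  have [measurable]: "\<phi> n \<in> borel_measurable borel" for n
    using test_function_continuous[OF \<phi>] by (rule borel_measurable_continuous_onI)
  have "(\<lambda>n. \<integral>x. indicator (cbox a b) x * f x * \<phi> n x \<partial>lborel) \<longlonglongrightarrow>
      (\<integral>x. indicator (cbox a b) x * f x * indicator (box a b) x \<partial>lborel)"
  proof (rule integral_dominated_convergence)
    show "integrable lborel (\<lambda>x. \<bar>indicator (cbox a b) x * f x\<bar>)"
      using f by (rule integrable_abs)
    show "(\<lambda>x. indicator (cbox a b) x * f x * indicator (box a b) x) \<in> borel_measurable lborel"
      using borel_measurable_integrable[OF f] by measurable
    show "(\<lambda>x. indicator (cbox a b) x * f x * \<phi> n x) \<in> borel_measurable lborel" for n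
      using borel_measurable_integrable[OF f] by measurable
    show "AE x in lborel. norm (indicator (cbox a b) x * f x * \<phi> n x) \<le> \<bar>indicator (cbox a b) x * f x\<bar>" for n
      using bounds by (auto simp: abs_mult intro!: mult_left_le)
    have "(\<lambda>n. \<phi> n x) \<longlonglongrightarrow> indicator (box a b) x" for x
    proof (cases "x \<in> box a b")
      case True
      then have "0 < \<psi> x" using \<psi>(2,4)[of x] by (auto simp: less_le)
      then have "norm (1 - \<psi> x) < 1" using \<psi>(3)[of x] by simp
      then have "(\<lambda>n. (1 - \<psi> x) ^ n) \<longlonglongrightarrow> 0" by (rule LIMSEQ_power_zero)
      then have "(\<lambda>n. \<phi> n x) \<longlonglongrightarrow> 1 - 0"
        unfolding \<phi>_def by (intro tendsto_diff tendsto_const)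
      then show ?thesis using True by simp
    qed (simp add: \<phi>0)
    then show "AE x in lborel. (\<lambda>n. indicator (cbox a b) x * f x * \<phi> n x) \<longlonglongrightarrow>
        indicator (cbox a b) x * f x * indicator (box a b) x"
      by (auto intro!: tendsto_intros)
  qed
  then have "(\<integral>x. indicator (cbox a b) x * f x * indicator (box a b) x \<partial>lborel) = 0"
    unfolding zero by (simp add: LIMSEQ_const_iff)
  moreover have "(\<lambda>x. indicator (cbox a b) x * f x * indicator (box a b) x) = (\<lambda>x. indicator (box a b) x * f x)"
    using box_subset_cbox[of a b] by (auto simp: indicator_def fun_eq_iff)
  ultimately show ?thesis by simp
qed

text \<open>
  The open set is a countable union of closed boxes, on each of which all integrals over open boxes
  vanish. The boundary of a box is a null set.
\<close>
theorem fundamental_lemma_calculus_of_variations: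
  fixes f :: "'a::euclidean_space \<Rightarrow> real"
  assumes \<Omega>: "open \<Omega>"
    and f: "\<And>a b. cbox a b \<subseteq> \<Omega> \<Longrightarrow> integrable lborel (\<lambda>x. indicator (cbox a b) x * f x)"
    and test: "\<And>\<phi>. \<phi> \<in> test_functions \<Omega> \<Longrightarrow> (LINT x:\<Omega>|lborel. f x * \<phi> x) = 0"
  shows "AE x in lborel. x \<in> \<Omega> \<longrightarrow> f x = 0"
proof -
  have cbox: "AE x in lborel. x \<in> cbox l u \<longrightarrow> f x = 0" if sub: "cbox l u \<subseteq> \<Omega>" for l u
  proof -
    have "AE x in lborel. indicator (cbox l u) x * f x = 0"
    proof (rule AE_zero_of_integral_boxes)
      fix a b
      obtain c d where cd: "box a b \<inter> box l u = box c d" "cbox c d \<subseteq> cbox l u"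
      proof (cases "box a b \<inter> box l u = {}")
        case True
        \<comment> \<open>Any empty box will do, provided that its closed box is empty too.\<close>
        obtain e :: 'a where "e \<in> Basis" using nonempty_Basis by blast
        then have "box 0 (- e) = {}" "cbox 0 (- e) = {}"
          by (auto simp: box_eq_empty intro!: bexI[of _ e])
        then show ?thesis using that[of 0 "- e"] True by simp
      next
        case False
        obtain c d where cd: "box a b \<inter> box l u = box c d" by (auto simp: box_Int_box)
        then have "closure (box c d) \<subseteq> cbox l u"
          by (intro closure_minimal) (use box_subset_cbox in blast)+
        then show ?thesis using that[of c d] cd False by (simp add: closure_box)
      qed
      have "(\<integral>x. indicator (box a b) x * (indicator (cbox l u) x * f x) \<partial>lborel) =
          (\<integral>x. indicator (box c d) x * f x \<partial>lborel)"
      proof (rule integral_cong_AE)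
        show "AE x in lborel. indicator (box a b) x * (indicator (cbox l u) x * f x) = indicator (box c d) x * f x"
          using AE_not_in[OF null_sets_cbox_Diff_box[of l u]]
        proof eventually_elim
          case (elim x)
          then have "x \<in> box c d \<longleftrightarrow> x \<in> box a b \<and> x \<in> cbox l u"
            using cd(1) box_subset_cbox[of l u] by auto
          then show ?case by (auto simp: indicator_def)
        qed
        have "(\<lambda>x. indicator (box c d) x * (indicator (cbox l u) x * f x)) \<in> borel_measurable lborel"
          by (intro borel_measurable_times borel_measurable_integrable[OF f[OF sub]]) simp
        also have "(\<lambda>x. indicator (box c d) x * (indicator (cbox l u) x * f x)) = (\<lambda>x. indicator (box c d) x * f x)"
          using cd(1) box_subset_cbox[of l u] by (auto simp: indicator_def fun_eq_iff)
        finally show "(\<lambda>x. indicator (box c d) x * f x) \<in> borel_measurable lborel" .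
        show "(\<lambda>x. indicator (box a b) x * (indicator (cbox l u) x * f x)) \<in> borel_measurable lborel"
          by (intro borel_measurable_times borel_measurable_integrable[OF f[OF sub]]) simp
      qed
      also have "\<dots> = 0"
        using cd(2) sub by (intro integral_box_zero_of_test_functions[OF f _ test]) auto
      finally show "(\<integral>x. indicator (box a b) x * (indicator (cbox l u) x * f x) \<partial>lborel) = 0" .
    qed (rule f[OF sub])
    then show ?thesis by eventually_elim (auto simp: indicator_def)
  qed
  obtain D where D: "countable D" "D \<subseteq> Pow \<Omega>" "\<And>X. X \<in> D \<Longrightarrow> \<exists>a b. X = cbox a b" "\<Union>D = \<Omega>"
    using open_countable_Union_open_cbox[OF \<Omega>] by metis
  have "AE x in lborel. \<forall>X\<in>D. x \<in> X \<longrightarrow> f x = 0"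
  proof (subst AE_ball_countable[OF D(1)], intro ballI)
    fix X assume X: "X \<in> D"
    then obtain a b where "X = cbox a b" using D(3) by blast
    then show "AE x in lborel. x \<in> X \<longrightarrow> f x = 0" using cbox[of a b] X D(2) by blast
  qed
  then show ?thesis
    by eventually_elim (use D(4) in auto)
qed

section \<open>Integration by parts against test functions\<close>

text \<open>
  By translation invariance of Lebesgue measure, every difference quotient of \<open>F\<close> in
  direction \<open>b\<close> has integral zero. The quotients converge to the derivative, and by the
  mean value theorem they are dominated by a bound for the derivative on a large ball.
\<close>
lemma integral_directional_derivative_zero:
  fixes F :: "'a::euclidean_space \<Rightarrow> real"
  assumes F: "\<And>x. F differentiable (at x)" and G: "continuous_on UNIV (pderiv_dir b F)"
    and K: "compact K" "\<And>x. x \<notin> K \<Longrightarrow> F x = 0"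
  shows "(\<integral>x. pderiv_dir b F x \<partial>lborel) = 0"
proof -
  have contF: "continuous_on UNIV F"
    by (intro continuous_at_imp_continuous_on ballI differentiable_imp_continuous_within F)
  have [measurable]: "F \<in> borel_measurable borel" "pderiv_dir b F \<in> borel_measurable borel"
    using contF G by (auto intro: borel_measurable_continuous_onI)
  obtain R where R: "0 < R" "\<And>x. x \<in> K \<Longrightarrow> norm x \<le> R"
    using compact_imp_bounded[OF K(1)] by (auto simp: bounded_pos)
  have G0: "pderiv_dir b F x = 0" if "norm x > R" for x
  proof (rule pderiv_dir_zero_off_support)
    have "closure {x. F x \<noteq> 0} \<subseteq> cball 0 R"
      using K(2) R(2) by (intro closure_minimal) fastforce+
    then show "x \<notin> closure {x. F x \<noteq> 0}" using that by auto
  qed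
  obtain C where C: "0 < C" "\<And>x. \<bar>pderiv_dir b F x\<bar> \<le> C"
  proof -
    have "bounded (pderiv_dir b F ` cball 0 R)"
      by (intro compact_imp_bounded compact_continuous_image continuous_on_subset[OF G]) auto
    then obtain C where C: "0 < C" "\<And>x. x \<in> cball 0 R \<Longrightarrow> \<bar>pderiv_dir b F x\<bar> \<le> C"
      by (auto simp: bounded_pos)
    have "\<bar>pderiv_dir b F x\<bar> \<le> C" for x
      using C(1) C(2)[of x] G0[of x] by (cases "norm x \<le> R") auto
    then show ?thesis using that C(1) by blast
  qed
  define Q where "Q n x = (F (inverse (real (Suc n)) *\<^sub>R b + x) - F x) / inverse (real (Suc n))" for n x
  have intF: "integrable lborel F"
  proof -
    have "F = (\<lambda>x. indicator K x *\<^sub>R F x)" by (rule ext) (use K(2) in \<open>auto simp: indicator_def\<close>)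
    then show ?thesis
      using borel_integrable_compact[OF K(1) continuous_on_subset[OF contF]] by (metis subset_UNIV)
  qed
  have shift: "integrable lborel (\<lambda>x. F (c + x))" "(\<integral>x. F (c + x) \<partial>lborel) = (\<integral>x. F x \<partial>lborel)" for c
  proof -
    have "integrable (distr lborel borel ((+) c)) F" using intF by (simp add: lborel_distr_plus)
    then show "integrable lborel (\<lambda>x. F (c + x))"
      by (subst (asm) integrable_distr_eq) auto
    have "(\<integral>x. F x \<partial>distr lborel borel ((+) c)) = (\<integral>x. F (c + x) \<partial>lborel)"
      by (subst integral_distr) auto
    then show "(\<integral>x. F (c + x) \<partial>lborel) = (\<integral>x. F x \<partial>lborel)" by (simp add: lborel_distr_plus)
  qed
  have Q0: "(\<integral>x. Q n x \<partial>lborel) = 0" for n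
    unfolding Q_def using shift intF by (simp add: Bochner_Integration.integral_diff)
  have line: "((\<lambda>t. F (t *\<^sub>R b + x)) has_real_derivative pderiv_dir b F (t *\<^sub>R b + x)) (at t)" for t x
  proof -
    have "((\<lambda>t. t *\<^sub>R b + x) has_derivative (\<lambda>h. h *\<^sub>R b)) (at t)"
      by (auto intro!: derivative_eq_intros)
    from has_derivative_compose[OF this differentiable_has_derivative[OF F]]
    have "((\<lambda>t. F (t *\<^sub>R b + x)) has_derivative (\<lambda>h. pderiv_dir (h *\<^sub>R b) F (t *\<^sub>R b + x))) (at t)" .
    moreover have "pderiv_dir (h *\<^sub>R b) F y = pderiv_dir b F y * h" for h y
      using linear_cmul[OF linear_frechet_derivative[OF F[of y]], of h b]
      by (simp add: pderiv_dir_def)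
    ultimately show ?thesis by (simp add: has_field_derivative_def)
  qed
  have lim: "(\<lambda>n. Q n x) \<longlonglongrightarrow> pderiv_dir b F x" for x
  proof -
    have "((\<lambda>h. (F ((0 + h) *\<^sub>R b + x) - F (0 *\<^sub>R b + x)) / h) \<longlongrightarrow> pderiv_dir b F (0 *\<^sub>R b + x)) (at 0)"
      by (rule line[of x 0, unfolded DERIV_def])
    moreover have "filterlim (\<lambda>n. inverse (real (Suc n))) (at 0) sequentially"
      unfolding filterlim_at using LIMSEQ_inverse_real_of_nat by simp
    ultimately have "(\<lambda>n. (F ((0 + inverse (real (Suc n))) *\<^sub>R b + x) - F (0 *\<^sub>R b + x)) / inverse (real (Suc n)))
        \<longlonglongrightarrow> pderiv_dir b F (0 *\<^sub>R b + x)"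
      by (rule filterlim_compose)
    then show ?thesis
      unfolding Q_def by simp
  qed
  \<comment> \<open>The steps are no longer than \<open>b\<close>, so outside the larger ball both points miss the support of \<open>F\<close>.\<close>
  have bound: "norm (Q n x) \<le> C * indicator (cball 0 (R + norm b)) x" for n x
  proof -
    define h where "h = inverse (real (Suc n))"
    have h: "0 < h" "h \<le> 1" unfolding h_def by (simp_all add: inverse_le_1_iff)
    show ?thesis
    proof (cases "x \<in> cball 0 (R + norm b)")
      case True
      have "\<exists>t>0. t < h \<and> F (h *\<^sub>R b + x) - F (0 *\<^sub>R b + x) = (h - 0) * pderiv_dir b F (t *\<^sub>R b + x)"
        by (rule MVT2[OF h(1)]) (rule line)
      then obtain t where "F (h *\<^sub>R b + x) - F x = h * pderiv_dir b F (t *\<^sub>R b + x)" by auto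
      then have "Q n x = pderiv_dir b F (t *\<^sub>R b + x)"
        unfolding Q_def h_def[symmetric] using h by simp
      then show ?thesis using C(2) True by simp
    next
      case False
      have "norm x \<le> norm (h *\<^sub>R b + x) + norm (h *\<^sub>R b)"
        using norm_triangle_ineq4[of "h *\<^sub>R b + x" "h *\<^sub>R b"] by simp
      moreover have "norm (h *\<^sub>R b) \<le> norm b"
        using h by (simp add: mult_left_le_one_le)
      moreover have "R + norm b < norm x" using False by simp
      moreover have "0 \<le> norm b" by simp
      ultimately have "norm (h *\<^sub>R b + x) > R" "norm x > R" by linarith+
      then have "F (h *\<^sub>R b + x) = 0" "F x = 0"
        using K(2) R(2) not_le by blast+
      then have "Q n x = 0"
        unfolding Q_def h_def[symmetric] by simp
      then show ?thesis using False by simp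
    qed
  qed
  have int: "integrable lborel (\<lambda>x :: 'a. C * indicator (cball 0 (R + norm b)) x)"
    using emeasure_lborel_cball_finite[of "0::'a" "R + norm b"]
    by (intro integrable_mult_right integrable_real_indicator) auto
  have "(\<lambda>n. \<integral>x. Q n x \<partial>lborel) \<longlonglongrightarrow> (\<integral>x. pderiv_dir b F x \<partial>lborel)"
    by (rule integral_dominated_convergence[OF _ _ int AE_I2[OF lim] AE_I2[OF bound]])
       (simp_all add: Q_def)
  then show ?thesis unfolding Q0 by (simp add: LIMSEQ_const_iff)
qed

lemma integrable_continuous_compact_support:
  fixes f :: "'a::euclidean_space \<Rightarrow> real"
  assumes "continuous_on \<Omega> f" "compact K" "K \<subseteq> \<Omega>" "\<And>x. x \<notin> K \<Longrightarrow> f x = 0"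
  shows "integrable lborel f"
proof -
  have "f = (\<lambda>x. indicator K x *\<^sub>R f x)" by (rule ext) (use assms(4) in \<open>auto simp: indicator_def\<close>)
  then show ?thesis
    using borel_integrable_compact[OF assms(2) continuous_on_subset[OF assms(1,3)]] by metis
qed

text \<open>
  The product with a test function, extended by zero, is continuously differentiable on the whole
  space and has compact support, so its derivative integrates to zero.
\<close>
lemma integration_by_parts_test_function:
  fixes u :: "'a::euclidean_space \<Rightarrow> real"
  assumes \<Omega>: "open \<Omega>" and u: "\<And>x. x \<in> \<Omega> \<Longrightarrow> u differentiable (at x)"
    and u': "continuous_on \<Omega> (pderiv_dir b u)" and \<phi>: "\<phi> \<in> test_functions \<Omega>" and b: "b \<in> Basis"
  shows "(LINT x:\<Omega>|lborel. u x * pderiv_dir b \<phi> x) = - (LINT x:\<Omega>|lborel. pderiv_dir b u x * \<phi> x)"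
proof -
  have contu: "continuous_on \<Omega> u"
    by (intro continuous_at_imp_continuous_on ballI differentiable_imp_continuous_within u)
  have \<phi>': "pderiv_dir b \<phi> \<in> test_functions \<Omega>"
    using test_function_iter_pderiv[OF \<phi>, of "[b]"] b by simp
  obtain K where K: "compact K" "K \<subseteq> \<Omega>" "\<And>x. x \<notin> K \<Longrightarrow> \<phi> x = 0"
    using test_function_support[OF \<phi>] by blast
  have K': "pderiv_dir b \<phi> x = 0" if "x \<notin> K" for x
  proof (rule pderiv_dir_zero_off_support)
    have "closure {x. \<phi> x \<noteq> 0} \<subseteq> K" using K by (intro closure_minimal compact_imp_closed) auto
    then show "x \<notin> closure {x. \<phi> x \<noteq> 0}" using that by auto
  qed
  define F where "F x = u x * \<phi> x" for x
  have F_in: "(F has_derivative (\<lambda>h. u x * pderiv_dir h \<phi> x + pderiv_dir h u x * \<phi> x)) (at x)" if "x \<in> \<Omega>" for x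
    unfolding F_def using u[OF that] test_function_differentiable[OF \<phi>]
    by (intro has_derivative_mult differentiable_has_derivative) auto
  have F_out: "(F has_derivative (\<lambda>h. 0)) (at x)" if "x \<notin> K" for x
  proof -
    have "((\<lambda>x. 0) has_derivative (\<lambda>h. 0)) (at x)" by simp
    then show ?thesis
      by (rule has_derivative_transform_within_open[where s = "- K"])
         (use that K compact_imp_closed in \<open>auto simp: F_def\<close>)
  qed
  have F': "pderiv_dir b F x = indicator \<Omega> x * (u x * pderiv_dir b \<phi> x) + indicator \<Omega> x * (pderiv_dir b u x * \<phi> x)" for x
    using pderiv_dirI[OF F_in[of x], of b] pderiv_dirI[OF F_out[of x], of b] K(2) K(3)[of x] K'[of x]
    by (cases "x \<in> \<Omega>") auto
  have cont1: "continuous_on \<Omega> (\<lambda>x. indicator \<Omega> x * (u x * pderiv_dir b \<phi> x))"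
    using continuous_on_mult[OF contu test_function_continuous[OF \<phi>']]
    by (rule continuous_on_eq) auto
  have cont2: "continuous_on \<Omega> (\<lambda>x. indicator \<Omega> x * (pderiv_dir b u x * \<phi> x))"
    using continuous_on_mult[OF u' test_function_continuous[OF \<phi>]]
    by (rule continuous_on_eq) auto
  have "continuous_on (\<Omega> \<union> - K) (pderiv_dir b F)"
  proof (rule continuous_on_open_Un)
    show "continuous_on \<Omega> (pderiv_dir b F)"
      unfolding F' by (intro continuous_on_add cont1 cont2)
    show "continuous_on (- K) (pderiv_dir b F)"
      by (rule continuous_on_eq[OF continuous_on_const[of _ 0]]) (use pderiv_dirI[OF F_out] in auto)
  qed (use \<Omega> K compact_imp_closed in auto)
  moreover have "\<Omega> \<union> - K = UNIV" using K(2) by auto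
  ultimately have contF': "continuous_on UNIV (pderiv_dir b F)" by simp
  have "F differentiable (at x)" for x
    using F_in F_out K(2) by (cases "x \<in> \<Omega>") (auto simp: differentiable_def)
  then have "(\<integral>x. pderiv_dir b F x \<partial>lborel) = 0"
    using K by (intro integral_directional_derivative_zero[OF _ contF']) (auto simp: F_def)
  moreover have "integrable lborel (\<lambda>x. indicator \<Omega> x * (u x * pderiv_dir b \<phi> x))"
    by (rule integrable_continuous_compact_support[OF cont1 K(1,2)]) (simp add: K')
  moreover have "integrable lborel (\<lambda>x. indicator \<Omega> x * (pderiv_dir b u x * \<phi> x))"
    by (rule integrable_continuous_compact_support[OF cont2 K(1,2)]) (simp add: K)
  ultimately show ?thesis
    unfolding F' set_lebesgue_integral_def by simp
qed

section \<open>Weak derivatives and Sobolev spaces\<close>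

definition fcomb :: "real \<Rightarrow> ('x \<Rightarrow> 'e::real_vector) \<Rightarrow> real \<Rightarrow> ('x \<Rightarrow> 'e) \<Rightarrow> 'x \<Rightarrow> 'e" where
  "fcomb a u b v = (\<lambda>x. a *\<^sub>R u x + b *\<^sub>R v x)"

lemma fcomb_diff: "fcomb 1 u (- 1) v = (\<lambda>x. u x - v x)"
  by (simp add: fcomb_def)

lemma L2_fcomb: "L2 M u \<Longrightarrow> L2 M v \<Longrightarrow> L2 M (fcomb a u b v)"
  unfolding fcomb_def by (intro L2_add L2_scaleR)

lemma finite_multi_indices: "finite (multi_indices k :: 'a::euclidean_space multiset set)"
proof -
  have "multi_indices k \<subseteq> (\<lambda>bs. mset bs) ` {bs :: 'a list. set bs \<subseteq> Basis \<and> length bs \<le> k}"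
  proof
    fix \<alpha> :: "'a multiset" assume \<alpha>: "\<alpha> \<in> multi_indices k"
    obtain bs where "mset bs = \<alpha>" using ex_mset by blast
    then show "\<alpha> \<in> (\<lambda>bs. mset bs) ` {bs :: 'a list. set bs \<subseteq> Basis \<and> length bs \<le> k}"
      using \<alpha> by (auto simp: multi_indices_def)
  qed
  then show ?thesis
    by (rule finite_subset) (intro finite_imageI finite_lists_length_le finite_Basis)
qed

text \<open>
  Its square is the Gagliardo quotient, so the Slobodeckij seminorm of \<open>f\<close> is the
  \<open>L\<^sup>2\<close> norm on \<open>\<Omega> \<times> \<Omega>\<close> of a function that
  depends linearly on \<open>f\<close>.
\<close>
definition gagliardo_difference ::
    "real \<Rightarrow> ('a::euclidean_space \<Rightarrow> real) \<Rightarrow> 'a \<times> 'a \<Rightarrow> real" where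
  "gagliardo_difference \<sigma> f z =
     (f (fst z) - f (snd z)) / norm (fst z - snd z) powr ((real DIM('a) + 2 * \<sigma>) / 2)"

lemma gagliardo_quotient_eq: "gagliardo_quotient \<sigma> f z = (gagliardo_difference \<sigma> f z)\<^sup>2"
proof -
  have "(r powr (p / 2))\<^sup>2 = r powr p" for r p :: real
    by (simp add: power2_eq_square powr_add[symmetric])
  then show ?thesis
    by (simp add: gagliardo_quotient_def gagliardo_difference_def case_prod_beta power_divide)
qed

lemma gagliardo_difference_fcomb:
  "gagliardo_difference \<sigma> (fcomb a f b g) z =
     a * gagliardo_difference \<sigma> f z + b * gagliardo_difference \<sigma> g z"
  by (simp add: gagliardo_difference_def fcomb_def diff_divide_distrib add_divide_distrib algebra_simps)

locale open_domain =
  fixes \<Omega> :: "'a::euclidean_space set"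
  assumes open_\<Omega>: "open \<Omega>"
begin

abbreviation M\<Omega> :: "'a measure" where
  "M\<Omega> \<equiv> restrict_space lborel \<Omega>"

abbreviation M\<Omega>2 :: "('a \<times> 'a) measure" where
  "M\<Omega>2 \<equiv> restrict_space (lborel \<Otimes>\<^sub>M lborel) (\<Omega> \<times> \<Omega>)"

lemma sets_\<Omega> [measurable, simp]: "\<Omega> \<in> sets borel" "\<Omega> \<in> sets lborel"
  using open_\<Omega> by auto

lemma sets_\<Omega>2: "\<Omega> \<times> \<Omega> \<in> sets (lborel \<Otimes>\<^sub>M lborel)"
  by (intro pair_measureI) simp_all

lemma set_integral_eq: "(LINT x:\<Omega>|lborel. f x) = (\<integral>x. f x \<partial>M\<Omega>)" for f :: "'a \<Rightarrow> 'e::euclidean_space"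
  unfolding set_lebesgue_integral_def by (subst integral_restrict_space) simp_all

lemma measurable_M\<Omega>_iff:
  "f \<in> borel_measurable M\<Omega> \<longleftrightarrow> (\<lambda>x. indicator \<Omega> x * f x) \<in> borel_measurable borel" for f :: "'a \<Rightarrow> real"
  by (subst borel_measurable_restrict_space_iff) simp_all

lemma continuous_imp_measurable_M\<Omega>: "continuous_on \<Omega> f \<Longrightarrow> f \<in> borel_measurable M\<Omega>"
  using borel_measurable_continuous_on_restrict[of \<Omega> f]
  by (simp add: measurable_cong_sets[OF sets_restrict_space_cong[OF sets_lborel] refl])

lemma AE_M\<Omega>_iff: "(AE x in M\<Omega>. P x) \<longleftrightarrow> (AE x in lborel. x \<in> \<Omega> \<longrightarrow> P x)"
  by (subst AE_restrict_space_iff) simp_all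

lemma square_integrable_iff: "square_integrable \<Omega> f \<longleftrightarrow> L2 M\<Omega> f"
  unfolding square_integrable_def L2_def set_borel_measurable_def set_integrable_def
  by (subst integrable_restrict_space, simp, subst measurable_M\<Omega>_iff) simp

lemma is_weak_deriv_iff:
  "is_weak_deriv \<Omega> \<alpha> u w \<longleftrightarrow>
     (\<forall>\<phi>\<in>test_functions \<Omega>. \<forall>bs. mset bs = \<alpha> \<longrightarrow>
        (\<integral>x. u x * iter_pderiv bs \<phi> x \<partial>M\<Omega>) = (-1) ^ size \<alpha> * (\<integral>x. w x * \<phi> x \<partial>M\<Omega>))"
  unfolding is_weak_deriv_def set_integral_eq ..

lemma integrable_M\<Omega>I: "integrable lborel f \<Longrightarrow> integrable M\<Omega> f" for f :: "'a \<Rightarrow> real"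
  using integrable_mult_indicator[OF sets_\<Omega>(2), of f] by (subst integrable_restrict_space) simp_all

lemma test_function_L2:
  assumes \<phi>: "\<phi> \<in> test_functions \<Omega>"
  shows "L2 M\<Omega> \<phi>"
  unfolding L2_def
proof
  show "\<phi> \<in> borel_measurable M\<Omega>"
    by (rule continuous_imp_measurable_M\<Omega>[OF test_function_continuous[OF \<phi>]])
  obtain K where K: "compact K" "K \<subseteq> \<Omega>" "\<And>x. x \<notin> K \<Longrightarrow> \<phi> x = 0"
    using test_function_support[OF \<phi>] by blast
  have "integrable lborel (\<lambda>x. (\<phi> x)\<^sup>2)"
    by (rule integrable_continuous_compact_support[OF _ K(1,2)])
       (use K(3) in \<open>auto intro!: continuous_on_power test_function_continuous[OF \<phi>]\<close>)
  then show "integrable M\<Omega> (\<lambda>x. (norm (\<phi> x))\<^sup>2)"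
    by (simp add: integrable_M\<Omega>I)
qed

text \<open>
  Integrable on closed boxes inside \<open>\<Omega>\<close> and against test functions: what the
  fundamental lemma requires, and what square integrable and continuous functions have in common.
\<close>
definition locally_integrable :: "('a \<Rightarrow> real) \<Rightarrow> bool" where
  "locally_integrable f \<longleftrightarrow>
     (\<forall>a b. cbox a b \<subseteq> \<Omega> \<longrightarrow> integrable lborel (\<lambda>x. indicator (cbox a b) x * f x)) \<and>
     (\<forall>\<phi>\<in>test_functions \<Omega>. integrable M\<Omega> (\<lambda>x. f x * \<phi> x))"

lemma L2_imp_locally_integrable:
  assumes f: "L2 M\<Omega> f"
  shows "locally_integrable f"
  unfolding locally_integrable_def
proof (intro conjI allI impI ballI)
  fix a b assume sub: "cbox a b \<subseteq> \<Omega>"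
  have one: "L2 M\<Omega> (indicator (cbox a b) :: 'a \<Rightarrow> real)"
    unfolding L2_def
  proof
    have m: "(indicator (cbox a b) :: 'a \<Rightarrow> real) \<in> borel_measurable lborel" by simp
    then show "(indicator (cbox a b) :: 'a \<Rightarrow> real) \<in> borel_measurable M\<Omega>"
      by (rule measurable_restrict_space1)
    have "integrable lborel (indicator (cbox a b) :: 'a \<Rightarrow> real)"
      using emeasure_lborel_cbox_finite[of a b] by (intro integrable_real_indicator) simp_all
    moreover have "(\<lambda>x. (norm (indicator (cbox a b) x :: real))\<^sup>2) = indicator (cbox a b)"
      by (auto simp: indicator_def)
    ultimately show "integrable M\<Omega> (\<lambda>x. (norm (indicator (cbox a b) x :: real))\<^sup>2)"
      by (simp only: integrable_M\<Omega>I)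
  qed
  have "integrable M\<Omega> (\<lambda>x. indicator (cbox a b) x * f x)"
    by (rule L2_integrable_product[OF one f])
  then have "integrable lborel (\<lambda>x. indicator \<Omega> x *\<^sub>R (indicator (cbox a b) x * f x))"
    by (subst (asm) integrable_restrict_space) simp_all
  moreover have "(\<lambda>x. indicator \<Omega> x *\<^sub>R (indicator (cbox a b) x * f x)) = (\<lambda>x. indicator (cbox a b) x * f x)"
    by (rule ext) (use sub in \<open>auto simp: indicator_def\<close>)
  ultimately show "integrable lborel (\<lambda>x. indicator (cbox a b) x * f x)" by (simp only:)
next
  fix \<phi> assume "\<phi> \<in> test_functions \<Omega>"
  then show "integrable M\<Omega> (\<lambda>x. f x * \<phi> x)"
    by (intro L2_integrable_product f test_function_L2)
qed

lemma continuous_imp_locally_integrable: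
  assumes f: "continuous_on \<Omega> f"
  shows "locally_integrable f"
  unfolding locally_integrable_def
proof (intro conjI allI impI ballI)
  fix a b assume "cbox a b \<subseteq> \<Omega>"
  then show "integrable lborel (\<lambda>x. indicator (cbox a b) x * f x)"
    using borel_integrable_compact[OF compact_cbox continuous_on_subset[OF f]] by simp
next
  fix \<phi> assume \<phi>: "\<phi> \<in> test_functions \<Omega>"
  then obtain K where K: "compact K" "K \<subseteq> \<Omega>" "\<And>x. x \<notin> K \<Longrightarrow> \<phi> x = 0"
    using test_function_support by blast
  show "integrable M\<Omega> (\<lambda>x. f x * \<phi> x)"
    by (rule integrable_M\<Omega>I, rule integrable_continuous_compact_support[OF _ K(1,2)])
       (use K(3) in \<open>auto intro!: continuous_on_mult f test_function_continuous[OF \<phi>]\<close>)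
qed

lemma AE_eq_of_test_functions:
  assumes f: "locally_integrable f" and g: "locally_integrable g"
    and eq: "\<And>\<phi>. \<phi> \<in> test_functions \<Omega> \<Longrightarrow> (\<integral>x. f x * \<phi> x \<partial>M\<Omega>) = (\<integral>x. g x * \<phi> x \<partial>M\<Omega>)"
  shows "AE x in M\<Omega>. f x = g x"
proof -
  have "AE x in lborel. x \<in> \<Omega> \<longrightarrow> f x - g x = 0"
  proof (rule fundamental_lemma_calculus_of_variations[OF open_\<Omega>])
    fix a b assume sub: "cbox a b \<subseteq> \<Omega>"
    show "integrable lborel (\<lambda>x. indicator (cbox a b) x * (f x - g x))"
      using f g sub unfolding locally_integrable_def right_diff_distrib
      by (intro Bochner_Integration.integrable_diff) simp_all
  next
    fix \<phi> assume \<phi>: "\<phi> \<in> test_functions \<Omega>"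
    show "(LINT x:\<Omega>|lborel. (f x - g x) * \<phi> x) = 0"
      unfolding set_integral_eq left_diff_distrib
      using f g \<phi> eq[OF \<phi>] unfolding locally_integrable_def
      by (subst Bochner_Integration.integral_diff) simp_all
  qed
  then show ?thesis by (simp add: AE_M\<Omega>_iff)
qed

lemma is_weak_derivD:
  assumes "is_weak_deriv \<Omega> \<alpha> u w" "\<phi> \<in> test_functions \<Omega>" "mset bs = \<alpha>"
  shows "(\<integral>x. u x * iter_pderiv bs \<phi> x \<partial>M\<Omega>) = (-1) ^ size \<alpha> * (\<integral>x. w x * \<phi> x \<partial>M\<Omega>)"
  using assms(1)[unfolded is_weak_deriv_iff, rule_format, OF assms(2,3)] .

lemma weak_deriv_AE_unique:
  assumes "locally_integrable w" "locally_integrable w'"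
    and "is_weak_deriv \<Omega> \<alpha> u w" "is_weak_deriv \<Omega> \<alpha> u w'"
  shows "AE x in M\<Omega>. w x = w' x"
proof (rule AE_eq_of_test_functions[OF assms(1,2)])
  fix \<phi> assume \<phi>: "\<phi> \<in> test_functions \<Omega>"
  obtain bs where bs: "mset bs = \<alpha>" using ex_mset by blast
  have "(-1) ^ size \<alpha> * (\<integral>x. w x * \<phi> x \<partial>M\<Omega>) = (-1) ^ size \<alpha> * (\<integral>x. w' x * \<phi> x \<partial>M\<Omega>)"
    using is_weak_derivD[OF assms(3) \<phi> bs] is_weak_derivD[OF assms(4) \<phi> bs] by (rule trans[OF sym])
  then show "(\<integral>x. w x * \<phi> x \<partial>M\<Omega>) = (\<integral>x. w' x * \<phi> x \<partial>M\<Omega>)" by simp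
qed

text \<open>
  The chosen weak derivative agrees almost everywhere with any square integrable weak derivative.
  All linearity and limit properties of \<open>weak_deriv\<close> come from here.
\<close>
lemma weak_deriv_works:
  assumes "L2 M\<Omega> w" "is_weak_deriv \<Omega> \<alpha> u w"
  shows "L2 M\<Omega> (weak_deriv \<Omega> \<alpha> u)" "is_weak_deriv \<Omega> \<alpha> u (weak_deriv \<Omega> \<alpha> u)"
    "AE x in M\<Omega>. weak_deriv \<Omega> \<alpha> u x = w x"
proof -
  have ex: "\<exists>w. square_integrable \<Omega> w \<and> is_weak_deriv \<Omega> \<alpha> u w"
    by (intro exI[of _ w] conjI) (simp_all add: assms square_integrable_iff)
  have "square_integrable \<Omega> (weak_deriv \<Omega> \<alpha> u) \<and> is_weak_deriv \<Omega> \<alpha> u (weak_deriv \<Omega> \<alpha> u)"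
    unfolding weak_deriv_def by (rule someI_ex[OF ex])
  then show L2: "L2 M\<Omega> (weak_deriv \<Omega> \<alpha> u)" and weak: "is_weak_deriv \<Omega> \<alpha> u (weak_deriv \<Omega> \<alpha> u)"
    by (simp_all add: square_integrable_iff)
  show "AE x in M\<Omega>. weak_deriv \<Omega> \<alpha> u x = w x"
    by (rule weak_deriv_AE_unique[OF L2_imp_locally_integrable[OF L2]
          L2_imp_locally_integrable[OF assms(1)] weak assms(2)])
qed

lemma is_weak_deriv_fcomb:
  assumes \<alpha>: "set_mset \<alpha> \<subseteq> Basis"
    and L2: "L2 M\<Omega> u" "L2 M\<Omega> v" "L2 M\<Omega> w" "L2 M\<Omega> z"
    and weak: "is_weak_deriv \<Omega> \<alpha> u w" "is_weak_deriv \<Omega> \<alpha> v z"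
  shows "is_weak_deriv \<Omega> \<alpha> (fcomb a u b v) (fcomb a w b z)"
  unfolding is_weak_deriv_iff
proof (intro ballI allI impI)
  fix \<phi> bs assume \<phi>: "\<phi> \<in> test_functions \<Omega>" and bs: "mset bs = \<alpha>"
  have "bs \<in> lists Basis" using bs \<alpha> by auto
  then have D\<phi>: "L2 M\<Omega> (iter_pderiv bs \<phi>)"
    by (intro test_function_L2 test_function_iter_pderiv \<phi>)
  have lin: "(\<integral>x. fcomb a f b g x * h x \<partial>M\<Omega>) = a * (\<integral>x. f x * h x \<partial>M\<Omega>) + b * (\<integral>x. g x * h x \<partial>M\<Omega>)"
    if "L2 M\<Omega> f" "L2 M\<Omega> g" "L2 M\<Omega> h" for f g h :: "'a \<Rightarrow> real"
  proof -
    have "(\<integral>x. fcomb a f b g x * h x \<partial>M\<Omega>) = (\<integral>x. a * (f x * h x) + b * (g x * h x) \<partial>M\<Omega>)"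
      by (intro Bochner_Integration.integral_cong) (auto simp: fcomb_def algebra_simps)
    then show ?thesis
      using L2_integrable_product[OF that(1,3)] L2_integrable_product[OF that(2,3)] by simp
  qed
  have "(\<integral>x. u x * iter_pderiv bs \<phi> x \<partial>M\<Omega>) = (- 1) ^ size \<alpha> * (\<integral>x. w x * \<phi> x \<partial>M\<Omega>)"
    "(\<integral>x. v x * iter_pderiv bs \<phi> x \<partial>M\<Omega>) = (- 1) ^ size \<alpha> * (\<integral>x. z x * \<phi> x \<partial>M\<Omega>)"
    by (rule is_weak_derivD[OF weak(1) \<phi> bs], rule is_weak_derivD[OF weak(2) \<phi> bs])
  then show "(\<integral>x. fcomb a u b v x * iter_pderiv bs \<phi> x \<partial>M\<Omega>) =
      (- 1) ^ size \<alpha> * (\<integral>x. fcomb a w b z x * \<phi> x \<partial>M\<Omega>)"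
    unfolding lin[OF L2(1,2) D\<phi>] lin[OF L2(3,4) test_function_L2[OF \<phi>]]
    by (simp add: algebra_simps)
qed

lemma is_weak_deriv_limit:
  assumes \<alpha>: "set_mset \<alpha> \<subseteq> Basis"
    and L2: "\<And>n. L2 M\<Omega> (u n)" "\<And>n. L2 M\<Omega> (w n)" "L2 M\<Omega> u'" "L2 M\<Omega> w'"
    and weak: "\<And>n. is_weak_deriv \<Omega> \<alpha> (u n) (w n)"
    and lim: "(\<lambda>n. \<integral>x. (u n x - u' x)\<^sup>2 \<partial>M\<Omega>) \<longlonglongrightarrow> 0" "(\<lambda>n. \<integral>x. (w n x - w' x)\<^sup>2 \<partial>M\<Omega>) \<longlonglongrightarrow> 0"
  shows "is_weak_deriv \<Omega> \<alpha> u' w'"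
  unfolding is_weak_deriv_iff
proof (intro ballI allI impI)
  fix \<phi> bs assume \<phi>: "\<phi> \<in> test_functions \<Omega>" and bs: "mset bs = \<alpha>"
  have "bs \<in> lists Basis" using bs \<alpha> by auto
  then have D\<phi>: "L2 M\<Omega> (iter_pderiv bs \<phi>)"
    by (intro test_function_L2 test_function_iter_pderiv \<phi>)
  have eq: "(\<integral>x. u n x * iter_pderiv bs \<phi> x \<partial>M\<Omega>) = (- 1) ^ size \<alpha> * (\<integral>x. w n x * \<phi> x \<partial>M\<Omega>)" for n
    by (rule is_weak_derivD[OF weak \<phi> bs])
  have "(\<lambda>n. \<integral>x. u n x * iter_pderiv bs \<phi> x \<partial>M\<Omega>) \<longlonglongrightarrow> (\<integral>x. u' x * iter_pderiv bs \<phi> x \<partial>M\<Omega>)"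
    by (rule L2_limit_integral[OF L2(1,3) D\<phi> lim(1)])
  moreover have "(\<lambda>n. \<integral>x. u n x * iter_pderiv bs \<phi> x \<partial>M\<Omega>) \<longlonglongrightarrow> (- 1) ^ size \<alpha> * (\<integral>x. w' x * \<phi> x \<partial>M\<Omega>)"
    unfolding eq by (intro tendsto_mult tendsto_const L2_limit_integral[OF L2(2,4) test_function_L2[OF \<phi>] lim(2)])
  ultimately show "(\<integral>x. u' x * iter_pderiv bs \<phi> x \<partial>M\<Omega>) = (- 1) ^ size \<alpha> * (\<integral>x. w' x * \<phi> x \<partial>M\<Omega>)"
    by (rule LIMSEQ_unique)
qed

lemma gagliardo_difference_measurable:
  assumes f: "f \<in> borel_measurable M\<Omega>"
  shows "gagliardo_difference \<sigma> f \<in> borel_measurable M\<Omega>2"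
proof -
  define g where "g x = indicator \<Omega> x * f x" for x
  have [measurable]: "g \<in> borel_measurable borel"
    using f unfolding g_def measurable_M\<Omega>_iff .
  have "gagliardo_difference \<sigma> g \<in> borel_measurable (borel \<Otimes>\<^sub>M borel)"
    unfolding gagliardo_difference_def by measurable
  then have g: "gagliardo_difference \<sigma> g \<in> borel_measurable (lborel \<Otimes>\<^sub>M lborel)"
    by (simp cong: measurable_cong_sets sets_pair_measure_cong)
  have g2: "gagliardo_difference \<sigma> g \<in> borel_measurable M\<Omega>2"
    by (rule measurable_restrict_space1[OF g])
  have "gagliardo_difference \<sigma> g z = gagliardo_difference \<sigma> f z" if "z \<in> space M\<Omega>2" for z
    using that by (auto simp: gagliardo_difference_def g_def space_restrict_space)
  then show ?thesis
    using measurable_cong[of M\<Omega>2 "gagliardo_difference \<sigma> g" "gagliardo_difference \<sigma> f" borel] g2 by blast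
qed

text \<open>
  The points of \<open>\<Omega> \<times> \<Omega>\<close> with one coordinate in a given null set
  form a null set.
\<close>
lemma AE_M\<Omega>2:
  assumes "AE x in M\<Omega>. P x"
  shows "AE z in M\<Omega>2. P (fst z) \<and> P (snd z)"
proof -
  have "AE x in lborel. x \<in> \<Omega> \<longrightarrow> P x" using assms by (simp add: AE_M\<Omega>_iff)
  then obtain N where N: "N \<in> null_sets lborel" "{x. \<not> (x \<in> \<Omega> \<longrightarrow> P x)} \<subseteq> N"
    by (auto simp: eventually_ae_filter)
  interpret pair_sigma_finite "lborel :: 'a measure" "lborel :: 'a measure"
    by unfold_locales
  have "N \<times> UNIV \<in> null_sets (lborel \<Otimes>\<^sub>M lborel)" "UNIV \<times> N \<in> null_sets (lborel \<Otimes>\<^sub>M lborel)"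
    using N(1) by (auto simp: null_sets_def lborel.emeasure_pair_measure_Times intro!: pair_measureI)
  then have "N \<times> UNIV \<union> UNIV \<times> N \<in> null_sets (lborel \<Otimes>\<^sub>M lborel)" by (rule null_sets.Un)
  then have "AE z in lborel \<Otimes>\<^sub>M lborel. z \<notin> N \<times> UNIV \<union> UNIV \<times> N" by (rule AE_not_in)
  then have "AE z in lborel \<Otimes>\<^sub>M lborel. z \<in> \<Omega> \<times> \<Omega> \<longrightarrow> P (fst z) \<and> P (snd z)"
    by eventually_elim (use N(2) in auto)
  then show ?thesis
    using sets_\<Omega>2 by (subst AE_restrict_space_iff) (simp_all add: space_pair_measure)
qed

lemma gagliardo_difference_AE_cong:
  assumes "AE x in M\<Omega>. f x = g x"
  shows "AE z in M\<Omega>2. gagliardo_difference \<sigma> f z = gagliardo_difference \<sigma> g z"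
  using AE_M\<Omega>2[OF assms] by eventually_elim (simp add: gagliardo_difference_def)

text \<open>
  The multi-indices that contribute a Gagliardo seminorm: those of maximal order, and none at all
  when the smoothness \<open>s\<close> is an integer.
\<close>
abbreviation top_indices :: "real \<Rightarrow> 'a multiset set" where
  "top_indices s \<equiv> {\<alpha> \<in> multi_indices (nat \<lfloor>s\<rfloor>). size \<alpha> = nat \<lfloor>s\<rfloor> \<and> frac s > 0}"

lemma sobolev_norm2_eq:
  "sobolev_norm2 \<Omega> s u =
     (\<Sum>\<alpha>\<in>multi_indices (nat \<lfloor>s\<rfloor>). \<integral>x. (weak_deriv \<Omega> \<alpha> u x)\<^sup>2 \<partial>M\<Omega>) +
     (\<Sum>\<alpha>\<in>top_indices s. \<integral>z. (gagliardo_difference (frac s) (weak_deriv \<Omega> \<alpha> u) z)\<^sup>2 \<partial>M\<Omega>2)"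
proof -
  have "(LINT z:\<Omega> \<times> \<Omega>|lborel \<Otimes>\<^sub>M lborel. gagliardo_quotient (frac s) f z) =
      (\<integral>z. (gagliardo_difference (frac s) f z)\<^sup>2 \<partial>M\<Omega>2)" for f
    unfolding set_lebesgue_integral_def
    using sets_\<Omega>2 by (subst integral_restrict_space) (simp_all add: gagliardo_quotient_eq space_pair_measure)
  then show ?thesis
    unfolding sobolev_norm2_def set_integral_eq by simp
qed

lemma gagliardo_integrable_iff:
  assumes "f \<in> borel_measurable M\<Omega>"
  shows "set_integrable (lborel \<Otimes>\<^sub>M lborel) (\<Omega> \<times> \<Omega>) (gagliardo_quotient \<sigma> f) \<longleftrightarrow>
    L2 M\<Omega>2 (gagliardo_difference \<sigma> f)"
proof -
  have "integrable M\<Omega>2 (\<lambda>z. (gagliardo_difference \<sigma> f z)\<^sup>2) \<longleftrightarrow>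
      set_integrable (lborel \<Otimes>\<^sub>M lborel) (\<Omega> \<times> \<Omega>) (gagliardo_quotient \<sigma> f)"
    unfolding set_integrable_def
    using sets_\<Omega>2 by (subst integrable_restrict_space) (simp_all add: gagliardo_quotient_eq space_pair_measure)
  then show ?thesis
    using gagliardo_difference_measurable[OF assms] by (simp add: L2_def)
qed

lemma sobolevD:
  assumes u: "u \<in> sobolev \<Omega> s"
  shows "L2 M\<Omega> u"
    and "\<alpha> \<in> multi_indices (nat \<lfloor>s\<rfloor>) \<Longrightarrow> L2 M\<Omega> (weak_deriv \<Omega> \<alpha> u)"
    and "\<alpha> \<in> multi_indices (nat \<lfloor>s\<rfloor>) \<Longrightarrow> is_weak_deriv \<Omega> \<alpha> u (weak_deriv \<Omega> \<alpha> u)"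
    and "\<alpha> \<in> top_indices s \<Longrightarrow> L2 M\<Omega>2 (gagliardo_difference (frac s) (weak_deriv \<Omega> \<alpha> u))"
proof -
  note U = CollectD[OF u[unfolded sobolev_def]]
  show "L2 M\<Omega> u" using conjunct1[OF U] by (simp only: square_integrable_iff)
  have *: "L2 M\<Omega> (weak_deriv \<Omega> \<alpha> u)" "is_weak_deriv \<Omega> \<alpha> u (weak_deriv \<Omega> \<alpha> u)"
    if \<alpha>: "\<alpha> \<in> multi_indices (nat \<lfloor>s\<rfloor>)" for \<alpha>
  proof -
    obtain w where w: "square_integrable \<Omega> w" "is_weak_deriv \<Omega> \<alpha> u w"
      using bspec[OF conjunct1[OF conjunct2[OF U]] \<alpha>] by blast
    note wd = weak_deriv_works[OF w(1)[unfolded square_integrable_iff] w(2)]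
    show "L2 M\<Omega> (weak_deriv \<Omega> \<alpha> u)" "is_weak_deriv \<Omega> \<alpha> u (weak_deriv \<Omega> \<alpha> u)"
      by (rule wd(1), rule wd(2))
  qed
  show "\<alpha> \<in> multi_indices (nat \<lfloor>s\<rfloor>) \<Longrightarrow> L2 M\<Omega> (weak_deriv \<Omega> \<alpha> u)"
    by (rule *(1))
  show "\<alpha> \<in> multi_indices (nat \<lfloor>s\<rfloor>) \<Longrightarrow> is_weak_deriv \<Omega> \<alpha> u (weak_deriv \<Omega> \<alpha> u)"
    by (rule *(2))
  assume "\<alpha> \<in> top_indices s"
  then have \<alpha>: "\<alpha> \<in> multi_indices (nat \<lfloor>s\<rfloor>)" "size \<alpha> = nat \<lfloor>s\<rfloor>" "0 < frac s" by blast+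
  have "set_integrable (lborel \<Otimes>\<^sub>M lborel) (\<Omega> \<times> \<Omega>) (gagliardo_quotient (frac s) (weak_deriv \<Omega> \<alpha> u))"
    using bspec[OF mp[OF conjunct2[OF conjunct2[OF U]] \<alpha>(3)] \<alpha>(1)] \<alpha>(2) by (rule mp)
  then show "L2 M\<Omega>2 (gagliardo_difference (frac s) (weak_deriv \<Omega> \<alpha> u))"
    unfolding gagliardo_integrable_iff[OF L2_measurable[OF *(1)[OF \<alpha>(1)]]] .
qed

text \<open>
  Membership may be checked on any family of weak derivatives in place of the chosen one.
\<close>
lemma sobolevI:
  assumes u: "L2 M\<Omega> u"
    and w: "\<And>\<alpha>. \<alpha> \<in> multi_indices (nat \<lfloor>s\<rfloor>) \<Longrightarrow> L2 M\<Omega> (w \<alpha>) \<and> is_weak_deriv \<Omega> \<alpha> u (w \<alpha>)"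
    and top: "\<And>\<alpha>. \<alpha> \<in> top_indices s \<Longrightarrow> L2 M\<Omega>2 (gagliardo_difference (frac s) (w \<alpha>))"
  shows "u \<in> sobolev \<Omega> s"
  unfolding sobolev_def mem_Collect_eq
proof (intro conjI ballI impI)
  show "square_integrable \<Omega> u" using u by (simp only: square_integrable_iff)
  fix \<alpha> :: "'a multiset" assume \<alpha>: "\<alpha> \<in> multi_indices (nat \<lfloor>s\<rfloor>)"
  have w\<alpha>: "L2 M\<Omega> (w \<alpha>)" "is_weak_deriv \<Omega> \<alpha> u (w \<alpha>)" using w[OF \<alpha>] by blast+
  show "\<exists>w. square_integrable \<Omega> w \<and> is_weak_deriv \<Omega> \<alpha> u w"
    using w\<alpha> unfolding square_integrable_iff by blast
  assume "0 < frac s" "size \<alpha> = nat \<lfloor>s\<rfloor>"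
  then have top': "\<alpha> \<in> top_indices s" using \<alpha> by blast
  note wd = weak_deriv_works[OF w\<alpha>]
  have "L2 M\<Omega>2 (gagliardo_difference (frac s) (weak_deriv \<Omega> \<alpha> u))"
    by (rule L2_cong_AE[OF top[OF top'] gagliardo_difference_measurable[OF L2_measurable[OF wd(1)]]
          gagliardo_difference_AE_cong[OF wd(3)]])
  then show "set_integrable (lborel \<Otimes>\<^sub>M lborel) (\<Omega> \<times> \<Omega>) (gagliardo_quotient (frac s) (weak_deriv \<Omega> \<alpha> u))"
    unfolding gagliardo_integrable_iff[OF L2_measurable[OF wd(1)]] .
qed

lemma multi_indices_Basis: "\<alpha> \<in> multi_indices k \<Longrightarrow> set_mset \<alpha> \<subseteq> Basis"
  by (simp add: multi_indices_def)

lemma sobolev_fcomb: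
  assumes u: "u \<in> sobolev \<Omega> s" and v: "v \<in> sobolev \<Omega> s"
  shows "fcomb a u b v \<in> sobolev \<Omega> s"
    and "\<alpha> \<in> multi_indices (nat \<lfloor>s\<rfloor>) \<Longrightarrow>
      AE x in M\<Omega>. weak_deriv \<Omega> \<alpha> (fcomb a u b v) x = a * weak_deriv \<Omega> \<alpha> u x + b * weak_deriv \<Omega> \<alpha> v x"
proof -
  have *: "L2 M\<Omega> (fcomb a (weak_deriv \<Omega> \<alpha> u) b (weak_deriv \<Omega> \<alpha> v)) \<and>
      is_weak_deriv \<Omega> \<alpha> (fcomb a u b v) (fcomb a (weak_deriv \<Omega> \<alpha> u) b (weak_deriv \<Omega> \<alpha> v))"
    if \<alpha>: "\<alpha> \<in> multi_indices (nat \<lfloor>s\<rfloor>)" for \<alpha>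
    by (intro conjI L2_fcomb is_weak_deriv_fcomb multi_indices_Basis[OF \<alpha>] sobolevD(1)[OF u] sobolevD(1)[OF v]
        sobolevD(2)[OF u \<alpha>] sobolevD(2)[OF v \<alpha>] sobolevD(3)[OF u \<alpha>] sobolevD(3)[OF v \<alpha>])
  show "fcomb a u b v \<in> sobolev \<Omega> s"
  proof (rule sobolevI[OF L2_fcomb[OF sobolevD(1)[OF u] sobolevD(1)[OF v]] *])
    fix \<alpha> assume \<alpha>: "\<alpha> \<in> top_indices s"
    show "L2 M\<Omega>2 (gagliardo_difference (frac s) (fcomb a (weak_deriv \<Omega> \<alpha> u) b (weak_deriv \<Omega> \<alpha> v)))"
      unfolding gagliardo_difference_fcomb[abs_def]
      by (intro L2_add L2_mult sobolevD(4)[OF u \<alpha>] sobolevD(4)[OF v \<alpha>])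
  qed
  assume \<alpha>: "\<alpha> \<in> multi_indices (nat \<lfloor>s\<rfloor>)"
  have "AE x in M\<Omega>. weak_deriv \<Omega> \<alpha> (fcomb a u b v) x = fcomb a (weak_deriv \<Omega> \<alpha> u) b (weak_deriv \<Omega> \<alpha> v) x"
    by (rule weak_deriv_works(3)) (use *[OF \<alpha>] in blast)+
  then show "AE x in M\<Omega>. weak_deriv \<Omega> \<alpha> (fcomb a u b v) x = a * weak_deriv \<Omega> \<alpha> u x + b * weak_deriv \<Omega> \<alpha> v x"
    unfolding fcomb_def real_scaleR_def .
qed

lemma gagliardo_sobolev_fcomb:
  assumes u: "u \<in> sobolev \<Omega> s" and v: "v \<in> sobolev \<Omega> s" and \<alpha>: "\<alpha> \<in> top_indices s"
  shows "AE z in M\<Omega>2. gagliardo_difference (frac s) (weak_deriv \<Omega> \<alpha> (fcomb a u b v)) z =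
    a * gagliardo_difference (frac s) (weak_deriv \<Omega> \<alpha> u) z +
    b * gagliardo_difference (frac s) (weak_deriv \<Omega> \<alpha> v) z"
proof -
  have "AE x in M\<Omega>. weak_deriv \<Omega> \<alpha> (fcomb a u b v) x =
      fcomb a (weak_deriv \<Omega> \<alpha> u) b (weak_deriv \<Omega> \<alpha> v) x"
    using sobolev_fcomb(2)[OF u v, of \<alpha> a b] \<alpha> unfolding fcomb_def real_scaleR_def by blast
  from gagliardo_difference_AE_cong[OF this] show ?thesis
    unfolding gagliardo_difference_fcomb .
qed

text \<open>
  The squared norm is a sum of squared \<open>L\<^sup>2\<close> norms of functions depending
  linearly on \<open>u\<close> up to null sets.
\<close>
lemma quad_form_sobolev: "quad_form fcomb (sobolev \<Omega> s) (sobolev_norm2 \<Omega> s)"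
proof -
  have closed: "fcomb a u b v \<in> sobolev \<Omega> s" if "u \<in> sobolev \<Omega> s" "v \<in> sobolev \<Omega> s" for a b u v
    using sobolev_fcomb(1)[OF that] .
  have "quad_form fcomb (sobolev \<Omega> s) (\<lambda>u. \<integral>x. (weak_deriv \<Omega> \<alpha> u x)\<^sup>2 \<partial>M\<Omega>)"
    if \<alpha>: "\<alpha> \<in> multi_indices (nat \<lfloor>s\<rfloor>)" for \<alpha>
    by (rule quad_form_L2_AE[where D = "weak_deriv \<Omega> \<alpha>"])
       (rule closed sobolevD(2)[OF _ \<alpha>] sobolev_fcomb(2)[OF _ _ \<alpha>]; assumption)+
  moreover have "quad_form fcomb (sobolev \<Omega> s)
      (\<lambda>u. \<integral>z. (gagliardo_difference (frac s) (weak_deriv \<Omega> \<alpha> u) z)\<^sup>2 \<partial>M\<Omega>2)"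
    if \<alpha>: "\<alpha> \<in> top_indices s" for \<alpha>
    by (rule quad_form_L2_AE[where D = "\<lambda>u. gagliardo_difference (frac s) (weak_deriv \<Omega> \<alpha> u)"])
       (rule closed sobolevD(4)[OF _ \<alpha>] gagliardo_sobolev_fcomb[OF _ _ \<alpha>]; assumption)+
  ultimately have "quad_form fcomb (sobolev \<Omega> s) (\<lambda>u.
     (\<Sum>\<alpha>\<in>multi_indices (nat \<lfloor>s\<rfloor>). \<integral>x. (weak_deriv \<Omega> \<alpha> u x)\<^sup>2 \<partial>M\<Omega>) +
     (\<Sum>\<alpha>\<in>top_indices s. \<integral>z. (gagliardo_difference (frac s) (weak_deriv \<Omega> \<alpha> u) z)\<^sup>2 \<partial>M\<Omega>2))"
    by (intro quad_form_add quad_form_sum closed)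
  then show ?thesis unfolding sobolev_norm2_eq[abs_def] .
qed

lemma weak_deriv_integral_le_sobolev_norm2:
  assumes "\<alpha> \<in> multi_indices (nat \<lfloor>s\<rfloor>)"
  shows "(\<integral>x. (weak_deriv \<Omega> \<alpha> u x)\<^sup>2 \<partial>M\<Omega>) \<le> sobolev_norm2 \<Omega> s u"
  unfolding sobolev_norm2_eq
  by (rule order.trans[OF member_le_sum[OF assms] add_increasing2])
     (simp_all add: finite_multi_indices sum_nonneg)

lemma finite_top_indices: "finite (top_indices s)"
  by (rule finite_subset[OF _ finite_multi_indices]) blast

lemma gagliardo_integral_le_sobolev_norm2:
  assumes "\<alpha> \<in> top_indices s"
  shows "(\<integral>z. (gagliardo_difference (frac s) (weak_deriv \<Omega> \<alpha> u) z)\<^sup>2 \<partial>M\<Omega>2) \<le> sobolev_norm2 \<Omega> s u"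
  unfolding sobolev_norm2_eq
  by (rule order.trans[OF member_le_sum[OF assms _ finite_top_indices] add_increasing])
     (simp_all add: sum_nonneg)

lemma empty_multi_index: "{#} \<in> multi_indices k"
  by (simp add: multi_indices_def)

lemma weak_deriv_empty:
  assumes "L2 M\<Omega> u"
  shows "AE x in M\<Omega>. weak_deriv \<Omega> {#} u x = u x"
  by (rule weak_deriv_works(3)[OF assms]) (simp add: is_weak_deriv_iff)

lemma sobolev_norm2_eq_0_imp:
  assumes u: "u \<in> sobolev \<Omega> s" and 0: "sobolev_norm2 \<Omega> s u \<le> 0"
  shows "AE x in M\<Omega>. u x = 0"
proof -
  have L2: "L2 M\<Omega> (weak_deriv \<Omega> {#} u)" by (rule sobolevD(2)[OF u empty_multi_index])
  have "0 \<le> (\<integral>x. (weak_deriv \<Omega> {#} u x)\<^sup>2 \<partial>M\<Omega>)" by simp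
  then have "(\<integral>x. (weak_deriv \<Omega> {#} u x)\<^sup>2 \<partial>M\<Omega>) = 0"
    using weak_deriv_integral_le_sobolev_norm2[OF empty_multi_index, of u s] 0
    by linarith
  then have "AE x in M\<Omega>. (weak_deriv \<Omega> {#} u x)\<^sup>2 = 0"
    by (subst (asm) integral_nonneg_eq_0_iff_AE) (use L2_integrable_square[OF L2] in auto)
  with weak_deriv_empty[OF sobolevD(1)[OF u]] show ?thesis
    by eventually_elim simp
qed

text \<open>
  Almost everywhere equal functions have the same weak derivatives in the sense of
  \<open>is_weak_deriv\<close>, and hence literally the same chosen ones.
\<close>
lemma sobolev_cong_AE:
  assumes u: "u \<in> sobolev \<Omega> s" and v: "v \<in> borel_measurable M\<Omega>" and eq: "AE x in M\<Omega>. v x = u x"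
  shows "v \<in> sobolev \<Omega> s"
    and "sobolev_norm2 \<Omega> s v = sobolev_norm2 \<Omega> s u"
proof -
  have L2v: "L2 M\<Omega> v" by (rule L2_cong_AE[OF sobolevD(1)[OF u] v eq])
  have int: "(\<integral>x. v x * iter_pderiv bs \<phi> x \<partial>M\<Omega>) = (\<integral>x. u x * iter_pderiv bs \<phi> x \<partial>M\<Omega>)"
    if \<phi>: "\<phi> \<in> test_functions \<Omega>" and bs: "bs \<in> lists Basis" for \<phi> bs
  proof (rule integral_cong_AE)
    have m: "iter_pderiv bs \<phi> \<in> borel_measurable M\<Omega>"
      using test_function_L2[OF test_function_iter_pderiv[OF \<phi> bs]] by (rule L2_measurable)
    show "(\<lambda>x. v x * iter_pderiv bs \<phi> x) \<in> borel_measurable M\<Omega>"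
      "(\<lambda>x. u x * iter_pderiv bs \<phi> x) \<in> borel_measurable M\<Omega>"
      using v L2_measurable[OF sobolevD(1)[OF u]] m by (auto intro: borel_measurable_times)
    show "AE x in M\<Omega>. v x * iter_pderiv bs \<phi> x = u x * iter_pderiv bs \<phi> x"
      using eq by eventually_elim simp
  qed
  have weak: "is_weak_deriv \<Omega> \<alpha> v w \<longleftrightarrow> is_weak_deriv \<Omega> \<alpha> u w" if "set_mset \<alpha> \<subseteq> Basis" for \<alpha> w
  proof -
    have "bs \<in> lists Basis" if "mset bs = \<alpha>" for bs
      using that \<open>set_mset \<alpha> \<subseteq> Basis\<close> by auto
    then show ?thesis
      unfolding is_weak_deriv_iff using int by (intro ball_cong refl all_cong1 imp_cong) simp
  qed
  have wd: "weak_deriv \<Omega> \<alpha> v = weak_deriv \<Omega> \<alpha> u" if "set_mset \<alpha> \<subseteq> Basis" for \<alpha>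
    unfolding weak_deriv_def weak[OF that] ..
  show "v \<in> sobolev \<Omega> s"
  proof (rule sobolevI[OF L2v, of _ "\<lambda>\<alpha>. weak_deriv \<Omega> \<alpha> u"])
    show "L2 M\<Omega> (weak_deriv \<Omega> \<alpha> u) \<and> is_weak_deriv \<Omega> \<alpha> v (weak_deriv \<Omega> \<alpha> u)"
      if "\<alpha> \<in> multi_indices (nat \<lfloor>s\<rfloor>)" for \<alpha>
      using sobolevD(2,3)[OF u that] weak[OF multi_indices_Basis[OF that]] by simp
  qed (rule sobolevD(4)[OF u])
  have wd': "weak_deriv \<Omega> \<alpha> v = weak_deriv \<Omega> \<alpha> u" if "\<alpha> \<in> top_indices s" for \<alpha>
    by (rule wd, rule multi_indices_Basis) (use that in blast)
  show "sobolev_norm2 \<Omega> s v = sobolev_norm2 \<Omega> s u"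
    unfolding sobolev_norm2_eq
    by (intro arg_cong2[where f = "(+)"] sum.cong refl)
       (simp_all only: wd[OF multi_indices_Basis] wd')
qed

abbreviation "wd \<equiv> weak_deriv \<Omega>"

abbreviation "gd s \<alpha> u \<equiv> gagliardo_difference (frac s) (wd \<alpha> u)"

lemma wd_diff_integral:
  assumes u: "u \<in> sobolev \<Omega> s" and v: "v \<in> sobolev \<Omega> s" and \<alpha>: "\<alpha> \<in> multi_indices (nat \<lfloor>s\<rfloor>)"
  shows "(\<integral>x. (wd \<alpha> u x - wd \<alpha> v x)\<^sup>2 \<partial>M\<Omega>) = (\<integral>x. (wd \<alpha> (fcomb 1 u (- 1) v) x)\<^sup>2 \<partial>M\<Omega>)"
proof (rule L2_integral_cong)
  show "AE x in M\<Omega>. wd \<alpha> u x - wd \<alpha> v x = wd \<alpha> (fcomb 1 u (- 1) v) x"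
    using sobolev_fcomb(2)[OF u v \<alpha>, of 1 "- 1"] by eventually_elim simp
qed (intro L2_diff sobolevD(2)[OF u \<alpha>] sobolevD(2)[OF v \<alpha>] sobolevD(2)[OF sobolev_fcomb(1)[OF u v] \<alpha>])+

lemma gd_diff_integral:
  assumes u: "u \<in> sobolev \<Omega> s" and v: "v \<in> sobolev \<Omega> s" and \<alpha>: "\<alpha> \<in> top_indices s"
  shows "(\<integral>z. (gd s \<alpha> u z - gd s \<alpha> v z)\<^sup>2 \<partial>M\<Omega>2) = (\<integral>z. (gd s \<alpha> (fcomb 1 u (- 1) v) z)\<^sup>2 \<partial>M\<Omega>2)"
proof (rule L2_integral_cong)
  show "AE z in M\<Omega>2. gd s \<alpha> u z - gd s \<alpha> v z = gd s \<alpha> (fcomb 1 u (- 1) v) z"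
    using gagliardo_sobolev_fcomb[OF u v \<alpha>, of 1 "- 1"] by eventually_elim simp
  show "L2 M\<Omega>2 (\<lambda>z. gd s \<alpha> u z - gd s \<alpha> v z)"
    by (rule L2_diff[OF sobolevD(4)[OF u \<alpha>] sobolevD(4)[OF v \<alpha>]])
  show "L2 M\<Omega>2 (gd s \<alpha> (fcomb 1 u (- 1) v))"
    by (rule sobolevD(4)[OF sobolev_fcomb(1)[OF u v] \<alpha>])
qed

text \<open>
  The limit \<open>u\<close> is the \<open>L\<^sup>2\<close> limit belonging to the empty
  multi-index. The \<open>L\<^sup>2\<close> limits \<open>h \<alpha>\<close> of the weak derivatives
  are weak derivatives of \<open>u\<close>, since the defining identity passes to the limit. On the
  top multi-indices the Gagliardo differences are Cauchy in \<open>L\<^sup>2(\<Omega> \<times>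
  \<Omega>)\<close> and converge almost everywhere, along a subsequence, to that of \<open>h
  \<alpha>\<close>.
\<close>
lemma sobolev_complete:
  assumes X: "\<And>n. X n \<in> sobolev \<Omega> s"
    and Cauchy: "\<And>e. 0 < e \<Longrightarrow> \<exists>K. \<forall>i\<ge>K. \<forall>j\<ge>K. sobolev_norm2 \<Omega> s (fcomb 1 (X i) (- 1) (X j)) < e"
  shows "\<exists>u\<in>sobolev \<Omega> s. (\<lambda>n. sobolev_norm2 \<Omega> s (fcomb 1 (X n) (- 1) u)) \<longlonglongrightarrow> 0"
proof -
  let ?I = "multi_indices (nat \<lfloor>s\<rfloor>) :: 'a multiset set"
  have wd_Cauchy: "\<exists>K. \<forall>i\<ge>K. \<forall>j\<ge>K. (\<integral>x. (wd \<alpha> (X i) x - wd \<alpha> (X j) x)\<^sup>2 \<partial>M\<Omega>) < e"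
    if "0 < e" and \<alpha>: "\<alpha> \<in> ?I" for e \<alpha>
    by (rule Cauchy_bound_mono[OF _ Cauchy[OF \<open>0 < e\<close>]], subst wd_diff_integral[OF X X \<alpha>])
       (rule weak_deriv_integral_le_sobolev_norm2[OF \<alpha>])
  define P where "P \<alpha> h r \<longleftrightarrow> L2 M\<Omega> h \<and> (\<lambda>n. \<integral>x. (wd \<alpha> (X n) x - h x)\<^sup>2 \<partial>M\<Omega>) \<longlonglongrightarrow> 0 \<and>
      strict_mono r \<and> (AE x in M\<Omega>. (\<lambda>n. wd \<alpha> (X (r n)) x) \<longlonglongrightarrow> h x)" for \<alpha> h and r :: "nat \<Rightarrow> nat"
  have ex: "\<forall>\<alpha>\<in>?I. \<exists>h r. P \<alpha> h r"
  proof
    fix \<alpha> assume \<alpha>: "\<alpha> \<in> ?I"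
    show "\<exists>h r. P \<alpha> h r"
      unfolding P_def
      by (rule L2_complete[of M\<Omega> "\<lambda>n. wd \<alpha> (X n)", OF sobolevD(2)[OF X \<alpha>] wd_Cauchy[OF _ \<alpha>]])
         blast+
  qed
  obtain h where "\<forall>\<alpha>\<in>?I. \<exists>r. P \<alpha> (h \<alpha>) r" using bchoice[OF ex] by blast
  from bchoice[OF this] obtain r where hr: "\<And>\<alpha>. \<alpha> \<in> ?I \<Longrightarrow> P \<alpha> (h \<alpha>) (r \<alpha>)" by blast
  have h: "\<And>\<alpha>. \<alpha> \<in> ?I \<Longrightarrow> L2 M\<Omega> (h \<alpha>)"
      "\<And>\<alpha>. \<alpha> \<in> ?I \<Longrightarrow> (\<lambda>n. \<integral>x. (wd \<alpha> (X n) x - h \<alpha> x)\<^sup>2 \<partial>M\<Omega>) \<longlonglongrightarrow> 0"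
    and r: "\<And>\<alpha>. \<alpha> \<in> ?I \<Longrightarrow> strict_mono (r \<alpha>)"
      "\<And>\<alpha>. \<alpha> \<in> ?I \<Longrightarrow> AE x in M\<Omega>. (\<lambda>n. wd \<alpha> (X (r \<alpha> n)) x) \<longlonglongrightarrow> h \<alpha> x"
    using hr unfolding P_def by simp_all
  define u where "u = h {#}"
  have L2u: "L2 M\<Omega> u" unfolding u_def by (rule h(1)[OF empty_multi_index])
  have X_lim: "(\<lambda>n. \<integral>x. (X n x - u x)\<^sup>2 \<partial>M\<Omega>) \<longlonglongrightarrow> 0"
  proof -
    have "(\<integral>x. (X n x - u x)\<^sup>2 \<partial>M\<Omega>) = (\<integral>x. (wd {#} (X n) x - h {#} x)\<^sup>2 \<partial>M\<Omega>)" for n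
    proof (rule L2_integral_cong)
      show "AE x in M\<Omega>. X n x - u x = wd {#} (X n) x - h {#} x"
        using weak_deriv_empty[OF sobolevD(1)[OF X[of n]]] unfolding u_def by eventually_elim simp
    qed (intro L2_diff L2u h(1) empty_multi_index sobolevD(1)[OF X] sobolevD(2)[OF X])+
    then show ?thesis using h(2)[OF empty_multi_index] by (simp only:)
  qed
  have weak: "L2 M\<Omega> (h \<alpha>) \<and> is_weak_deriv \<Omega> \<alpha> u (h \<alpha>)" if \<alpha>: "\<alpha> \<in> ?I" for \<alpha>
    using is_weak_deriv_limit[OF multi_indices_Basis[OF \<alpha>] sobolevD(1)[OF X] sobolevD(2)[OF X \<alpha>] L2u h(1)[OF \<alpha>]
        sobolevD(3)[OF X \<alpha>] X_lim h(2)[OF \<alpha>]] h(1)[OF \<alpha>] by blast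
  have gag: "L2 M\<Omega>2 (gagliardo_difference (frac s) (h \<alpha>)) \<and>
      (\<lambda>n. \<integral>z. (gd s \<alpha> (X n) z - gagliardo_difference (frac s) (h \<alpha>) z)\<^sup>2 \<partial>M\<Omega>2) \<longlonglongrightarrow> 0"
    if \<alpha>: "\<alpha> \<in> top_indices s" for \<alpha>
  proof -
    have \<alpha>I: "\<alpha> \<in> ?I" using \<alpha> by simp
    have L2g: "L2 M\<Omega>2 (gd s \<alpha> (X n))" for n
      by (rule sobolevD(4)[OF X \<alpha>])
    have C: "\<exists>K. \<forall>i\<ge>K. \<forall>j\<ge>K. (\<integral>z. (gd s \<alpha> (X i) z - gd s \<alpha> (X j) z)\<^sup>2 \<partial>M\<Omega>2) < e" if "0 < e" for e
      by (rule Cauchy_bound_mono[OF _ Cauchy[OF that]], subst gd_diff_integral[OF X X \<alpha>])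
         (rule gagliardo_integral_le_sobolev_norm2[OF \<alpha>])
    have m: "gagliardo_difference (frac s) (h \<alpha>) \<in> borel_measurable M\<Omega>2"
      by (rule gagliardo_difference_measurable[OF L2_measurable[OF h(1)[OF \<alpha>I]]])
    have lim: "AE z in M\<Omega>2. (\<lambda>n. gd s \<alpha> (X (r \<alpha> n)) z)
        \<longlonglongrightarrow> gagliardo_difference (frac s) (h \<alpha>) z"
      using AE_M\<Omega>2[OF r(2)[OF \<alpha>I]]
    proof eventually_elim
      case (elim z)
      then show ?case
        unfolding gagliardo_difference_def divide_inverse
        by (intro tendsto_mult_right tendsto_diff) auto
    qed
    show ?thesis
      by (rule conjI[OF L2_Cauchy_AE_limit[OF L2g C r(1)[OF \<alpha>I] m lim]])
  qed
  have u: "u \<in> sobolev \<Omega> s"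
    by (rule sobolevI[OF L2u weak conjunct1[OF gag]])
  have wd_u: "AE x in M\<Omega>. wd \<alpha> u x = h \<alpha> x" if \<alpha>: "\<alpha> \<in> ?I" for \<alpha>
    by (rule weak_deriv_works(3)[OF conjunct1[OF weak[OF \<alpha>]] conjunct2[OF weak[OF \<alpha>]]])
  have lim1: "(\<lambda>n. \<integral>x. (wd \<alpha> (fcomb 1 (X n) (- 1) u) x)\<^sup>2 \<partial>M\<Omega>) \<longlonglongrightarrow> 0" if \<alpha>: "\<alpha> \<in> ?I" for \<alpha>
  proof -
    have "(\<integral>x. (wd \<alpha> (X n) x - wd \<alpha> u x)\<^sup>2 \<partial>M\<Omega>) = (\<integral>x. (wd \<alpha> (X n) x - h \<alpha> x)\<^sup>2 \<partial>M\<Omega>)" for n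
    proof (rule L2_integral_cong)
      show "AE x in M\<Omega>. wd \<alpha> (X n) x - wd \<alpha> u x = wd \<alpha> (X n) x - h \<alpha> x"
        using wd_u[OF \<alpha>] by eventually_elim simp
    qed (intro L2_diff h(1) \<alpha> sobolevD(2)[OF X] sobolevD(2)[OF u])+
    then show ?thesis using h(2)[OF \<alpha>] unfolding wd_diff_integral[OF X u \<alpha>] by (simp only:)
  qed
  have lim2: "(\<lambda>n. \<integral>z. (gd s \<alpha> (fcomb 1 (X n) (- 1) u) z)\<^sup>2 \<partial>M\<Omega>2) \<longlonglongrightarrow> 0"
    if \<alpha>: "\<alpha> \<in> top_indices s" for \<alpha>
  proof -
    have \<alpha>I: "\<alpha> \<in> ?I" using \<alpha> by simp
    have "(\<integral>z. (gd s \<alpha> (X n) z - gd s \<alpha> u z)\<^sup>2 \<partial>M\<Omega>2) =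
        (\<integral>z. (gd s \<alpha> (X n) z - gagliardo_difference (frac s) (h \<alpha>) z)\<^sup>2 \<partial>M\<Omega>2)" for n
    proof (rule L2_integral_cong)
      show "AE z in M\<Omega>2. gd s \<alpha> (X n) z - gd s \<alpha> u z = gd s \<alpha> (X n) z - gagliardo_difference (frac s) (h \<alpha>) z"
        using gagliardo_difference_AE_cong[OF wd_u[OF \<alpha>I], of "frac s"] by eventually_elim simp
    qed (intro L2_diff conjunct1[OF gag[OF \<alpha>]] sobolevD(4)[OF X \<alpha>] sobolevD(4)[OF u \<alpha>])+
    then show ?thesis using conjunct2[OF gag[OF \<alpha>]] unfolding gd_diff_integral[OF X u \<alpha>] by (simp only:)
  qed
  have "(\<lambda>n. sobolev_norm2 \<Omega> s (fcomb 1 (X n) (- 1) u)) \<longlonglongrightarrow>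
      (\<Sum>\<alpha>\<in>?I. 0) + (\<Sum>\<alpha>\<in>top_indices s. 0)"
    unfolding sobolev_norm2_eq by (intro tendsto_add tendsto_sum lim1 lim2)
  then show ?thesis using u by auto
qed

end

section \<open>Functions of class C2 up to the boundary\<close>

lemma pderiv_dir_cong_open:
  assumes "open S" "x \<in> S" "\<And>y. y \<in> S \<Longrightarrow> f y = g y"
  shows "pderiv_dir b f x = pderiv_dir b g x"
proof -
  have "(f has_derivative D) (at x) \<longleftrightarrow> (g has_derivative D) (at x)" for D
    using has_derivative_transform_within_open[OF _ assms(1,2), of f D UNIV g]
      has_derivative_transform_within_open[OF _ assms(1,2), of g D UNIV f] assms(3) by force
  then show ?thesis by (simp add: pderiv_dir_def frechet_derivative_def)
qed

text \<open>
  \<open>iter_pderiv\<close> uses the values in a neighbourhood only, even where a derivative fails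
  to exist and its value is arbitrary.
\<close>
lemma iter_pderiv_cong_open:
  assumes "open S" "\<And>y. y \<in> S \<Longrightarrow> f y = g y" "x \<in> S"
  shows "iter_pderiv bs f x = iter_pderiv bs g x"
  using assms(3)
proof (induction bs arbitrary: x rule: list.induct)
  case Nil then show ?case by (simp add: assms(2))
next
  case (Cons b bs)
  have "pderiv_dir b (iter_pderiv bs f) x = pderiv_dir b (iter_pderiv bs g) x"
    by (rule pderiv_dir_cong_open[OF assms(1) Cons.prems Cons.IH])
  then show ?case by simp
qed

lemma differentiable_cong_open:
  assumes "f differentiable (at x)" "open S" "x \<in> S" "\<And>y. y \<in> S \<Longrightarrow> f y = g y"
  shows "g differentiable (at x)"
proof -
  obtain D where "(f has_derivative D) (at x)" using assms(1) unfolding differentiable_def by blast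
  then have "(g has_derivative D) (at x)"
    by (rule has_derivative_transform_within_open[OF _ assms(2,3)]) (rule assms(4))
  then show ?thesis unfolding differentiable_def by blast
qed

lemma C2_closureD:
  assumes "u \<in> C2_closure \<Omega>"
  shows "continuous_on (closure \<Omega>) u"
    and "bs \<in> lists Basis \<Longrightarrow> length bs \<le> 1 \<Longrightarrow> x \<in> \<Omega> \<Longrightarrow> iter_pderiv bs u differentiable (at x)"
    and "bs \<in> lists Basis \<Longrightarrow> length bs \<le> 2 \<Longrightarrow>
      \<exists>h. continuous_on (closure \<Omega>) h \<and> (\<forall>x\<in>\<Omega>. h x = iter_pderiv bs u x)"
  using assms unfolding C2_closure_def by simp_all

lemma C2_closure_continuous:
  assumes "u \<in> C2_closure \<Omega>" "bs \<in> lists Basis" "length bs \<le> 2"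
  shows "continuous_on \<Omega> (iter_pderiv bs u)"
proof -
  obtain h where h: "continuous_on (closure \<Omega>) h" "\<forall>x\<in>\<Omega>. h x = iter_pderiv bs u x"
    using C2_closureD(3)[OF assms] by blast
  have "continuous_on \<Omega> h" by (rule continuous_on_subset[OF h(1) closure_subset])
  then show ?thesis by (rule continuous_on_eq) (use h(2) in blast)
qed

lemma C2_closure_cong:
  assumes \<Omega>: "open \<Omega>" and u: "u \<in> C2_closure \<Omega>" and eq: "\<And>x. x \<in> closure \<Omega> \<Longrightarrow> v x = u x"
  shows "v \<in> C2_closure \<Omega>"
proof -
  have sub: "x \<in> \<Omega> \<Longrightarrow> u x = v x" for x using eq closure_subset[of \<Omega>] by auto
  have it: "iter_pderiv bs u x = iter_pderiv bs v x" if "x \<in> \<Omega>" for bs x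
    by (rule iter_pderiv_cong_open[OF \<Omega> sub that])
  show ?thesis
    unfolding C2_closure_def mem_Collect_eq
  proof (intro conjI ballI impI)
    show "continuous_on (closure \<Omega>) v"
      by (rule continuous_on_eq[OF C2_closureD(1)[OF u]]) (simp add: eq)
    show "iter_pderiv bs v differentiable at x" if "bs \<in> lists Basis" "length bs \<le> 1" "x \<in> \<Omega>" for bs x
      by (rule differentiable_cong_open[OF C2_closureD(2)[OF u that] \<Omega> that(3) it])
    show "\<exists>h. continuous_on (closure \<Omega>) h \<and> (\<forall>x\<in>\<Omega>. h x = iter_pderiv bs v x)"
      if "bs \<in> lists Basis" "length bs \<le> 2" for bs
      using C2_closureD(3)[OF u that] it by simp
  qed
qed

lemma iter_pderiv_fcomb:
  assumes \<Omega>: "open \<Omega>" and u: "u \<in> C2_closure \<Omega>" and v: "v \<in> C2_closure \<Omega>"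
    and bs: "bs \<in> lists Basis" "length bs \<le> 2" and x: "x \<in> \<Omega>"
  shows "iter_pderiv bs (fcomb a u b v) x = a * iter_pderiv bs u x + b * iter_pderiv bs v x"
  using bs x
proof (induction bs arbitrary: x rule: list.induct)
  case Nil then show ?case by (simp add: fcomb_def)
next
  case (Cons c bs)
  have bs: "bs \<in> lists Basis" "length bs \<le> 1" "length bs \<le> 2" using Cons.prems(1,2) by simp_all
  have IH: "iter_pderiv bs (fcomb a u b v) y = a * iter_pderiv bs u y + b * iter_pderiv bs v y" if "y \<in> \<Omega>" for y
    by (rule Cons.IH[OF bs(1,3) that])
  have "pderiv_dir c (iter_pderiv bs (fcomb a u b v)) x =
      pderiv_dir c (\<lambda>y. a * iter_pderiv bs u y + b * iter_pderiv bs v y) x"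
    by (rule pderiv_dir_cong_open[OF \<Omega> Cons.prems(3) IH])
  also have "\<dots> = a * pderiv_dir c (iter_pderiv bs u) x + b * pderiv_dir c (iter_pderiv bs v) x"
  proof (rule pderiv_dirI)
    show "((\<lambda>y. a * iter_pderiv bs u y + b * iter_pderiv bs v y) has_derivative
        (\<lambda>h. a * pderiv_dir h (iter_pderiv bs u) x + b * pderiv_dir h (iter_pderiv bs v) x)) (at x)"
      by (intro has_derivative_add has_derivative_mult_right differentiable_has_derivative
          C2_closureD(2)[OF u bs(1,2) Cons.prems(3)] C2_closureD(2)[OF v bs(1,2) Cons.prems(3)])
  qed
  finally show ?case by simp
qed

lemma C2_closure_fcomb:
  assumes \<Omega>: "open \<Omega>" and u: "u \<in> C2_closure \<Omega>" and v: "v \<in> C2_closure \<Omega>"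
  shows "fcomb a u b v \<in> C2_closure \<Omega>"
  unfolding C2_closure_def mem_Collect_eq
proof (intro conjI ballI impI)
  show "continuous_on (closure \<Omega>) (fcomb a u b v)"
    unfolding fcomb_def
    by (intro continuous_on_add continuous_on_scaleR continuous_on_const C2_closureD(1) u v)
  fix bs :: "'a list" assume bs: "bs \<in> lists Basis"
  show "iter_pderiv bs (fcomb a u b v) differentiable at x" if len: "length bs \<le> 1" and x: "x \<in> \<Omega>" for x
  proof (rule differentiable_cong_open[OF _ \<Omega> x])
    show "(\<lambda>y. a * iter_pderiv bs u y + b * iter_pderiv bs v y) differentiable at x"
      by (intro differentiable_add differentiable_mult differentiable_const
          C2_closureD(2)[OF u bs len x] C2_closureD(2)[OF v bs len x])
    show "a * iter_pderiv bs u y + b * iter_pderiv bs v y = iter_pderiv bs (fcomb a u b v) y" if "y \<in> \<Omega>" for y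
      using iter_pderiv_fcomb[OF \<Omega> u v bs _ that, of a b] len by simp
  qed
  assume len: "length bs \<le> 2"
  obtain h k where h: "continuous_on (closure \<Omega>) h" "\<forall>x\<in>\<Omega>. h x = iter_pderiv bs u x"
    and k: "continuous_on (closure \<Omega>) k" "\<forall>x\<in>\<Omega>. k x = iter_pderiv bs v x"
    using C2_closureD(3)[OF u bs len] C2_closureD(3)[OF v bs len] by blast
  show "\<exists>h. continuous_on (closure \<Omega>) h \<and> (\<forall>x\<in>\<Omega>. h x = iter_pderiv bs (fcomb a u b v) x)"
    by (intro exI[of _ "\<lambda>x. a * h x + b * k x"] conjI continuous_on_add continuous_on_mult continuous_on_const h(1) k(1))
       (simp add: h(2) k(2) iter_pderiv_fcomb[OF \<Omega> u v bs len])
qed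

text \<open>
  The set in \<open>\<Omega>\<close> where \<open>u\<close> and \<open>v\<close> differ is open and
  null, hence empty.
\<close>
lemma AE_eq_imp_eq_on_closure:
  fixes u v :: "'a::euclidean_space \<Rightarrow> real"
  assumes \<Omega>: "open \<Omega>" and u: "continuous_on (closure \<Omega>) u" and v: "continuous_on (closure \<Omega>) v"
    and eq: "AE x in lborel. x \<in> \<Omega> \<longrightarrow> u x = v x" and x: "x \<in> closure \<Omega>"
  shows "u x = v x"
proof -
  define S where "S = \<Omega> \<inter> (\<lambda>x. u x - v x) -` (- {0})"
  have cont: "continuous_on \<Omega> (\<lambda>x. u x - v x)"
    by (intro continuous_on_diff continuous_on_subset[OF u] continuous_on_subset[OF v] closure_subset)
  have "open S"
    unfolding S_def using cont \<Omega> by (rule continuous_open_preimage) auto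
  moreover have "negligible S"
  proof -
    have "AE x in lborel. x \<notin> S" using eq by eventually_elim (auto simp: S_def)
    then have "S \<in> null_sets lborel"
      using AE_iff_null_sets[of S lborel] \<open>open S\<close> by simp
    then show ?thesis
      by (simp add: negligible_iff_null_sets null_sets_completionI)
  qed
  ultimately have "S = {}" using open_not_negligible by blast
  then have zero: "u x - v x = 0" if "x \<in> \<Omega>" for x using that by (auto simp: S_def)
  have "u x - v x = 0"
    by (rule continuous_constant_on_closure[OF continuous_on_diff[OF u v] _ x]) (rule zero)
  then show ?thesis by simp
qed

section \<open>The Sobolev space of continuous representatives\<close>

locale sobolev_embedding = open_domain \<Omega> for \<Omega> :: "'a::euclidean_space set" +
  fixes s :: real
  assumes embedding: "embeds_into_C2 \<Omega> s" and s_ge_2: "2 \<le> s"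
begin

abbreviation "N2 \<equiv> sobolev_norm2 \<Omega> s"

lemma HsD:
  assumes "u \<in> Hs \<Omega> s"
  shows "u \<in> sobolev \<Omega> s" "u \<in> C2_closure \<Omega>" "x \<notin> closure \<Omega> \<Longrightarrow> u x = 0"
  using assms by (simp_all add: Hs_def)

lemma Hs_fcomb:
  assumes u: "u \<in> Hs \<Omega> s" and v: "v \<in> Hs \<Omega> s"
  shows "fcomb a u b v \<in> Hs \<Omega> s"
  unfolding Hs_def mem_Collect_eq
proof (intro conjI allI impI)
  show "fcomb a u b v \<in> sobolev \<Omega> s"
    by (rule sobolev_fcomb(1)[OF HsD(1)[OF u] HsD(1)[OF v]])
  show "fcomb a u b v \<in> C2_closure \<Omega>"
    by (rule C2_closure_fcomb[OF open_\<Omega> HsD(2)[OF u] HsD(2)[OF v]])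
  show "fcomb a u b v x = 0" if "x \<notin> closure \<Omega>" for x
    using HsD(3)[OF u that] HsD(3)[OF v that] by (simp add: fcomb_def)
qed

lemma Hs_diff: "u \<in> Hs \<Omega> s \<Longrightarrow> v \<in> Hs \<Omega> s \<Longrightarrow> (\<lambda>x. u x - v x) \<in> Hs \<Omega> s"
  using Hs_fcomb[of u v 1 "- 1"] by (simp add: fcomb_diff)

lemma Hs_pderiv_fcomb:
  assumes "u \<in> Hs \<Omega> s" "v \<in> Hs \<Omega> s" "bs \<in> lists Basis" "length bs \<le> 2" "x \<in> \<Omega>"
  shows "iter_pderiv bs (fcomb a u b v) x = a * iter_pderiv bs u x + b * iter_pderiv bs v x"
  by (rule iter_pderiv_fcomb[OF open_\<Omega> HsD(2)[OF assms(1)] HsD(2)[OF assms(2)] assms(3,4,5)])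

lemma Hs_continuous_pderiv:
  "u \<in> Hs \<Omega> s \<Longrightarrow> bs \<in> lists Basis \<Longrightarrow> length bs \<le> 2 \<Longrightarrow> continuous_on \<Omega> (iter_pderiv bs u)"
  by (rule C2_closure_continuous[OF HsD(2)])

lemma quad_form_Hs: "quad_form fcomb (Hs \<Omega> s) N2"
  using quad_form_pullback[OF quad_form_sobolev, of "Hs \<Omega> s" fcomb "\<lambda>u. u" s] Hs_fcomb HsD(1) by blast

lemma N2_nonneg: "u \<in> Hs \<Omega> s \<Longrightarrow> 0 \<le> N2 u"
  by (rule quad_form_nonneg[OF quad_form_Hs])

lemma Hs_zero_of_norm2:
  assumes u: "u \<in> Hs \<Omega> s" and "N2 u \<le> 0"
  shows "u = (\<lambda>x. 0)"
proof
  fix x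
  have "AE x in lborel. x \<in> \<Omega> \<longrightarrow> u x = 0"
    using sobolev_norm2_eq_0_imp[OF HsD(1)[OF u] assms(2)] unfolding AE_M\<Omega>_iff .
  then show "u x = 0"
    using AE_eq_imp_eq_on_closure[OF open_\<Omega> C2_closureD(1)[OF HsD(2)[OF u]] continuous_on_const[of _ 0]]
      HsD(3)[OF u] by (cases "x \<in> closure \<Omega>") blast+
qed

text \<open>
  The embedding provides some representative with this bound; on \<open>\<Omega>\<close> it
  coincides with \<open>u\<close> itself, as both are continuous.
\<close>
lemma C2_bound:
  obtains C where "0 \<le> C"
    "\<And>u bs x. u \<in> Hs \<Omega> s \<Longrightarrow> bs \<in> lists Basis \<Longrightarrow> length bs \<le> 2 \<Longrightarrow> x \<in> \<Omega> \<Longrightarrow>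
      \<bar>iter_pderiv bs u x\<bar> \<le> C * sqrt (N2 u)"
proof -
  obtain C where C: "\<forall>u\<in>sobolev \<Omega> s. \<exists>v\<in>C2_closure \<Omega>.
        (AE x in lborel. x \<in> \<Omega> \<longrightarrow> v x = u x) \<and>
        (\<forall>bs\<in>lists Basis. length bs \<le> 2 \<longrightarrow>
           (\<forall>x\<in>\<Omega>. \<bar>iter_pderiv bs v x\<bar> \<le> C * sqrt (N2 u)))"
    using embedding unfolding embeds_into_C2_def by blast
  show ?thesis
  proof (rule that[of "max 0 C"])
    fix u and bs :: "'a list" and x assume u: "u \<in> Hs \<Omega> s" and bs: "bs \<in> lists Basis" "length bs \<le> 2" and x: "x \<in> \<Omega>"
    obtain v where v: "v \<in> C2_closure \<Omega>" "AE x in lborel. x \<in> \<Omega> \<longrightarrow> v x = u x"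
      "\<forall>bs\<in>lists Basis. length bs \<le> 2 \<longrightarrow> (\<forall>x\<in>\<Omega>. \<bar>iter_pderiv bs v x\<bar> \<le> C * sqrt (N2 u))"
      using bspec[OF C HsD(1)[OF u]] by blast
    have "v y = u y" if "y \<in> \<Omega>" for y
      using AE_eq_imp_eq_on_closure[OF open_\<Omega> C2_closureD(1)[OF v(1)] C2_closureD(1)[OF HsD(2)[OF u]] v(2)]
        closure_subset[of \<Omega>] that by blast
    then have "iter_pderiv bs v x = iter_pderiv bs u x"
      by (rule iter_pderiv_cong_open[OF open_\<Omega> _ x])
    then have "\<bar>iter_pderiv bs u x\<bar> \<le> C * sqrt (N2 u)" using v(3) bs x by metis
    also have "\<dots> \<le> max 0 C * sqrt (N2 u)"
      by (intro mult_right_mono) (simp_all add: N2_nonneg[OF u])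
    finally show "\<bar>iter_pderiv bs u x\<bar> \<le> max 0 C * sqrt (N2 u)" .
  qed simp
qed

lemma closure_bound:
  obtains C where "0 \<le> C" "\<And>u x. u \<in> Hs \<Omega> s \<Longrightarrow> x \<in> closure \<Omega> \<Longrightarrow> \<bar>u x\<bar> \<le> C * sqrt (N2 u)"
proof -
  obtain C where C: "0 \<le> C" "\<And>u bs x. u \<in> Hs \<Omega> s \<Longrightarrow> bs \<in> lists Basis \<Longrightarrow> length bs \<le> 2 \<Longrightarrow> x \<in> \<Omega> \<Longrightarrow>
      \<bar>iter_pderiv bs u x\<bar> \<le> C * sqrt (N2 u)" using C2_bound by blast
  show ?thesis
  proof (rule that[OF C(1)])
    fix u x assume u: "u \<in> Hs \<Omega> s" and x: "x \<in> closure \<Omega>"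
    have "norm (u x) \<le> C * sqrt (N2 u)"
      by (rule continuous_on_closure_norm_le[OF C2_closureD(1)[OF HsD(2)[OF u]] _ x])
         (use C(2)[OF u, of "[]"] in simp)
    then show "\<bar>u x\<bar> \<le> C * sqrt (N2 u)" by simp
  qed
qed

text \<open>
  The limit in \<open>H\<^sup>s(\<Omega>)\<close> is replaced by its continuous representative,
  extended by zero off the closure.
\<close>
lemma Hs_complete:
  assumes X: "\<And>n. X n \<in> Hs \<Omega> s"
    and Cauchy: "\<And>e. 0 < e \<Longrightarrow> \<exists>K. \<forall>i\<ge>K. \<forall>j\<ge>K. N2 (\<lambda>x. X i x - X j x) < e"
  shows "\<exists>u\<in>Hs \<Omega> s. (\<lambda>n. N2 (\<lambda>x. X n x - u x)) \<longlonglongrightarrow> 0"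
proof -
  obtain w where w: "w \<in> sobolev \<Omega> s" "(\<lambda>n. N2 (fcomb 1 (X n) (- 1) w)) \<longlonglongrightarrow> 0"
    using sobolev_complete[of X s, OF HsD(1)[OF X]] Cauchy unfolding fcomb_diff by blast
  obtain v where v: "v \<in> C2_closure \<Omega>" "AE x in lborel. x \<in> \<Omega> \<longrightarrow> v x = w x"
    using embedding w(1) unfolding embeds_into_C2_def by blast
  define u where "u x = (if x \<in> closure \<Omega> then v x else 0)" for x
  have uC2: "u \<in> C2_closure \<Omega>"
    by (rule C2_closure_cong[OF open_\<Omega> v(1)]) (simp add: u_def)
  have meas: "u \<in> borel_measurable M\<Omega>"
    using C2_closure_continuous[OF uC2, of "[]"] by (simp add: continuous_imp_measurable_M\<Omega>)
  have eq: "AE x in M\<Omega>. u x = w x"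
    unfolding AE_M\<Omega>_iff using v(2) by eventually_elim (use closure_subset[of \<Omega>] in \<open>auto simp: u_def\<close>)
  have u: "u \<in> Hs \<Omega> s"
    unfolding Hs_def mem_Collect_eq
    by (intro conjI sobolev_cong_AE(1)[OF w(1) meas eq] uC2) (simp add: u_def)
  have eqN: "N2 (fcomb 1 (X n) (- 1) u) = N2 (fcomb 1 (X n) (- 1) w)" for n
  proof (rule sobolev_cong_AE(2)[OF sobolev_fcomb(1)[OF HsD(1)[OF X] w(1)]])
    show "fcomb 1 (X n) (- 1) u \<in> borel_measurable M\<Omega>"
      by (rule L2_measurable[OF sobolevD(1)[OF sobolev_fcomb(1)[OF HsD(1)[OF X] HsD(1)[OF u]]]])
    show "AE x in M\<Omega>. fcomb 1 (X n) (- 1) u x = fcomb 1 (X n) (- 1) w x"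
      using eq by eventually_elim (simp add: fcomb_def)
  qed
  have "(\<lambda>n. N2 (fcomb 1 (X n) (- 1) u)) \<longlonglongrightarrow> 0"
    unfolding eqN by (rule w(2))
  then show ?thesis using u unfolding fcomb_diff by blast
qed

text \<open>
  Moving the derivatives one at a time onto the test function reverses their order.
\<close>
lemma integration_by_parts_iter_pderiv:
  assumes u: "u \<in> Hs \<Omega> s" and bs: "bs \<in> lists Basis" "length bs \<le> 2" and \<phi>: "\<phi> \<in> test_functions \<Omega>"
  shows "(\<integral>x. iter_pderiv bs u x * \<phi> x \<partial>M\<Omega>) =
    (-1) ^ length bs * (\<integral>x. u x * iter_pderiv (rev bs) \<phi> x \<partial>M\<Omega>)"
  using bs \<phi>
proof (induction bs arbitrary: \<phi> rule: list.induct)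
  case Nil then show ?case by simp
next
  case (Cons b bs)
  have bs: "bs \<in> lists Basis" "length bs \<le> 1" "length bs \<le> 2" and b: "b \<in> Basis"
    using Cons.prems(1,2) by simp_all
  have D\<phi>: "pderiv_dir b \<phi> \<in> test_functions \<Omega>"
    using test_function_iter_pderiv[OF Cons.prems(3), of "[b]"] b by simp
  have cont: "continuous_on \<Omega> (pderiv_dir b (iter_pderiv bs u))"
    using Hs_continuous_pderiv[OF u Cons.prems(1,2)] by simp
  have "(\<integral>x. iter_pderiv bs u x * pderiv_dir b \<phi> x \<partial>M\<Omega>) =
      - (\<integral>x. pderiv_dir b (iter_pderiv bs u) x * \<phi> x \<partial>M\<Omega>)"
    using integration_by_parts_test_function[OF open_\<Omega> C2_closureD(2)[OF HsD(2)[OF u] bs(1,2)] cont Cons.prems(3) b]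
    unfolding set_integral_eq by blast
  moreover have "(\<integral>x. iter_pderiv bs u x * pderiv_dir b \<phi> x \<partial>M\<Omega>) =
      (-1) ^ length bs * (\<integral>x. u x * iter_pderiv (rev bs) (pderiv_dir b \<phi>) x \<partial>M\<Omega>)"
    by (rule Cons.IH[OF bs(1,3) D\<phi>])
  ultimately show ?case by (simp add: iter_pderiv_append)
qed

text \<open>
  Classical and weak derivatives give the same integrals against all test functions. Here \<open>2
  \<le> s\<close> ensures that the weak derivatives of order at most two belong to the
  \<open>H\<^sup>s\<close> norm.
\<close>
lemma iter_pderiv_AE_weak_deriv:
  assumes u: "u \<in> Hs \<Omega> s" and bs: "bs \<in> lists Basis" "length bs \<le> 2"
  shows "mset bs \<in> multi_indices (nat \<lfloor>s\<rfloor>)"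
    and "AE x in M\<Omega>. iter_pderiv bs u x = weak_deriv \<Omega> (mset bs) u x"
proof -
  have "2 \<le> nat \<lfloor>s\<rfloor>" using s_ge_2 by (simp add: le_nat_iff le_floor_iff)
  then show \<alpha>: "mset bs \<in> multi_indices (nat \<lfloor>s\<rfloor>)"
    using bs by (auto simp: multi_indices_def)
  show "AE x in M\<Omega>. iter_pderiv bs u x = weak_deriv \<Omega> (mset bs) u x"
  proof (rule AE_eq_of_test_functions)
    show "locally_integrable (iter_pderiv bs u)"
      by (rule continuous_imp_locally_integrable[OF Hs_continuous_pderiv[OF u bs]])
    show "locally_integrable (weak_deriv \<Omega> (mset bs) u)"
      by (rule L2_imp_locally_integrable[OF sobolevD(2)[OF HsD(1)[OF u] \<alpha>]])
    fix \<phi> assume \<phi>: "\<phi> \<in> test_functions \<Omega>"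
    have "(\<integral>x. u x * iter_pderiv (rev bs) \<phi> x \<partial>M\<Omega>) =
        (-1) ^ size (mset bs) * (\<integral>x. weak_deriv \<Omega> (mset bs) u x * \<phi> x \<partial>M\<Omega>)"
      by (rule is_weak_derivD[OF sobolevD(3)[OF HsD(1)[OF u] \<alpha>] \<phi>]) simp
    then show "(\<integral>x. iter_pderiv bs u x * \<phi> x \<partial>M\<Omega>) = (\<integral>x. weak_deriv \<Omega> (mset bs) u x * \<phi> x \<partial>M\<Omega>)"
      unfolding integration_by_parts_iter_pderiv[OF u bs \<phi>] by simp
  qed
qed

lemma iter_pderiv_L2:
  assumes u: "u \<in> Hs \<Omega> s" and bs: "bs \<in> lists Basis" "length bs \<le> 2"
  shows "L2 M\<Omega> (iter_pderiv bs u)" "(\<integral>x. (iter_pderiv bs u x)\<^sup>2 \<partial>M\<Omega>) \<le> N2 u"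
proof -
  note \<alpha> = iter_pderiv_AE_weak_deriv[OF u bs]
  have wd: "L2 M\<Omega> (weak_deriv \<Omega> (mset bs) u)" by (rule sobolevD(2)[OF HsD(1)[OF u] \<alpha>(1)])
  have m: "iter_pderiv bs u \<in> borel_measurable M\<Omega>"
    by (rule continuous_imp_measurable_M\<Omega>[OF Hs_continuous_pderiv[OF u bs]])
  show "L2 M\<Omega> (iter_pderiv bs u)" by (rule L2_cong_AE[OF wd m \<alpha>(2)])
  have "(\<integral>x. (iter_pderiv bs u x)\<^sup>2 \<partial>M\<Omega>) = (\<integral>x. (weak_deriv \<Omega> (mset bs) u x)\<^sup>2 \<partial>M\<Omega>)"
  proof (rule integral_cong_AE)
    show "AE x in M\<Omega>. (iter_pderiv bs u x)\<^sup>2 = (weak_deriv \<Omega> (mset bs) u x)\<^sup>2"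
      using \<alpha>(2) by eventually_elim simp
  qed (intro borel_measurable_power m L2_measurable[OF wd])+
  also have "\<dots> \<le> N2 u" by (rule weak_deriv_integral_le_sobolev_norm2[OF \<alpha>(1)])
  finally show "(\<integral>x. (iter_pderiv bs u x)\<^sup>2 \<partial>M\<Omega>) \<le> N2 u" .
qed

section \<open>Traces of the normal derivative\<close>

lemma frontier_not_bot: "x \<in> frontier \<Omega> \<Longrightarrow> at x within \<Omega> \<noteq> bot"
  using open_\<Omega> by (auto simp: trivial_limit_within frontier_def interior_open closure_def)

text \<open>
  The limit that defines the normal derivative on the boundary exists, because the first derivatives
  extend continuously to the closure.
\<close>
lemma grad_limit:
  assumes u: "u \<in> Hs \<Omega> s" and x: "x \<in> frontier \<Omega>"
  shows "(grad u \<longlongrightarrow> Lim (at x within \<Omega>) (grad u)) (at x within \<Omega>)"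
proof -
  have "\<exists>l. (pderiv_dir i u \<longlongrightarrow> l) (at x within \<Omega>)" if i: "i \<in> Basis" for i
  proof -
    have "[i] \<in> lists Basis" "length [i] \<le> 2" using i by simp_all
    from C2_closureD(3)[OF HsD(2)[OF u] this]
    obtain h where h: "continuous_on (closure \<Omega>) h" "\<And>y. y \<in> \<Omega> \<Longrightarrow> h y = pderiv_dir i u y" by auto
    have "(h \<longlongrightarrow> h x) (at x within closure \<Omega>)"
      using h(1) x by (auto simp: continuous_on_def frontier_def)
    then have "(h \<longlongrightarrow> h x) (at x within \<Omega>)"
      by (rule tendsto_within_subset[OF _ closure_subset])
    then have "(pderiv_dir i u \<longlongrightarrow> h x) (at x within \<Omega>)"
      by (rule Lim_transform_eventually) (simp add: eventually_at_filter h(2))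
    then show ?thesis ..
  qed
  then obtain l where l: "\<And>i. i \<in> Basis \<Longrightarrow> (pderiv_dir i u \<longlongrightarrow> l i) (at x within \<Omega>)" by metis
  have "(grad u \<longlongrightarrow> (\<Sum>i\<in>Basis. l i *\<^sub>R i)) (at x within \<Omega>)"
    unfolding grad_def[abs_def] by (intro tendsto_sum tendsto_scaleR tendsto_const l)
  then show ?thesis using tendsto_Lim[OF frontier_not_bot[OF x]] by metis
qed

lemma grad_fcomb:
  assumes "u \<in> Hs \<Omega> s" "v \<in> Hs \<Omega> s" "x \<in> \<Omega>"
  shows "grad (fcomb a u b v) x = a *\<^sub>R grad u x + b *\<^sub>R grad v x"
proof -
  have "pderiv_dir i (fcomb a u b v) x = a * pderiv_dir i u x + b * pderiv_dir i v x" if "i \<in> Basis" for i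
    using Hs_pderiv_fcomb[OF assms(1,2) _ _ assms(3), of "[i]" a b] that by simp
  then show ?thesis
    by (simp add: grad_def scaleR_add_left sum.distrib scaleR_sum_right)
qed

lemma normal_deriv_fcomb:
  assumes u: "u \<in> Hs \<Omega> s" and v: "v \<in> Hs \<Omega> s" and x: "x \<in> frontier \<Omega>"
  shows "normal_deriv \<Omega> \<nu> (fcomb a u b v) x = a * normal_deriv \<Omega> \<nu> u x + b * normal_deriv \<Omega> \<nu> v x"
proof -
  let ?L = "Lim (at x within \<Omega>)"
  have "((\<lambda>y. a *\<^sub>R grad u y + b *\<^sub>R grad v y) \<longlongrightarrow> a *\<^sub>R ?L (grad u) + b *\<^sub>R ?L (grad v)) (at x within \<Omega>)"
    by (intro tendsto_add tendsto_scaleR tendsto_const grad_limit u v x)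
  then have "(grad (fcomb a u b v) \<longlongrightarrow> a *\<^sub>R ?L (grad u) + b *\<^sub>R ?L (grad v)) (at x within \<Omega>)"
    by (rule Lim_transform_eventually) (simp add: eventually_at_filter grad_fcomb[OF u v])
  then have "?L (grad (fcomb a u b v)) = a *\<^sub>R ?L (grad u) + b *\<^sub>R ?L (grad v)"
    by (rule tendsto_Lim[OF frontier_not_bot[OF x]])
  then show ?thesis by (simp add: normal_deriv_def inner_add_right)
qed

text \<open>
  The gradient on the boundary is a limit of gradients inside \<open>\<Omega>\<close>, which the
  embedding bounds.
\<close>
lemma normal_deriv_bound:
  obtains C where "0 \<le> C"
    "\<And>u x. u \<in> Hs \<Omega> s \<Longrightarrow> x \<in> frontier \<Omega> \<Longrightarrow> \<bar>normal_deriv \<Omega> \<nu> u x\<bar> \<le> norm (\<nu> x) * (C * sqrt (N2 u))"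
proof -
  obtain C where C: "0 \<le> C" "\<And>u bs x. u \<in> Hs \<Omega> s \<Longrightarrow> bs \<in> lists Basis \<Longrightarrow> length bs \<le> 2 \<Longrightarrow> x \<in> \<Omega> \<Longrightarrow>
      \<bar>iter_pderiv bs u x\<bar> \<le> C * sqrt (N2 u)" using C2_bound by blast
  show ?thesis
  proof (rule that[of "real DIM('a) * C"])
    fix u x assume u: "u \<in> Hs \<Omega> s" and x: "x \<in> frontier \<Omega>"
    have grad: "norm (grad u y) \<le> real DIM('a) * C * sqrt (N2 u)" if y: "y \<in> \<Omega>" for y
    proof -
      have "norm (grad u y) \<le> (\<Sum>i\<in>(Basis :: 'a set). C * sqrt (N2 u))"
        unfolding grad_def
      proof (rule sum_norm_le)
        fix i :: 'a assume i: "i \<in> Basis"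
        show "norm (pderiv_dir i u y *\<^sub>R i) \<le> C * sqrt (N2 u)"
          using C(2)[OF u _ _ y, of "[i]"] i by simp
      qed
      then show ?thesis by simp
    qed
    have "norm (Lim (at x within \<Omega>) (grad u)) \<le> real DIM('a) * C * sqrt (N2 u)"
      by (rule Lim_norm_ubound[OF frontier_not_bot[OF x] grad_limit[OF u x]])
         (simp add: eventually_at_filter grad)
    then have "norm (\<nu> x) * norm (Lim (at x within \<Omega>) (grad u)) \<le> norm (\<nu> x) * (real DIM('a) * C * sqrt (N2 u))"
      by (rule mult_left_mono) simp
    then show "\<bar>normal_deriv \<Omega> \<nu> u x\<bar> \<le> norm (\<nu> x) * (real DIM('a) * C * sqrt (N2 u))"
      unfolding normal_deriv_def using Cauchy_Schwarz_ineq2 by (rule order.trans[rotated])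
  qed (use C(1) in simp)
qed

end

section \<open>The state space\<close>

definition scomb :: "real \<Rightarrow> 'a::euclidean_space state \<Rightarrow> real \<Rightarrow> 'a state \<Rightarrow> 'a state" where
  "scomb a X b Y = (\<lambda>n. fcomb a (fst X n) b (fst Y n), \<lambda>n. fcomb a (snd X n) b (snd Y n))"

lemma scomb_sel [simp]:
  "fst (scomb a X b Y) n = fcomb a (fst X n) b (fst Y n)"
  "snd (scomb a X b Y) n = fcomb a (snd X n) b (snd Y n)"
  by (simp_all add: scomb_def)

lemma state_diff: "X - Y = scomb 1 X (- 1) Y" for X Y :: "'a::euclidean_space state"
  by (simp add: scomb_def fcomb_def prod_eq_iff fun_eq_iff)

lemma component_fcomb: "component i (fcomb a v b w) = fcomb a (component i v) b (component i w)"
  by (simp add: component_def fcomb_def fun_eq_iff inner_add_left)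

lemma component_sum:
  "component i (\<lambda>x. \<Sum>j\<in>Basis. c j x *\<^sub>R j) = c i" if "i \<in> Basis"
  using that by (simp add: component_def fun_eq_iff inner_sum_left inner_Basis if_distrib cong: if_cong)

lemma component_eqI:
  assumes "\<And>i. i \<in> Basis \<Longrightarrow> component i v x = component i w x"
  shows "v x = w x"
  using assms by (auto simp: component_def intro: euclidean_eqI)

lemma L2_set_convex:
  fixes u v :: "'i \<Rightarrow> 'e::real_normed_vector"
  assumes "L2_set (\<lambda>n. norm (u n)) I \<le> m" "L2_set (\<lambda>n. norm (v n)) I \<le> m"
  shows "L2_set (\<lambda>n. norm ((1/2) *\<^sub>R u n + (1/2) *\<^sub>R v n)) I \<le> m"
proof -
  have "norm ((1/2) *\<^sub>R u n + (1/2) *\<^sub>R v n) \<le> (1/2) * norm (u n) + (1/2) * norm (v n)" for n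
    using norm_triangle_ineq[of "(1/2) *\<^sub>R u n" "(1/2) *\<^sub>R v n"] by simp
  then have "L2_set (\<lambda>n. norm ((1/2) *\<^sub>R u n + (1/2) *\<^sub>R v n)) I \<le>
      L2_set (\<lambda>n. (1/2) * norm (u n) + (1/2) * norm (v n)) I"
    by (intro L2_set_mono) simp_all
  also have "\<dots> \<le> L2_set (\<lambda>n. (1/2) * norm (u n)) I + L2_set (\<lambda>n. (1/2) * norm (v n)) I"
    by (rule L2_set_triangle_ineq)
  also have "\<dots> = (1/2) * L2_set (\<lambda>n. norm (u n)) I + (1/2) * L2_set (\<lambda>n. norm (v n)) I"
    by (simp only: L2_set_right_distrib)
  also have "\<dots> \<le> m" using assms by simp
  finally show ?thesis .
qed

locale state_space = sobolev_embedding \<Omega> s for \<Omega> :: "'a::euclidean_space set" and s +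
  fixes N :: nat
begin

abbreviation "HS \<equiv> H_space \<Omega> s N"
abbreviation "HN \<equiv> H_norm2 \<Omega> s N"

lemma H_norm2_eq:
  "HN X = (\<Sum>n\<le>N. (\<Sum>i\<in>Basis. N2 (component i (fst X n))) + N2 (snd X n))"
  by (simp add: H_norm2_def case_prod_beta)

lemma H_space_iff:
  "X \<in> HS \<longleftrightarrow> (\<forall>n\<le>N. (\<forall>i\<in>Basis. component i (fst X n) \<in> Hs \<Omega> s) \<and> snd X n \<in> Hs \<Omega> s) \<and>
     (\<forall>n>N. fst X n = (\<lambda>_. 0) \<and> snd X n = (\<lambda>_. 0))"
  by (simp add: H_space_def case_prod_beta)

lemma H_spaceD:
  assumes "X \<in> HS"
  shows "n \<le> N \<Longrightarrow> i \<in> Basis \<Longrightarrow> component i (fst X n) \<in> Hs \<Omega> s"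
    and "n \<le> N \<Longrightarrow> snd X n \<in> Hs \<Omega> s"
    and "N < n \<Longrightarrow> fst X n = (\<lambda>_. 0)" and "N < n \<Longrightarrow> snd X n = (\<lambda>_. 0)"
  using assms unfolding H_space_iff by simp_all

lemma H_space_scomb:
  assumes X: "X \<in> HS" and Y: "Y \<in> HS"
  shows "scomb a X b Y \<in> HS"
  unfolding H_space_iff
proof (intro conjI allI impI ballI)
  fix n assume n: "n \<le> N"
  show "snd (scomb a X b Y) n \<in> Hs \<Omega> s"
    using Hs_fcomb[OF H_spaceD(2)[OF X n] H_spaceD(2)[OF Y n]] by simp
  fix i :: 'a assume i: "i \<in> Basis"
  show "component i (fst (scomb a X b Y) n) \<in> Hs \<Omega> s"
    using Hs_fcomb[OF H_spaceD(1)[OF X n i] H_spaceD(1)[OF Y n i]] by (simp add: component_fcomb)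
next
  fix n assume n: "N < n"
  show "fst (scomb a X b Y) n = (\<lambda>_. 0)" "snd (scomb a X b Y) n = (\<lambda>_. 0)"
    using H_spaceD(3)[OF X n] H_spaceD(3)[OF Y n] H_spaceD(4)[OF X n] H_spaceD(4)[OF Y n]
    by (simp_all add: fcomb_def)
qed

lemma H_space_diff: "X \<in> HS \<Longrightarrow> Y \<in> HS \<Longrightarrow> X - Y \<in> HS"
  unfolding state_diff by (rule H_space_scomb)

lemma quad_form_H: "quad_form scomb HS HN"
proof -
  have "quad_form scomb HS (\<lambda>X. N2 (component i (fst X n)))" if "n \<le> N" "i \<in> Basis" for n i
    by (rule quad_form_pullback[OF quad_form_Hs H_space_scomb H_spaceD(1)[OF _ that]])
       (simp_all add: component_fcomb)
  moreover have "quad_form scomb HS (\<lambda>X. N2 (snd X n))" if "n \<le> N" for n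
    by (rule quad_form_pullback[OF quad_form_Hs H_space_scomb H_spaceD(2)[OF _ that]]) simp_all
  ultimately have "quad_form scomb HS
      (\<lambda>X. \<Sum>n\<le>N. (\<Sum>i\<in>Basis. N2 (component i (fst X n))) + N2 (snd X n))"
    by (intro quad_form_sum quad_form_add H_space_scomb) simp_all
  then show ?thesis unfolding H_norm2_eq[abs_def] .
qed

lemma component_norm2_le:
  assumes X: "X \<in> HS" and n: "n \<le> N"
  shows "N2 (snd X n) \<le> HN X" and "i \<in> Basis \<Longrightarrow> N2 (component i (fst X n)) \<le> HN X"
proof -
  have nonneg: "0 \<le> (\<Sum>i\<in>Basis. N2 (component i (fst X m)))" "0 \<le> N2 (snd X m)" if "m \<le> N" for m
    using N2_nonneg H_spaceD(1,2)[OF X that] by (simp_all add: sum_nonneg)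
  have le: "(\<Sum>i\<in>Basis. N2 (component i (fst X n))) + N2 (snd X n) \<le> HN X"
    unfolding H_norm2_eq by (rule member_le_sum) (use n nonneg in \<open>auto intro: add_nonneg_nonneg\<close>)
  show "N2 (snd X n) \<le> HN X" using le nonneg[OF n] by linarith
  assume i: "i \<in> Basis"
  have "N2 (component i (fst X n)) \<le> (\<Sum>i\<in>Basis. N2 (component i (fst X n)))"
    by (rule member_le_sum[OF i]) (simp_all add: N2_nonneg[OF H_spaceD(1)[OF X n]])
  then show "N2 (component i (fst X n)) \<le> HN X" using le nonneg[OF n] by linarith
qed

lemma H_eq_of_norm2:
  assumes X: "X \<in> HS" and Y: "Y \<in> HS" and 0: "HN (X - Y) \<le> 0"
  shows "X = Y"
proof -
  have D: "X - Y \<in> HS" by (rule H_space_diff[OF X Y])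
  have "fst X n x = fst Y n x \<and> snd X n x = snd Y n x" for n x
  proof (cases "n \<le> N")
    case True
    have "snd (X - Y) n = (\<lambda>x. 0)"
      using Hs_zero_of_norm2[OF H_spaceD(2)[OF D True]] component_norm2_le(1)[OF D True] 0 by linarith
    moreover have "component i (fst (X - Y) n) = (\<lambda>x. 0)" if "i \<in> Basis" for i
      using Hs_zero_of_norm2[OF H_spaceD(1)[OF D True that]] component_norm2_le(2)[OF D True that] 0 by linarith
    then have "fst (X - Y) n x = 0"
      using component_eqI[of "fst (X - Y) n" x "\<lambda>x. 0"] by (simp add: component_def)
    ultimately show ?thesis
      by (simp add: fun_eq_iff)
  next
    case False
    then show ?thesis using H_spaceD(3,4)[OF X] H_spaceD(3,4)[OF Y] by simp
  qed
  then show ?thesis by (simp add: prod_eq_iff fun_eq_iff)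
qed

lemma component_diff: "component i (fst (X - Y) n) = (\<lambda>x. component i (fst X n) x - component i (fst Y n) x)"
  for X Y :: "'a state"
  by (simp add: component_def inner_diff_left)

lemma snd_diff: "snd (X - Y) n = (\<lambda>x. snd X n x - snd Y n x)" for X Y :: "'a state"
  by (simp add: fun_eq_iff)

text \<open>
  A Cauchy sequence of states is Cauchy in each component, and \<open>H_norm2\<close> is the sum of
  the squared norms of the components.
\<close>
lemma H_complete:
  assumes X: "\<And>k. X k \<in> HS"
    and Cauchy: "\<And>e. 0 < e \<Longrightarrow> \<exists>K. \<forall>i\<ge>K. \<forall>j\<ge>K. HN (X i - X j) < e"
  shows "\<exists>A\<in>HS. (\<lambda>k. HN (X k - A)) \<longlonglongrightarrow> 0"
proof -
  have "\<exists>u\<in>Hs \<Omega> s. (\<lambda>k. N2 (\<lambda>x. snd (X k) n x - u x)) \<longlonglongrightarrow> 0" if n: "n \<le> N" for n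
  proof (rule Hs_complete[OF H_spaceD(2)[OF X n]])
    show "\<exists>K. \<forall>i\<ge>K. \<forall>j\<ge>K. N2 (\<lambda>x. snd (X i) n x - snd (X j) n x) < e" if "0 < e" for e
      by (rule Cauchy_bound_mono[OF _ Cauchy[OF that]])
         (rule component_norm2_le(1)[OF H_space_diff[OF X X] n, unfolded snd_diff])
  qed
  then have "\<forall>n\<in>{..N}. \<exists>u. u \<in> Hs \<Omega> s \<and> (\<lambda>k. N2 (\<lambda>x. snd (X k) n x - u x)) \<longlonglongrightarrow> 0"
    by blast
  from bchoice[OF this] obtain q where q': "\<forall>n\<in>{..N}. q n \<in> Hs \<Omega> s \<and>
    (\<lambda>k. N2 (\<lambda>x. snd (X k) n x - q n x)) \<longlonglongrightarrow> 0" by blast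
  have q: "q n \<in> Hs \<Omega> s" "(\<lambda>k. N2 (\<lambda>x. snd (X k) n x - q n x)) \<longlonglongrightarrow> 0" if "n \<le> N" for n
    using q' that by simp_all
  have "\<exists>u\<in>Hs \<Omega> s. (\<lambda>k. N2 (\<lambda>x. component i (fst (X k) n) x - u x)) \<longlonglongrightarrow> 0"
    if n: "n \<le> N" and i: "i \<in> Basis" for n i
  proof (rule Hs_complete[OF H_spaceD(1)[OF X n i]])
    show "\<exists>K. \<forall>k\<ge>K. \<forall>l\<ge>K. N2 (\<lambda>x. component i (fst (X k) n) x - component i (fst (X l) n) x) < e"
      if "0 < e" for e
      by (rule Cauchy_bound_mono[OF _ Cauchy[OF that]])
         (rule component_norm2_le(2)[OF H_space_diff[OF X X] n i, unfolded component_diff])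
  qed
  then have "\<forall>p\<in>{..N} \<times> (Basis :: 'a set). \<exists>u. u \<in> Hs \<Omega> s \<and>
      (\<lambda>k. N2 (\<lambda>x. component (snd p) (fst (X k) (fst p)) x - u x)) \<longlonglongrightarrow> 0"
    by auto
  from bchoice[OF this] obtain c' where c': "\<forall>p\<in>{..N} \<times> (Basis :: 'a set). c' p \<in> Hs \<Omega> s \<and>
      (\<lambda>k. N2 (\<lambda>x. component (snd p) (fst (X k) (fst p)) x - c' p x)) \<longlonglongrightarrow> 0" by blast
  define c where "c n i = c' (n, i)" for n i
  have c: "c n i \<in> Hs \<Omega> s" "(\<lambda>k. N2 (\<lambda>x. component i (fst (X k) n) x - c n i x)) \<longlonglongrightarrow> 0"
    if "n \<le> N" "i \<in> Basis" for n i
    using bspec[OF c', of "(n, i)"] that by (simp_all add: c_def)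
  define A :: "'a state" where "A = (\<lambda>n. if n \<le> N then (\<lambda>x. \<Sum>i\<in>Basis. c n i x *\<^sub>R i) else (\<lambda>_. 0),
      \<lambda>n. if n \<le> N then q n else (\<lambda>_. 0))"
  have A1: "component i (fst A n) = c n i" if "n \<le> N" "i \<in> Basis" for n i
    using that by (simp add: A_def component_sum)
  have A2: "snd A n = q n" if "n \<le> N" for n using that by (simp add: A_def)
  have "A \<in> HS"
    unfolding H_space_iff using c(1) q(1) A1 A2 by (simp add: A_def)
  moreover have "(\<lambda>k. HN (X k - A)) \<longlonglongrightarrow> (\<Sum>n\<le>N. (\<Sum>i\<in>(Basis :: 'a set). 0) + 0)"
    unfolding H_norm2_eq component_diff snd_diff
    by (intro tendsto_sum tendsto_add) (simp_all add: A1 A2 c(2) q(2))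
  ultimately show ?thesis by auto
qed

lemma tendsto_of_norm2_bound:
  assumes bound: "\<And>k. \<bar>f k - l\<bar> \<le> C * sqrt (N2 (u k))" and lim: "(\<lambda>k. N2 (u k)) \<longlonglongrightarrow> 0"
  shows "f \<longlonglongrightarrow> l"
proof (rule LIM_zero_cancel, rule Lim_null_comparison)
  show "\<forall>\<^sub>F k in sequentially. norm (f k - l) \<le> C * sqrt (N2 (u k))" using bound by simp
  have "(\<lambda>k. C * sqrt (N2 (u k))) \<longlonglongrightarrow> C * sqrt 0"
    by (intro tendsto_mult tendsto_const tendsto_real_sqrt lim)
  then show "(\<lambda>k. C * sqrt (N2 (u k))) \<longlonglongrightarrow> 0" by simp
qed

text \<open>
  Values and normal derivatives on the boundary are continuous in the \<open>H\<^sup>s\<close> norm;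
  this is why the boundary conditions define a closed set.
\<close>
lemma Hs_tendsto:
  assumes u: "\<And>k. u k \<in> Hs \<Omega> s" and v: "v \<in> Hs \<Omega> s" and lim: "(\<lambda>k. N2 (\<lambda>x. u k x - v x)) \<longlonglongrightarrow> 0"
  shows "x \<in> closure \<Omega> \<Longrightarrow> (\<lambda>k. u k x) \<longlonglongrightarrow> v x"
    and "x \<in> frontier \<Omega> \<Longrightarrow> (\<lambda>k. normal_deriv \<Omega> \<nu> (u k) x) \<longlonglongrightarrow> normal_deriv \<Omega> \<nu> v x"
proof -
  have diff: "(\<lambda>x. u k x - v x) \<in> Hs \<Omega> s" for k by (rule Hs_diff[OF u v])
  assume x: "x \<in> closure \<Omega>"
  obtain C where C: "0 \<le> C" "\<And>u x. u \<in> Hs \<Omega> s \<Longrightarrow> x \<in> closure \<Omega> \<Longrightarrow> \<bar>u x\<bar> \<le> C * sqrt (N2 u)"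
    using closure_bound by blast
  show "(\<lambda>k. u k x) \<longlonglongrightarrow> v x"
    by (rule tendsto_of_norm2_bound[OF _ lim]) (rule C(2)[OF diff x])
next
  have diff: "(\<lambda>x. u k x - v x) \<in> Hs \<Omega> s" for k by (rule Hs_diff[OF u v])
  assume x: "x \<in> frontier \<Omega>"
  obtain C where C: "0 \<le> C"
    "\<And>u x. u \<in> Hs \<Omega> s \<Longrightarrow> x \<in> frontier \<Omega> \<Longrightarrow> \<bar>normal_deriv \<Omega> \<nu> u x\<bar> \<le> norm (\<nu> x) * (C * sqrt (N2 u))"
    using normal_deriv_bound by blast
  have "\<bar>normal_deriv \<Omega> \<nu> (u k) x - normal_deriv \<Omega> \<nu> v x\<bar> \<le> (norm (\<nu> x) * C) * sqrt (N2 (\<lambda>x. u k x - v x))" for k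
    using C(2)[OF diff x, of k] normal_deriv_fcomb[OF u v x, of \<nu> 1 k "- 1"]
    by (simp add: fcomb_diff mult.assoc)
  then show "(\<lambda>k. normal_deriv \<Omega> \<nu> (u k) x) \<longlonglongrightarrow> normal_deriv \<Omega> \<nu> v x"
    by (rule tendsto_of_norm2_bound[OF _ lim])
qed

lemma H_component_tendsto:
  assumes X: "\<And>k. X k \<in> HS" and a: "a \<in> HS" and lim: "(\<lambda>k. HN (X k - a)) \<longlonglongrightarrow> 0" and n: "n \<le> N"
  shows "(\<lambda>k. N2 (\<lambda>x. snd (X k) n x - snd a n x)) \<longlonglongrightarrow> 0"
    and "i \<in> Basis \<Longrightarrow> (\<lambda>k. N2 (\<lambda>x. component i (fst (X k) n) x - component i (fst a n) x)) \<longlonglongrightarrow> 0"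
proof -
  have D: "X k - a \<in> HS" for k by (rule H_space_diff[OF X a])
  show "(\<lambda>k. N2 (\<lambda>x. snd (X k) n x - snd a n x)) \<longlonglongrightarrow> 0"
  proof (rule tendsto_sandwich[OF _ _ tendsto_const lim])
    show "\<forall>\<^sub>F k in sequentially. 0 \<le> N2 (\<lambda>x. snd (X k) n x - snd a n x)"
      using N2_nonneg[OF H_spaceD(2)[OF D n]] unfolding snd_diff by simp
    show "\<forall>\<^sub>F k in sequentially. N2 (\<lambda>x. snd (X k) n x - snd a n x) \<le> HN (X k - a)"
      using component_norm2_le(1)[OF D n] unfolding snd_diff by simp
  qed
  assume i: "i \<in> Basis"
  show "(\<lambda>k. N2 (\<lambda>x. component i (fst (X k) n) x - component i (fst a n) x)) \<longlonglongrightarrow> 0"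
  proof (rule tendsto_sandwich[OF _ _ tendsto_const lim])
    show "\<forall>\<^sub>F k in sequentially. 0 \<le> N2 (\<lambda>x. component i (fst (X k) n) x - component i (fst a n) x)"
      using N2_nonneg[OF H_spaceD(1)[OF D n i]] unfolding component_diff by simp
    show "\<forall>\<^sub>F k in sequentially. N2 (\<lambda>x. component i (fst (X k) n) x - component i (fst a n) x) \<le> HN (X k - a)"
      using component_norm2_le(2)[OF D n i] unfolding component_diff by simp
  qed
qed

lemma tendsto_componentI:
  fixes w :: "'a \<Rightarrow> 'a"
  assumes "\<And>i. i \<in> Basis \<Longrightarrow> (\<lambda>k. component i (v k) x) \<longlonglongrightarrow> component i w x"
  shows "(\<lambda>k. v k x) \<longlonglongrightarrow> w x"
  using assms unfolding component_def by (subst tendsto_componentwise_iff) blast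

lemma H_velocity_continuous:
  assumes X: "X \<in> HS" and n: "n \<le> N"
  shows "continuous_on \<Omega> (fst X n)"
proof -
  have "continuous_on \<Omega> (component i (fst X n))" if "i \<in> Basis" for i
    using Hs_continuous_pderiv[OF H_spaceD(1)[OF X n that], of "[]"] by simp
  then show ?thesis
    unfolding component_def by (subst continuous_on_componentwise) blast
qed

lemma H_pressure_continuous:
  assumes X: "X \<in> HS" and n: "n \<le> N"
  shows "continuous_on \<Omega> (snd X n)"
  using Hs_continuous_pderiv[OF H_spaceD(2)[OF X n], of "[]"] by simp

section \<open>The admissible set\<close>

text \<open>
  Continuity supplies measurability of \<open>f\<close> on \<open>\<Omega>\<close>; the essential
  supremum of a nonmeasurable function is infinite.
\<close>
lemma Linf_norm_le_iff:
  assumes "continuous_on \<Omega> f"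
  shows "Linf_norm \<Omega> f \<le> ereal m \<longleftrightarrow> (AE x in M\<Omega>. \<bar>f x\<bar> \<le> m)"
proof
  assume le: "Linf_norm \<Omega> f \<le> ereal m"
  have "AE x in M\<Omega>. ereal \<bar>f x\<bar> \<le> Linf_norm \<Omega> f"
    unfolding Linf_norm_def by (rule esssup_AE)
  then show "AE x in M\<Omega>. \<bar>f x\<bar> \<le> m"
    by eventually_elim (use le in \<open>metis ereal_less_eq(3) order_trans\<close>)
next
  assume "AE x in M\<Omega>. \<bar>f x\<bar> \<le> m"
  moreover have "f \<in> borel_measurable M\<Omega>" by (rule continuous_imp_measurable_M\<Omega>[OF assms])
  ultimately show "Linf_norm \<Omega> f \<le> ereal m"
    unfolding Linf_norm_def by (intro esssup_I) simp_all
qed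

lemma admissible_iff:
  "X \<in> admissible \<Omega> \<nu> s N m T g h\<^sub>1 h\<^sub>2 \<longleftrightarrow> X \<in> HS \<and>
     (AE x in M\<Omega>. L2_set (\<lambda>n. norm (fst X n x)) {..N} \<le> m) \<and>
     (AE x in M\<Omega>. L2_set (\<lambda>n. norm (snd X n x)) {..N} \<le> m) \<and>
     (\<forall>n\<le>N. \<forall>x\<in>frontier \<Omega>.
        fst X n x = 0 \<and>
        vec_normal_deriv \<Omega> \<nu> (fst X n) x = data_coeff T g n x \<and>
        snd X n x = data_coeff T h\<^sub>1 n x \<and>
        normal_deriv \<Omega> \<nu> (snd X n) x = data_coeff T h\<^sub>2 n x)"
proof (cases "X \<in> HS")
  case True
  have 1: "continuous_on \<Omega> (\<lambda>x. sqrt (\<Sum>n\<le>N. (norm (fst X n x))\<^sup>2))"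
    by (intro continuous_on_real_sqrt continuous_on_sum continuous_on_power continuous_on_norm
        H_velocity_continuous[OF True]) simp
  have 2: "continuous_on \<Omega> (\<lambda>x. sqrt (\<Sum>n\<le>N. (snd X n x)\<^sup>2))"
    by (intro continuous_on_real_sqrt continuous_on_sum continuous_on_power
        H_pressure_continuous[OF True]) simp
  have 3: "\<bar>sqrt (\<Sum>n\<le>N. (norm (fst X n x))\<^sup>2)\<bar> = L2_set (\<lambda>n. norm (fst X n x)) {..N}"
    "\<bar>sqrt (\<Sum>n\<le>N. (snd X n x)\<^sup>2)\<bar> = L2_set (\<lambda>n. norm (snd X n x)) {..N}" for x
    by (simp_all add: L2_set_def sum_nonneg)
  show ?thesis
    unfolding admissible_def case_prod_beta mem_Collect_eq Linf_norm_le_iff[OF 1] Linf_norm_le_iff[OF 2] 3 prod.collapse ..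
next
  case False
  then show ?thesis unfolding admissible_def case_prod_beta mem_Collect_eq prod.collapse by blast
qed

lemma admissibleD:
  assumes "X \<in> admissible \<Omega> \<nu> s N m T g h\<^sub>1 h\<^sub>2"
  shows "X \<in> HS"
    and "AE x in M\<Omega>. L2_set (\<lambda>n. norm (fst X n x)) {..N} \<le> m"
    and "AE x in M\<Omega>. L2_set (\<lambda>n. norm (snd X n x)) {..N} \<le> m"
    and "n \<le> N \<Longrightarrow> x \<in> frontier \<Omega> \<Longrightarrow> fst X n x = 0"
    and "n \<le> N \<Longrightarrow> x \<in> frontier \<Omega> \<Longrightarrow> vec_normal_deriv \<Omega> \<nu> (fst X n) x = data_coeff T g n x"
    and "n \<le> N \<Longrightarrow> x \<in> frontier \<Omega> \<Longrightarrow> snd X n x = data_coeff T h\<^sub>1 n x"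
    and "n \<le> N \<Longrightarrow> x \<in> frontier \<Omega> \<Longrightarrow> normal_deriv \<Omega> \<nu> (snd X n) x = data_coeff T h\<^sub>2 n x"
proof -
  note c = assms[unfolded admissible_iff]
  note b = conjunct2[OF conjunct2[OF conjunct2[OF c]], rule_format]
  show "X \<in> HS" by (rule conjunct1[OF c])
  show "AE x in M\<Omega>. L2_set (\<lambda>n. norm (fst X n x)) {..N} \<le> m" by (rule conjunct1[OF conjunct2[OF c]])
  show "AE x in M\<Omega>. L2_set (\<lambda>n. norm (snd X n x)) {..N} \<le> m" by (rule conjunct1[OF conjunct2[OF conjunct2[OF c]]])
  assume n: "n \<le> N" "x \<in> frontier \<Omega>"
  show "fst X n x = 0" by (rule conjunct1[OF b[OF n]])
  show "vec_normal_deriv \<Omega> \<nu> (fst X n) x = data_coeff T g n x" by (rule conjunct1[OF conjunct2[OF b[OF n]]])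
  show "snd X n x = data_coeff T h\<^sub>1 n x" by (rule conjunct1[OF conjunct2[OF conjunct2[OF b[OF n]]]])
  show "normal_deriv \<Omega> \<nu> (snd X n) x = data_coeff T h\<^sub>2 n x" by (rule conjunct2[OF conjunct2[OF conjunct2[OF b[OF n]]]])
qed

lemma vec_normal_deriv_fcomb:
  assumes X: "X \<in> HS" and Y: "Y \<in> HS" and n: "n \<le> N" and x: "x \<in> frontier \<Omega>"
  shows "vec_normal_deriv \<Omega> \<nu> (fcomb a (fst X n) b (fst Y n)) x =
    a *\<^sub>R vec_normal_deriv \<Omega> \<nu> (fst X n) x + b *\<^sub>R vec_normal_deriv \<Omega> \<nu> (fst Y n) x"
proof -
  have "normal_deriv \<Omega> \<nu> (component i (fcomb a (fst X n) b (fst Y n))) x =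
      a * normal_deriv \<Omega> \<nu> (component i (fst X n)) x + b * normal_deriv \<Omega> \<nu> (component i (fst Y n)) x"
    if "i \<in> Basis" for i
    unfolding component_fcomb
    by (rule normal_deriv_fcomb[OF H_spaceD(1)[OF X n that] H_spaceD(1)[OF Y n that] x])
  then show ?thesis
    by (simp add: vec_normal_deriv_def scaleR_add_left sum.distrib scaleR_sum_right)
qed

text \<open>
  The sup-norm bounds are convex, by Minkowski's inequality for the sum over \<open>n\<close>, and
  the boundary conditions are affine.
\<close>
lemma admissible_midpoint:
  assumes X: "X \<in> admissible \<Omega> \<nu> s N m T g h\<^sub>1 h\<^sub>2" and Y: "Y \<in> admissible \<Omega> \<nu> s N m T g h\<^sub>1 h\<^sub>2"
  shows "scomb (1/2) X (1/2) Y \<in> admissible \<Omega> \<nu> s N m T g h\<^sub>1 h\<^sub>2"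
  unfolding admissible_iff
proof (intro conjI allI impI ballI)
  note XH = admissibleD(1)[OF X] and YH = admissibleD(1)[OF Y]
  show "scomb (1/2) X (1/2) Y \<in> HS" by (rule H_space_scomb[OF XH YH])
  show "AE x in M\<Omega>. L2_set (\<lambda>n. norm (fst (scomb (1/2) X (1/2) Y) n x)) {..N} \<le> m"
    using admissibleD(2)[OF X] admissibleD(2)[OF Y] unfolding scomb_sel fcomb_def by eventually_elim (rule L2_set_convex)
  show "AE x in M\<Omega>. L2_set (\<lambda>n. norm (snd (scomb (1/2) X (1/2) Y) n x)) {..N} \<le> m"
    using admissibleD(3)[OF X] admissibleD(3)[OF Y] unfolding scomb_sel fcomb_def by eventually_elim (rule L2_set_convex)
  fix n x assume n: "n \<le> N" and x: "x \<in> frontier \<Omega>"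
  note bX = admissibleD(4-7)[OF X n x] and bY = admissibleD(4-7)[OF Y n x]
  have half: "(1/2) *\<^sub>R z + (1/2) *\<^sub>R z = z" for z :: "'e::real_vector"
    by (simp add: scaleR_add_left[symmetric])
  have half': "1/2 * z + 1/2 * z = z" for z :: real by simp
  show "fst (scomb (1/2) X (1/2) Y) n x = 0" using bX bY by (simp add: fcomb_def)
  show "snd (scomb (1/2) X (1/2) Y) n x = data_coeff T h\<^sub>1 n x"
    unfolding scomb_sel fcomb_def bX bY by (rule half)
  show "vec_normal_deriv \<Omega> \<nu> (fst (scomb (1/2) X (1/2) Y) n) x = data_coeff T g n x"
    unfolding scomb_sel vec_normal_deriv_fcomb[OF XH YH n x] bX bY by (rule half)
  show "normal_deriv \<Omega> \<nu> (snd (scomb (1/2) X (1/2) Y) n) x = data_coeff T h\<^sub>2 n x"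
    unfolding scomb_sel normal_deriv_fcomb[OF H_spaceD(2)[OF XH n] H_spaceD(2)[OF YH n] x] bX bY by (rule half')
qed

lemma L2_set_tendsto_le:
  fixes u :: "nat \<Rightarrow> 'i \<Rightarrow> 'e::real_normed_vector"
  assumes "\<And>k. L2_set (\<lambda>n. norm (u k n)) I \<le> m" "\<And>n. n \<in> I \<Longrightarrow> (\<lambda>k. u k n) \<longlonglongrightarrow> v n"
  shows "L2_set (\<lambda>n. norm (v n)) I \<le> m"
proof (rule LIMSEQ_le_const2)
  show "(\<lambda>k. L2_set (\<lambda>n. norm (u k n)) I) \<longlonglongrightarrow> L2_set (\<lambda>n. norm (v n)) I"
    unfolding L2_set_def by (intro tendsto_real_sqrt tendsto_sum tendsto_power tendsto_norm assms(2))
qed (use assms(1) in blast)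

text \<open>
  Convergence in \<open>H\<close> implies pointwise convergence of values on the closure and of
  normal derivatives on the boundary, and all constraints are closed conditions on these.
\<close>
lemma admissible_closed:
  assumes X: "\<And>k. X k \<in> admissible \<Omega> \<nu> s N m T g h\<^sub>1 h\<^sub>2" and a: "a \<in> HS"
    and lim: "(\<lambda>k. HN (X k - a)) \<longlonglongrightarrow> 0"
  shows "a \<in> admissible \<Omega> \<nu> s N m T g h\<^sub>1 h\<^sub>2"
proof -
  note XH = admissibleD(1)[OF X]
  have c1: "(\<lambda>k. component i (fst (X k) n) x) \<longlonglongrightarrow> component i (fst a n) x"
    if "n \<le> N" "i \<in> Basis" "x \<in> closure \<Omega>" for n i x
    by (rule Hs_tendsto(1)[OF H_spaceD(1)[OF XH that(1,2)] H_spaceD(1)[OF a that(1,2)]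
          H_component_tendsto(2)[OF XH a lim that(1,2)] that(3)])
  have c2: "(\<lambda>k. normal_deriv \<Omega> \<nu> (component i (fst (X k) n)) x) \<longlonglongrightarrow> normal_deriv \<Omega> \<nu> (component i (fst a n)) x"
    if "n \<le> N" "i \<in> Basis" "x \<in> frontier \<Omega>" for n i x
    by (rule Hs_tendsto(2)[OF H_spaceD(1)[OF XH that(1,2)] H_spaceD(1)[OF a that(1,2)]
          H_component_tendsto(2)[OF XH a lim that(1,2)] that(3)])
  have p1: "(\<lambda>k. snd (X k) n x) \<longlonglongrightarrow> snd a n x" if "n \<le> N" "x \<in> closure \<Omega>" for n x
    by (rule Hs_tendsto(1)[OF H_spaceD(2)[OF XH that(1)] H_spaceD(2)[OF a that(1)]
          H_component_tendsto(1)[OF XH a lim that(1)] that(2)])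
  have p2: "(\<lambda>k. normal_deriv \<Omega> \<nu> (snd (X k) n) x) \<longlonglongrightarrow> normal_deriv \<Omega> \<nu> (snd a n) x"
    if "n \<le> N" "x \<in> frontier \<Omega>" for n x
    by (rule Hs_tendsto(2)[OF H_spaceD(2)[OF XH that(1)] H_spaceD(2)[OF a that(1)]
          H_component_tendsto(1)[OF XH a lim that(1)] that(2)])
  have v1: "(\<lambda>k. fst (X k) n x) \<longlonglongrightarrow> fst a n x" if "n \<le> N" "x \<in> closure \<Omega>" for n x
    by (rule tendsto_componentI) (rule c1[OF that(1) _ that(2)])
  have v2: "(\<lambda>k. vec_normal_deriv \<Omega> \<nu> (fst (X k) n) x) \<longlonglongrightarrow> vec_normal_deriv \<Omega> \<nu> (fst a n) x"
    if "n \<le> N" "x \<in> frontier \<Omega>" for n x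
    unfolding vec_normal_deriv_def
    by (intro tendsto_sum tendsto_scaleR tendsto_const c2[OF that(1) _ that(2)])
  have AE_\<Omega>: "AE x in M\<Omega>. x \<in> \<Omega>" by (simp add: AE_M\<Omega>_iff)
  have sub: "x \<in> \<Omega> \<Longrightarrow> x \<in> closure \<Omega>" "x \<in> frontier \<Omega> \<Longrightarrow> x \<in> closure \<Omega>" for x
    using closure_subset by (auto simp: frontier_def)
  show ?thesis
    unfolding admissible_iff
  proof (intro conjI allI impI ballI a)
    have "AE x in M\<Omega>. \<forall>k. L2_set (\<lambda>n. norm (fst (X k) n x)) {..N} \<le> m"
      unfolding AE_all_countable by (rule allI) (rule admissibleD(2)[OF X])
    then show "AE x in M\<Omega>. L2_set (\<lambda>n. norm (fst a n x)) {..N} \<le> m"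
      using AE_\<Omega>
    proof eventually_elim
      case (elim x)
      show ?case
      proof (rule L2_set_tendsto_le[where u = "\<lambda>k n. fst (X k) n x"])
        show "L2_set (\<lambda>n. norm (fst (X k) n x)) {..N} \<le> m" for k using elim(1) by (rule spec)
        show "(\<lambda>k. fst (X k) n x) \<longlonglongrightarrow> fst a n x" if "n \<in> {..N}" for n
          by (rule v1[OF _ sub(1)[OF elim(2)]]) (use that in simp)
      qed
    qed
    have "AE x in M\<Omega>. \<forall>k. L2_set (\<lambda>n. norm (snd (X k) n x)) {..N} \<le> m"
      unfolding AE_all_countable by (rule allI) (rule admissibleD(3)[OF X])
    then show "AE x in M\<Omega>. L2_set (\<lambda>n. norm (snd a n x)) {..N} \<le> m"
      using AE_\<Omega>
    proof eventually_elim
      case (elim x)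
      show ?case
      proof (rule L2_set_tendsto_le[where u = "\<lambda>k n. snd (X k) n x"])
        show "L2_set (\<lambda>n. norm (snd (X k) n x)) {..N} \<le> m" for k using elim(1) by (rule spec)
        show "(\<lambda>k. snd (X k) n x) \<longlonglongrightarrow> snd a n x" if "n \<in> {..N}" for n
          by (rule p1[OF _ sub(1)[OF elim(2)]]) (use that in simp)
      qed
    qed
    fix n x assume n: "n \<le> N" and x: "x \<in> frontier \<Omega>"
    note bX = admissibleD(4-7)[OF X n x]
    show "fst a n x = 0" "vec_normal_deriv \<Omega> \<nu> (fst a n) x = data_coeff T g n x"
      "snd a n x = data_coeff T h\<^sub>1 n x" "normal_deriv \<Omega> \<nu> (snd a n) x = data_coeff T h\<^sub>2 n x"
      using v1[OF n sub(2)[OF x]] v2[OF n x] p1[OF n sub(2)[OF x]] p2[OF n x]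
      unfolding bX LIMSEQ_const_iff by simp_all
  qed
qed

end

section \<open>Bounded linear operators on states\<close>

lemma mat_act_add: "mat_act N A (\<lambda>l. v l + w l) m = mat_act N A v m + mat_act N A w m"
  by (simp add: mat_act_def scaleR_add_right sum.distrib)

lemma L2_mat_act:
  "(\<And>l. l \<le> N \<Longrightarrow> L2 M (\<lambda>x. v l x)) \<Longrightarrow> L2 M (\<lambda>x. mat_act N A (\<lambda>l. v l x) m)"
  unfolding mat_act_def by (intro L2_sum L2_scaleR) simp

lemma norm_square_combination:
  fixes p q :: "'e::real_inner"
  shows "(norm (a *\<^sub>R p + b *\<^sub>R q))\<^sup>2 = a\<^sup>2 * (norm p)\<^sup>2 + 2 * a * b * (p \<bullet> q) + b\<^sup>2 * (norm q)\<^sup>2"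
  unfolding power2_norm_eq_inner inner_add_left inner_add_right inner_scaleR_left inner_scaleR_right
    inner_commute[of q p]
  by algebra

context state_space
begin

text \<open>
  A bounded linear operator from states into \<open>L\<^sup>2(\<Omega>)\<close>. Linearity is
  pointwise on \<open>\<Omega>\<close>, which makes sense because states consist of continuous
  representatives.
\<close>
definition bounded_op :: "('a state \<Rightarrow> 'a \<Rightarrow> 'e::euclidean_space) \<Rightarrow> bool" where
  "bounded_op D \<longleftrightarrow>
     (\<exists>C\<ge>0. \<forall>X\<in>HS. L2 M\<Omega> (D X) \<and> (\<integral>x. (norm (D X x))\<^sup>2 \<partial>M\<Omega>) \<le> C * HN X) \<and>
     (\<forall>X\<in>HS. \<forall>Y\<in>HS. \<forall>a b. \<forall>x\<in>\<Omega>. D (scomb a X b Y) x = a *\<^sub>R D X x + b *\<^sub>R D Y x)"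

lemma bounded_opI:
  assumes "0 \<le> C" "\<And>X. X \<in> HS \<Longrightarrow> L2 M\<Omega> (D X)"
    "\<And>X. X \<in> HS \<Longrightarrow> (\<integral>x. (norm (D X x))\<^sup>2 \<partial>M\<Omega>) \<le> C * HN X"
    "\<And>X Y a b x. X \<in> HS \<Longrightarrow> Y \<in> HS \<Longrightarrow> x \<in> \<Omega> \<Longrightarrow> D (scomb a X b Y) x = a *\<^sub>R D X x + b *\<^sub>R D Y x"
  shows "bounded_op D"
  unfolding bounded_op_def using assms by blast

lemma bounded_op_L2: "bounded_op D \<Longrightarrow> X \<in> HS \<Longrightarrow> L2 M\<Omega> (D X)"
  unfolding bounded_op_def by blast

lemma bounded_op_bound:
  assumes "bounded_op D"
  obtains C where "0 \<le> C" "\<And>X. X \<in> HS \<Longrightarrow> (\<integral>x. (norm (D X x))\<^sup>2 \<partial>M\<Omega>) \<le> C * HN X"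
  using assms unfolding bounded_op_def by blast

lemma bounded_op_scomb:
  assumes "bounded_op D" "X \<in> HS" "Y \<in> HS" "x \<in> \<Omega>"
  shows "D (scomb a X b Y) x = a *\<^sub>R D X x + b *\<^sub>R D Y x"
  using assms unfolding bounded_op_def by blast

lemma bounded_op_add:
  assumes D: "bounded_op D" and E: "bounded_op E"
  shows "bounded_op (\<lambda>X x. D X x + E X x)"
proof -
  obtain C where C: "0 \<le> C" "\<And>X. X \<in> HS \<Longrightarrow> (\<integral>x. (norm (D X x))\<^sup>2 \<partial>M\<Omega>) \<le> C * HN X"
    using bounded_op_bound[OF D] by blast
  obtain C' where C': "0 \<le> C'" "\<And>X. X \<in> HS \<Longrightarrow> (\<integral>x. (norm (E X x))\<^sup>2 \<partial>M\<Omega>) \<le> C' * HN X"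
    using bounded_op_bound[OF E] by blast
  show ?thesis
  proof (rule bounded_opI[of "2 * C + 2 * C'"])
    fix X assume X: "X \<in> HS"
    note DX = bounded_op_L2[OF D X] and EX = bounded_op_L2[OF E X]
    show L2: "L2 M\<Omega> (\<lambda>x. D X x + E X x)" by (rule L2_add[OF DX EX])
    have "(\<integral>x. (norm (D X x + E X x))\<^sup>2 \<partial>M\<Omega>) \<le> (\<integral>x. 2 * (norm (D X x))\<^sup>2 + 2 * (norm (E X x))\<^sup>2 \<partial>M\<Omega>)"
      by (intro integral_mono Bochner_Integration.integrable_add integrable_mult_right
          L2_integrable_norm2 L2 DX EX norm_add_square_le)
    also have "\<dots> = 2 * (\<integral>x. (norm (D X x))\<^sup>2 \<partial>M\<Omega>) + 2 * (\<integral>x. (norm (E X x))\<^sup>2 \<partial>M\<Omega>)"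
      using L2_integrable_norm2[OF DX] L2_integrable_norm2[OF EX] by simp
    also have "\<dots> \<le> 2 * (C * HN X) + 2 * (C' * HN X)"
      by (intro add_mono mult_left_mono C(2) C'(2) X) simp_all
    finally show "(\<integral>x. (norm (D X x + E X x))\<^sup>2 \<partial>M\<Omega>) \<le> (2 * C + 2 * C') * HN X"
      by (simp add: algebra_simps)
  next
    fix X Y a b x assume "X \<in> HS" "Y \<in> HS" "x \<in> \<Omega>"
    then show "D (scomb a X b Y) x + E (scomb a X b Y) x = a *\<^sub>R (D X x + E X x) + b *\<^sub>R (D Y x + E Y x)"
      by (simp add: bounded_op_scomb[OF D] bounded_op_scomb[OF E] scaleR_add_right)
  qed (use C(1) C'(1) in simp)
qed

lemma bounded_op_linear:
  fixes D :: "'a state \<Rightarrow> 'a \<Rightarrow> 'e::euclidean_space" and T :: "'e \<Rightarrow> 'f::euclidean_space"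
  assumes D: "bounded_op D" and T: "bounded_linear T"
  shows "bounded_op (\<lambda>X x. T (D X x))"
proof -
  obtain C where C: "0 \<le> C" "\<And>X. X \<in> HS \<Longrightarrow> (\<integral>x. (norm (D X x))\<^sup>2 \<partial>M\<Omega>) \<le> C * HN X"
    using bounded_op_bound[OF D] by blast
  obtain K where K: "\<And>y. norm (T y) \<le> norm y * K" using bounded_linear.bounded[OF T] by blast
  show ?thesis
  proof (rule bounded_opI[of "K\<^sup>2 * C"])
    fix X assume X: "X \<in> HS"
    note DX = bounded_op_L2[OF D X]
    show L2: "L2 M\<Omega> (\<lambda>x. T (D X x))" by (rule L2_bounded_linear[OF DX T])
    have "(norm (T y))\<^sup>2 \<le> K\<^sup>2 * (norm y)\<^sup>2" for y
      using power_mono[OF K norm_ge_zero, of y 2] by (simp add: power_mult_distrib mult.commute)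
    then have "(\<integral>x. (norm (T (D X x)))\<^sup>2 \<partial>M\<Omega>) \<le> (\<integral>x. K\<^sup>2 * (norm (D X x))\<^sup>2 \<partial>M\<Omega>)"
      by (intro integral_mono integrable_mult_right L2_integrable_norm2 L2 DX)
    also have "\<dots> \<le> K\<^sup>2 * (C * HN X)"
      using C(2)[OF X] by (simp add: mult_left_mono)
    finally show "(\<integral>x. (norm (T (D X x)))\<^sup>2 \<partial>M\<Omega>) \<le> K\<^sup>2 * C * HN X"
      by (simp add: mult.assoc)
  next
    fix X Y a b x assume XY: "X \<in> HS" "Y \<in> HS" "x \<in> \<Omega>"
    show "T (D (scomb a X b Y) x) = a *\<^sub>R T (D X x) + b *\<^sub>R T (D Y x)"
      unfolding bounded_op_scomb[OF D XY] linear_add[OF bounded_linear.linear[OF T]]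
        linear_cmul[OF bounded_linear.linear[OF T]] ..
  qed (use C(1) in simp)
qed

lemma bounded_op_scaleR: "bounded_op D \<Longrightarrow> bounded_op (\<lambda>X x. c *\<^sub>R D X x)"
  by (rule bounded_op_linear[OF _ bounded_linear_scaleR_right])

lemma bounded_op_vector: "bounded_op D \<Longrightarrow> bounded_op (\<lambda>X x. D X x *\<^sub>R v)"
  by (rule bounded_op_linear[OF _ bounded_linear_scaleR_left])

lemma bounded_op_zero: "bounded_op (\<lambda>X x. 0)"
  by (rule bounded_opI[of 0]) (simp_all add: L2_zero)

lemma bounded_op_sum:
  "(\<And>i. i \<in> I \<Longrightarrow> bounded_op (D i)) \<Longrightarrow> bounded_op (\<lambda>X x. \<Sum>i\<in>I. D i X x)"
  by (induction I rule: infinite_finite_induct) (simp_all add: bounded_op_zero bounded_op_add)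

lemma bounded_op_diff:
  assumes "bounded_op D" "bounded_op E"
  shows "bounded_op (\<lambda>X x. D X x - E X x)"
  using bounded_op_add[OF assms(1) bounded_op_scaleR[OF assms(2), of "- 1"]] by simp

lemma bounded_op_mat_act:
  "(\<And>n. n \<le> N \<Longrightarrow> bounded_op (D n)) \<Longrightarrow> bounded_op (\<lambda>X x. mat_act N A (\<lambda>n. D n X x) m)"
  unfolding mat_act_def by (intro bounded_op_sum bounded_op_scaleR) simp

lemma bounded_op_pressure_pderiv:
  assumes n: "n \<le> N" and bs: "bs \<in> lists Basis" "length bs \<le> 2"
  shows "bounded_op (\<lambda>X. iter_pderiv bs (snd X n))"
proof (rule bounded_opI[of 1])
  fix X assume X: "X \<in> HS"
  note u = H_spaceD(2)[OF X n]
  show "L2 M\<Omega> (iter_pderiv bs (snd X n))" by (rule iter_pderiv_L2(1)[OF u bs])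
  show "(\<integral>x. (norm (iter_pderiv bs (snd X n) x))\<^sup>2 \<partial>M\<Omega>) \<le> 1 * HN X"
    using order.trans[OF iter_pderiv_L2(2)[OF u bs] component_norm2_le(1)[OF X n]] by simp
next
  fix X Y a b x assume "X \<in> HS" "Y \<in> HS" "x \<in> \<Omega>"
  then show "iter_pderiv bs (snd (scomb a X b Y) n) x =
      a *\<^sub>R iter_pderiv bs (snd X n) x + b *\<^sub>R iter_pderiv bs (snd Y n) x"
    using Hs_pderiv_fcomb[OF H_spaceD(2)[OF _ n] H_spaceD(2)[OF _ n] bs] by simp
qed simp

lemma bounded_op_velocity_pderiv:
  assumes n: "n \<le> N" and i: "i \<in> Basis" and bs: "bs \<in> lists Basis" "length bs \<le> 2"
  shows "bounded_op (\<lambda>X. iter_pderiv bs (component i (fst X n)))"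
proof (rule bounded_opI[of 1])
  fix X assume X: "X \<in> HS"
  note u = H_spaceD(1)[OF X n i]
  show "L2 M\<Omega> (iter_pderiv bs (component i (fst X n)))" by (rule iter_pderiv_L2(1)[OF u bs])
  show "(\<integral>x. (norm (iter_pderiv bs (component i (fst X n)) x))\<^sup>2 \<partial>M\<Omega>) \<le> 1 * HN X"
    using order.trans[OF iter_pderiv_L2(2)[OF u bs] component_norm2_le(2)[OF X n i]] by simp
next
  fix X Y a b x assume "X \<in> HS" "Y \<in> HS" "x \<in> \<Omega>"
  then show "iter_pderiv bs (component i (fst (scomb a X b Y) n)) x =
      a *\<^sub>R iter_pderiv bs (component i (fst X n)) x + b *\<^sub>R iter_pderiv bs (component i (fst Y n)) x"
    using Hs_pderiv_fcomb[OF H_spaceD(1)[OF _ n i] H_spaceD(1)[OF _ n i] bs]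
    by (simp add: component_fcomb)
qed simp

lemma bounded_op_pressure: "n \<le> N \<Longrightarrow> bounded_op (\<lambda>X. snd X n)"
  using bounded_op_pressure_pderiv[of n "[]"] by simp

lemma bounded_op_pressure_grad:
  assumes n: "n \<le> N"
  shows "bounded_op (\<lambda>X. grad (snd X n))"
proof -
  have "bounded_op (\<lambda>X. pderiv_dir i (snd X n))" if "i \<in> Basis" for i
    using bounded_op_pressure_pderiv[OF n, of "[i]"] that by simp
  then show ?thesis
    unfolding grad_def[abs_def] by (intro bounded_op_sum bounded_op_vector)
qed

lemma bounded_op_pressure_laplacian: "n \<le> N \<Longrightarrow> bounded_op (\<lambda>X. laplacian (snd X n))"
  unfolding laplacian_def[abs_def]
  by (intro bounded_op_sum bounded_op_pressure_pderiv) simp_all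

lemma bounded_op_velocity:
  assumes n: "n \<le> N"
  shows "bounded_op (\<lambda>X. fst X n)"
proof -
  have "bounded_op (\<lambda>X. component i (fst X n))" if "i \<in> Basis" for i
    using bounded_op_velocity_pderiv[OF n that, of "[]"] by simp
  then have "bounded_op (\<lambda>X x. \<Sum>i\<in>Basis. component i (fst X n) x *\<^sub>R i)"
    by (intro bounded_op_sum bounded_op_vector)
  then show ?thesis by (simp add: component_def euclidean_representation)
qed

lemma bounded_op_velocity_grad:
  assumes n: "n \<le> N" and i: "i \<in> Basis"
  shows "bounded_op (\<lambda>X. grad (component i (fst X n)))"
proof -
  have "bounded_op (\<lambda>X. pderiv_dir j (component i (fst X n)))" if "j \<in> Basis" for j
    using bounded_op_velocity_pderiv[OF n i, of "[j]"] that by simp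
  then show ?thesis
    unfolding grad_def[abs_def] by (intro bounded_op_sum bounded_op_vector)
qed

lemma bounded_op_velocity_laplacian: "n \<le> N \<Longrightarrow> bounded_op (\<lambda>X. vec_laplacian (fst X n))"
  unfolding vec_laplacian_def[abs_def] laplacian_def
  by (intro bounded_op_sum bounded_op_vector bounded_op_velocity_pderiv) simp_all

section \<open>The nonlinear terms are square integrable\<close>

text \<open>
  Derivatives of order at most two are bounded on \<open>\<Omega>\<close>, by the embedding. With it
  the quadratic terms of the system are square integrable.
\<close>
lemma Hs_bounded_product:
  assumes u: "u \<in> Hs \<Omega> s" and bs: "bs \<in> lists Basis" "length bs \<le> 2" and f: "L2 M\<Omega> f"
  shows "L2 M\<Omega> (\<lambda>x. iter_pderiv bs u x * f x)"
proof -
  obtain C where C: "0 \<le> C" "\<And>u bs x. u \<in> Hs \<Omega> s \<Longrightarrow> bs \<in> lists Basis \<Longrightarrow> length bs \<le> 2 \<Longrightarrow> x \<in> \<Omega> \<Longrightarrow>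
      \<bar>iter_pderiv bs u x\<bar> \<le> C * sqrt (N2 u)" using C2_bound by blast
  show ?thesis
  proof (rule L2_bounded_mult[OF f L2_measurable[OF iter_pderiv_L2(1)[OF u bs]]])
    fix x assume "x \<in> space M\<Omega>"
    then have "x \<in> \<Omega>" by (simp add: space_restrict_space)
    then show "\<bar>iter_pderiv bs u x\<bar> \<le> C * sqrt (N2 u)" by (rule C(2)[OF u bs])
  qed
qed

lemma advect_L2:
  assumes X: "X \<in> HS" and n: "n \<le> N" and k: "k \<le> N"
  shows "L2 M\<Omega> (advect (fst X n) (fst X k))"
  unfolding advect_def[abs_def]
proof (intro L2_sum L2_scaleR_vector)
  fix i j :: 'a assume ij: "i \<in> Basis" "j \<in> Basis"
  show "L2 M\<Omega> (\<lambda>x. component j (fst X n) x * pderiv_dir j (component i (fst X k)) x)"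
  proof -
    have "L2 M\<Omega> (iter_pderiv [j] (component i (fst X k)))"
      by (rule iter_pderiv_L2(1)[OF H_spaceD(1)[OF X k ij(1)]]) (simp_all add: ij)
    from Hs_bounded_product[OF H_spaceD(1)[OF X n ij(2)] _ _ this, of "[]"] show ?thesis by simp
  qed
qed

lemma grad_dot_grad_transpose_L2:
  assumes X: "X \<in> HS" and n: "n \<le> N" and k: "k \<le> N"
  shows "L2 M\<Omega> (grad_dot_grad_transpose (fst X n) (fst X k))"
  unfolding grad_dot_grad_transpose_def[abs_def]
proof (intro L2_sum)
  fix i j :: 'a assume ij: "i \<in> Basis" "j \<in> Basis"
  show "L2 M\<Omega> (\<lambda>x. pderiv_dir j (component i (fst X n)) x * pderiv_dir i (component j (fst X k)) x)"
  proof -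
    have "L2 M\<Omega> (iter_pderiv [i] (component j (fst X k)))"
      by (rule iter_pderiv_L2(1)[OF H_spaceD(1)[OF X k ij(2)]]) (simp_all add: ij)
    from Hs_bounded_product[OF H_spaceD(1)[OF X n ij(1)] _ _ this, of "[j]"] show ?thesis
      by (simp add: ij)
  qed
qed

lemma F_term_L2: "X \<in> HS \<Longrightarrow> L2 M\<Omega> (F_term T N (fst X) m)"
  unfolding F_term_def[abs_def]
  by (rule L2_add; rule L2_sum; rule L2_sum; rule L2_scaleR; rule advect_L2; simp)

lemma G_term_L2: "X \<in> HS \<Longrightarrow> L2 M\<Omega> (G_term T N (fst X) m)"
  unfolding G_term_def[abs_def]
  by (rule L2_diff, rule L2_uminus; rule L2_sum; rule L2_sum; rule L2_mult; rule grad_dot_grad_transpose_L2; simp)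

section \<open>Minimisation over the admissible set\<close>

text \<open>
  Linear combinations of pairs \<open>(X, \<tau>)\<close>. An affine functional of \<open>X\<close>
  is the restriction to \<open>\<tau> = 1\<close> of a linear functional of the pair, and
  differences of states have \<open>\<tau> = 0\<close>.
\<close>
definition hcomb :: "real \<Rightarrow> 'a state \<times> real \<Rightarrow> real \<Rightarrow> 'a state \<times> real \<Rightarrow> 'a state \<times> real" where
  "hcomb a p b q = (scomb a (fst p) b (fst q), a * snd p + b * snd q)"

lemma hcomb_closed: "p \<in> HS \<times> UNIV \<Longrightarrow> q \<in> HS \<times> UNIV \<Longrightarrow> hcomb a p b q \<in> HS \<times> UNIV"
  by (auto simp: hcomb_def H_space_scomb)

text \<open>
  On pairs with \<open>\<tau> = 0\<close> the form is equivalent to the squared \<open>H\<close>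
  norm. The lower bound gives uniform convexity. The upper bound and the triangle inequality for
  \<open>sqrt J\<close> give continuity of the functional along the Cauchy sequences for which
  \<open>uniformly_convex_minimizer\<close> asks it.
\<close>
lemma admissible_minimizer:
  assumes J: "quad_form hcomb (HS \<times> UNIV) J" and \<epsilon>: "0 < \<epsilon>"
    and lower: "\<And>X. X \<in> HS \<Longrightarrow> \<epsilon> * HN X \<le> J (X, 0)"
    and upper: "\<And>X. X \<in> HS \<Longrightarrow> J (X, 0) \<le> C * HN X"
    and A: "A = admissible \<Omega> \<nu> s N m T g h\<^sub>1 h\<^sub>2" and ne: "A \<noteq> {}"
  shows "\<exists>!w. is_arg_min (\<lambda>X. J (X, 1)) (\<lambda>b. b \<in> A) w"
proof (rule uniformly_convex_minimizer[OF ne, where c = "\<epsilon> / 4" and D = "\<lambda>X Y. HN (X - Y)"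
      and m = "\<lambda>X Y. scomb (1/2) X (1/2) Y"])
  have AH: "X \<in> HS" if "X \<in> A" for X by (rule admissibleD(1)[OF that[unfolded A]])
  show "0 \<le> J (X, 1)" if "X \<in> A" for X
    by (rule quad_form_nonneg[OF J]) (simp add: AH[OF that])
  show "0 < \<epsilon> / 4" using \<epsilon> by simp
  show "X = Y" if "X \<in> A" "Y \<in> A" "HN (X - Y) \<le> 0" for X Y
    by (rule H_eq_of_norm2[OF AH[OF that(1)] AH[OF that(2)] that(3)])
  show "scomb (1/2) X (1/2) Y \<in> A \<and>
      J (scomb (1/2) X (1/2) Y, 1) \<le> (J (X, 1) + J (Y, 1)) / 2 - \<epsilon> / 4 * HN (X - Y)"
    if X: "X \<in> A" and Y: "Y \<in> A" for X Y
  proof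
    show "scomb (1/2) X (1/2) Y \<in> A" using X Y unfolding A by (rule admissible_midpoint)
    have "(X, 1) \<in> HS \<times> UNIV" "(Y, 1) \<in> HS \<times> UNIV" using AH X Y by auto
    from quad_form_parallelogram[OF J this]
    have "J (scomb (1/2) X (1/2) Y, 1) = (J (X, 1) + J (Y, 1)) / 2 - J (X - Y, 0) / 4"
      by (simp add: hcomb_def state_diff)
    moreover have "\<epsilon> * HN (X - Y) \<le> J (X - Y, 0)"
      by (rule lower[OF H_space_diff[OF AH[OF X] AH[OF Y]]])
    ultimately show "J (scomb (1/2) X (1/2) Y, 1) \<le> (J (X, 1) + J (Y, 1)) / 2 - \<epsilon> / 4 * HN (X - Y)"
      by simp
  qed
  fix X :: "nat \<Rightarrow> 'a state"
  assume X: "\<And>n. X n \<in> A" and Cauchy: "\<And>e. 0 < e \<Longrightarrow> \<exists>K. \<forall>i\<ge>K. \<forall>j\<ge>K. HN (X i - X j) < e"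
  obtain a where a: "a \<in> HS" "(\<lambda>k. HN (X k - a)) \<longlonglongrightarrow> 0"
    using H_complete[OF AH[OF X] Cauchy] by blast
  have aA: "a \<in> A" unfolding A by (rule admissible_closed[OF X[unfolded A] a])
  have D: "X k - a \<in> HS" for k by (rule H_space_diff[OF AH[OF X] a(1)])
  have J_diff: "\<bar>sqrt (J (X k, 1)) - sqrt (J (a, 1))\<bar> \<le> sqrt (C * HN (X k - a))" for k
  proof -
    \<comment> \<open>The pairs of \<open>X k\<close> and of \<open>a\<close> differ by \<open>(X k - a, 0)\<close>, so each is bounded through the other.\<close>
    have mem: "(X k - a, 0) \<in> HS \<times> UNIV" "(a, 1) \<in> HS \<times> UNIV" "(X k, 1) \<in> HS \<times> UNIV"
      using D a(1) AH[OF X] by auto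
    have "hcomb 1 (X k - a, 0) 1 (a, 1) = (X k, 1)" "hcomb (- 1) (X k - a, 0) 1 (X k, 1) = (a, 1)"
      by (simp_all add: hcomb_def scomb_def fcomb_def prod_eq_iff fun_eq_iff)
    then have "sqrt (J (X k, 1)) \<le> sqrt (J (X k - a, 0)) + sqrt (J (a, 1))"
      "sqrt (J (a, 1)) \<le> sqrt (J (X k - a, 0)) + sqrt (J (X k, 1))"
      using quad_form_triangle[OF J mem(1,2), of 1 1] quad_form_triangle[OF J mem(1,3), of "- 1" 1] by simp_all
    moreover have "sqrt (J (X k - a, 0)) \<le> sqrt (C * HN (X k - a))"
      by (rule real_sqrt_le_mono[OF upper[OF D]])
    ultimately show ?thesis by linarith
  qed
  have "(\<lambda>k. sqrt (J (X k, 1))) \<longlonglongrightarrow> sqrt (J (a, 1))"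
  proof (rule LIM_zero_cancel, rule Lim_null_comparison)
    show "\<forall>\<^sub>F k in sequentially. norm (sqrt (J (X k, 1)) - sqrt (J (a, 1))) \<le> sqrt (C * HN (X k - a))"
      using J_diff by simp
    have "(\<lambda>k. sqrt (C * HN (X k - a))) \<longlonglongrightarrow> sqrt (C * 0)"
      by (intro tendsto_real_sqrt tendsto_mult tendsto_const a(2))
    then show "(\<lambda>k. sqrt (C * HN (X k - a))) \<longlonglongrightarrow> 0" by simp
  qed
  then have "(\<lambda>k. (sqrt (J (X k, 1)))\<^sup>2) \<longlonglongrightarrow> (sqrt (J (a, 1)))\<^sup>2"
    by (rule tendsto_power)
  moreover have "(sqrt (J (Y, 1)))\<^sup>2 = J (Y, 1)" if "Y \<in> HS" for Y
    using quad_form_nonneg[OF J, of "(Y, 1)"] that by simp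
  ultimately have "(\<lambda>k. J (X k, 1)) \<longlonglongrightarrow> J (a, 1)"
    using AH[OF X] a(1) by simp
  then show "\<exists>a\<in>A. (\<lambda>k. J (X k, 1)) \<longlonglongrightarrow> J (a, 1)" using aA by blast
qed

end

section \<open>Weighted quadratic functionals\<close>

locale weighted_state_space = state_space \<Omega> s N for \<Omega> :: "'a::euclidean_space set" and s N +
  fixes w :: "'a \<Rightarrow> real" and B :: real
  assumes w_measurable: "w \<in> borel_measurable M\<Omega>"
    and w_bounds: "\<And>x. x \<in> \<Omega> \<Longrightarrow> 0 \<le> w x \<and> w x \<le> B" and B_nonneg: "0 \<le> B"
begin

lemma weighted_integrable:
  assumes f: "L2 M\<Omega> f"
  shows "integrable M\<Omega> (\<lambda>x. w x * (norm (f x))\<^sup>2)"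
proof (rule Bochner_Integration.integrable_bound[where f = "\<lambda>x. B * (norm (f x))\<^sup>2"])
  show "integrable M\<Omega> (\<lambda>x. B * (norm (f x))\<^sup>2)"
    by (intro integrable_mult_right L2_integrable_norm2 f)
  show "(\<lambda>x. w x * (norm (f x))\<^sup>2) \<in> borel_measurable M\<Omega>"
    by (intro borel_measurable_times w_measurable borel_measurable_integrable L2_integrable_norm2 f)
  have "\<bar>w x * (norm (f x))\<^sup>2\<bar> \<le> \<bar>B * (norm (f x))\<^sup>2\<bar>" if "x \<in> \<Omega>" for x
    using w_bounds[OF that] B_nonneg by (simp add: abs_mult mult_right_mono)
  then show "AE x in M\<Omega>. norm (w x * (norm (f x))\<^sup>2) \<le> norm (B * (norm (f x))\<^sup>2)"
    by (intro AE_I2) (simp add: space_restrict_space)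
qed

lemma weighted_integral_le:
  assumes f: "L2 M\<Omega> f"
  shows "(\<integral>x. w x * (norm (f x))\<^sup>2 \<partial>M\<Omega>) \<le> B * (\<integral>x. (norm (f x))\<^sup>2 \<partial>M\<Omega>)"
proof -
  have "(\<integral>x. w x * (norm (f x))\<^sup>2 \<partial>M\<Omega>) \<le> (\<integral>x. B * (norm (f x))\<^sup>2 \<partial>M\<Omega>)"
    by (intro integral_mono weighted_integrable f integrable_mult_right L2_integrable_norm2 mult_right_mono)
       (use w_bounds in \<open>simp_all add: space_restrict_space\<close>)
  then show ?thesis by simp
qed

lemma quad_form_weighted:
  fixes D :: "'v \<Rightarrow> 'a \<Rightarrow> 'e::euclidean_space"
  assumes closed: "\<And>u v a b. u \<in> S \<Longrightarrow> v \<in> S \<Longrightarrow> cmb a u b v \<in> S"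
    and L2: "\<And>u. u \<in> S \<Longrightarrow> L2 M\<Omega> (D u)"
    and lin: "\<And>u v a b x. u \<in> S \<Longrightarrow> v \<in> S \<Longrightarrow> x \<in> \<Omega> \<Longrightarrow> D (cmb a u b v) x = a *\<^sub>R D u x + b *\<^sub>R D v x"
  shows "quad_form cmb S (\<lambda>u. \<integral>x. w x * (norm (D u x))\<^sup>2 \<partial>M\<Omega>)"
proof (rule quad_form_integral[OF closed])
  fix u assume u: "u \<in> S"
  show "integrable M\<Omega> (\<lambda>x. w x * (norm (D u x))\<^sup>2)" by (rule weighted_integrable[OF L2[OF u]])
  show "AE x in M\<Omega>. 0 \<le> w x * (norm (D u x))\<^sup>2"
    using w_bounds by (intro AE_I2) (simp add: space_restrict_space)
  fix v assume v: "v \<in> S"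
  have "w x * (norm (D (cmb a u b v) x))\<^sup>2 =
      a\<^sup>2 * (w x * (norm (D u x))\<^sup>2) + 2 * a * b * (w x * (D u x \<bullet> D v x)) + b\<^sup>2 * (w x * (norm (D v x))\<^sup>2)"
    if "x \<in> \<Omega>" for a b x
    unfolding lin[OF u v that] norm_square_combination by (simp add: algebra_simps)
  then show "\<exists>\<beta>. \<forall>a b. AE x in M\<Omega>. w x * (norm (D (cmb a u b v) x))\<^sup>2 =
      a\<^sup>2 * (w x * (norm (D u x))\<^sup>2) + 2 * a * b * \<beta> x + b\<^sup>2 * (w x * (norm (D v x))\<^sup>2)"
    by (intro exI[of _ "\<lambda>x. w x * (D u x \<bullet> D v x)"] allI AE_I2) (simp add: space_restrict_space)
qed

text \<open>
  Quadratic forms on states that are continuous for the \<open>H\<close> norm.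
\<close>
definition bounded_form :: "('a state \<Rightarrow> real) \<Rightarrow> bool" where
  "bounded_form q \<longleftrightarrow> quad_form scomb HS q \<and> (\<exists>C\<ge>0. \<forall>X\<in>HS. q X \<le> C * HN X)"

lemma bounded_form_bounds:
  assumes "bounded_form q"
  shows "\<exists>C\<ge>0. \<forall>X\<in>HS. 0 \<le> q X \<and> q X \<le> C * HN X"
proof -
  obtain C where C: "0 \<le> C" "\<And>X. X \<in> HS \<Longrightarrow> q X \<le> C * HN X"
    using assms unfolding bounded_form_def by blast
  have q: "quad_form scomb HS q" using assms unfolding bounded_form_def by blast
  show ?thesis
    by (intro exI[of _ C] conjI ballI C quad_form_nonneg[OF q])
qed

lemma bounded_form_add:
  assumes "bounded_form p" "bounded_form q"
  shows "bounded_form (\<lambda>X. p X + q X)"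
proof -
  obtain C C' where C: "0 \<le> C" "0 \<le> C'" "\<And>X. X \<in> HS \<Longrightarrow> p X \<le> C * HN X" "\<And>X. X \<in> HS \<Longrightarrow> q X \<le> C' * HN X"
    using assms unfolding bounded_form_def by blast
  have "0 \<le> C + C'" using C by simp
  moreover have "\<forall>X\<in>HS. p X + q X \<le> (C + C') * HN X"
    unfolding distrib_right by (intro ballI add_mono C)
  moreover have "quad_form scomb HS (\<lambda>X. p X + q X)"
    by (intro quad_form_add conjunct1[OF assms(1)[unfolded bounded_form_def]]
        conjunct1[OF assms(2)[unfolded bounded_form_def]])
  ultimately show ?thesis
    unfolding bounded_form_def by blast
qed

lemma bounded_form_sum:
  assumes "\<And>i. i \<in> I \<Longrightarrow> bounded_form (q i)"
  shows "bounded_form (\<lambda>X. \<Sum>i\<in>I. q i X)"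
proof -
  have "quad_form scomb HS (\<lambda>X. 0)" unfolding quad_form_def using H_space_scomb by simp
  then have "bounded_form (\<lambda>X. 0)"
    unfolding bounded_form_def by (intro conjI exI[of _ 0]) simp_all
  then show ?thesis
    using assms by (induction I rule: infinite_finite_induct) (simp_all add: bounded_form_add)
qed

lemma bounded_form_weighted:
  assumes D: "bounded_op D"
  shows "bounded_form (\<lambda>X. \<integral>x. w x * (norm (D X x))\<^sup>2 \<partial>M\<Omega>)"
  unfolding bounded_form_def
proof
  show "quad_form scomb HS (\<lambda>X. \<integral>x. w x * (norm (D X x))\<^sup>2 \<partial>M\<Omega>)"
    by (rule quad_form_weighted[OF H_space_scomb bounded_op_L2[OF D] bounded_op_scomb[OF D]])
  obtain C where C: "0 \<le> C" "\<And>X. X \<in> HS \<Longrightarrow> (\<integral>x. (norm (D X x))\<^sup>2 \<partial>M\<Omega>) \<le> C * HN X"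
    using bounded_op_bound[OF D] by blast
  have "(\<integral>x. w x * (norm (D X x))\<^sup>2 \<partial>M\<Omega>) \<le> B * C * HN X" if X: "X \<in> HS" for X
  proof -
    have "B * (\<integral>x. (norm (D X x))\<^sup>2 \<partial>M\<Omega>) \<le> B * (C * HN X)"
      by (rule mult_left_mono[OF C(2)[OF X] B_nonneg])
    then show ?thesis using weighted_integral_le[OF bounded_op_L2[OF D X]] by simp
  qed
  then show "\<exists>C\<ge>0. \<forall>X\<in>HS. (\<integral>x. w x * (norm (D X x))\<^sup>2 \<partial>M\<Omega>) \<le> C * HN X"
    using C(1) B_nonneg by (intro exI[of _ "B * C"]) simp
qed

lemma weighted_integral_sum:
  assumes "\<And>i. i \<in> I \<Longrightarrow> L2 M\<Omega> (f i)"
  shows "(\<integral>x. w x * (\<Sum>i\<in>I. (norm (f i x))\<^sup>2) \<partial>M\<Omega>) = (\<Sum>i\<in>I. \<integral>x. w x * (norm (f i x))\<^sup>2 \<partial>M\<Omega>)"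
  unfolding sum_distrib_left
  by (rule Bochner_Integration.integral_sum) (rule weighted_integrable[OF assms])

text \<open>
  The residuals \<open>D m X - f m\<close> are affine in \<open>X\<close>. Replacing them by
  \<open>D m X - \<tau> f m\<close> makes the functional a quadratic form in \<open>(X,
  \<tau>)\<close>; at \<open>\<tau> = 0\<close> the data disappear and a bounded form plus
  \<open>\<epsilon>\<close> times the squared \<open>H\<close> norm remains.
\<close>
lemma least_squares_minimizer:
  fixes D :: "nat \<Rightarrow> 'a state \<Rightarrow> 'a \<Rightarrow> 'a" and E :: "nat \<Rightarrow> 'a state \<Rightarrow> 'a \<Rightarrow> real"
  assumes D: "\<And>m. m \<le> N \<Longrightarrow> bounded_op (D m)" and E: "\<And>m. m \<le> N \<Longrightarrow> bounded_op (E m)"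
    and f: "\<And>m. m \<le> N \<Longrightarrow> L2 M\<Omega> (f m)" and h: "\<And>m. m \<le> N \<Longrightarrow> L2 M\<Omega> (h m)"
    and \<epsilon>: "0 < \<epsilon>" and A: "A = admissible \<Omega> \<nu> s N M T g h\<^sub>1 h\<^sub>2" and ne: "A \<noteq> {}"
    and J: "\<And>X. X \<in> A \<Longrightarrow> J X = (\<integral>x. w x * (\<Sum>m\<le>N. (norm (D m X x - f m x))\<^sup>2) \<partial>M\<Omega>) +
      (\<integral>x. w x * (\<Sum>m\<le>N. (norm (E m X x - h m x))\<^sup>2) \<partial>M\<Omega>) + \<epsilon> * HN X"
  shows "\<exists>!X. is_arg_min J (\<lambda>b. b \<in> A) X"
proof -
  define Jh where "Jh p = (\<Sum>m\<le>N. \<integral>x. w x * (norm (D m (fst p) x - snd p *\<^sub>R f m x))\<^sup>2 \<partial>M\<Omega>) +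
      (\<Sum>m\<le>N. \<integral>x. w x * (norm (E m (fst p) x - snd p *\<^sub>R h m x))\<^sup>2 \<partial>M\<Omega>) + \<epsilon> * HN (fst p)"
    for p :: "'a state \<times> real"
  have form: "quad_form hcomb (HS \<times> UNIV) (\<lambda>p. \<integral>x. w x * (norm (K (fst p) x - snd p *\<^sub>R k x))\<^sup>2 \<partial>M\<Omega>)"
    if K: "bounded_op K" and k: "L2 M\<Omega> k" for K :: "'a state \<Rightarrow> 'a \<Rightarrow> 'e::euclidean_space" and k
  proof (rule quad_form_weighted[OF hcomb_closed])
    show "L2 M\<Omega> (\<lambda>x. K (fst p) x - snd p *\<^sub>R k x)" if "p \<in> HS \<times> UNIV" for p
      using that by (intro L2_diff L2_scaleR k bounded_op_L2[OF K]) auto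
    show "K (fst (hcomb a p b q)) x - snd (hcomb a p b q) *\<^sub>R k x =
        a *\<^sub>R (K (fst p) x - snd p *\<^sub>R k x) + b *\<^sub>R (K (fst q) x - snd q *\<^sub>R k x)"
      if "p \<in> HS \<times> UNIV" "q \<in> HS \<times> UNIV" "x \<in> \<Omega>" for p q a b x
    proof -
      have "fst p \<in> HS" "fst q \<in> HS" using that by auto
      then show ?thesis
        by (simp add: hcomb_def bounded_op_scomb[OF K _ _ that(3)] algebra_simps)
    qed
  qed
  have HNform: "quad_form hcomb (HS \<times> UNIV) (\<lambda>p. HN (fst p))"
    by (rule quad_form_pullback[OF quad_form_H hcomb_closed]) (auto simp: hcomb_def)
  have "quad_form hcomb (HS \<times> UNIV) Jh"
    unfolding Jh_def
    by (intro quad_form_add quad_form_sum quad_form_scale hcomb_closed form D E f h HNform)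
       (use \<epsilon> in simp_all)
  moreover
  define q where "q X = (\<Sum>m\<le>N. \<integral>x. w x * (norm (D m X x))\<^sup>2 \<partial>M\<Omega>) +
      (\<Sum>m\<le>N. \<integral>x. w x * (norm (E m X x))\<^sup>2 \<partial>M\<Omega>)" for X
  have "bounded_form q"
    unfolding q_def[abs_def]
    by (intro bounded_form_add bounded_form_sum bounded_form_weighted D E) simp_all
  from bounded_form_bounds[OF this]
  obtain C where C: "\<And>X. X \<in> HS \<Longrightarrow> 0 \<le> q X" "\<And>X. X \<in> HS \<Longrightarrow> q X \<le> C * HN X"
    by blast
  have Jh0: "Jh (X, 0) = q X + \<epsilon> * HN X" for X by (simp add: Jh_def q_def)
  have "\<epsilon> * HN X \<le> Jh (X, 0)" "Jh (X, 0) \<le> (C + \<epsilon>) * HN X" if "X \<in> HS" for X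
    using C[OF that] unfolding Jh0 distrib_right by linarith+
  ultimately have ex: "\<exists>!X. is_arg_min (\<lambda>X. Jh (X, 1)) (\<lambda>b. b \<in> A) X"
    by (intro admissible_minimizer[OF _ \<epsilon> _ _ A ne])
  have "Jh (X, 1) = J X" if X: "X \<in> A" for X
  proof -
    have XH: "X \<in> HS" by (rule admissibleD(1)[OF X[unfolded A]])
    have "L2 M\<Omega> (\<lambda>x. D m X x - f m x)" if "m \<in> {..N}" for m
      by (intro L2_diff bounded_op_L2[OF _ XH] D f) (use that in simp_all)
    moreover have "L2 M\<Omega> (\<lambda>x. E m X x - h m x)" if "m \<in> {..N}" for m
      by (intro L2_diff bounded_op_L2[OF _ XH] E h) (use that in simp_all)
    ultimately show ?thesis
      unfolding J[OF X] Jh_def fst_conv snd_conv scaleR_one by (simp only: weighted_integral_sum)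
  qed
  then have "is_arg_min (\<lambda>X. Jh (X, 1)) (\<lambda>b. b \<in> A) = is_arg_min J (\<lambda>b. b \<in> A)"
    by (rule is_arg_min_cong)
  then show ?thesis using ex by simp
qed

end

section \<open>The fixed-point iteration\<close>

context weighted_state_space
begin

lemma bounded_form_H:
  assumes "0 \<le> c"
  shows "bounded_form (\<lambda>X. c * HN X)"
  unfolding bounded_form_def
  by (intro conjI quad_form_scale quad_form_H exI[of _ c] ballI assms order_refl)

lemma bounded_form_cong:
  assumes q: "bounded_form q" and eq: "\<And>X. X \<in> HS \<Longrightarrow> p X = q X"
  shows "bounded_form p"
  using q H_space_scomb unfolding bounded_form_def quad_form_def by (simp add: eq)

text \<open>
  Pointwise densities of bounded forms. Keeping integrability along with the form lets the integral
  of the long sum in the weighted norm be split by rules.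
\<close>
definition bounded_density :: "('a state \<Rightarrow> 'a \<Rightarrow> real) \<Rightarrow> bool" where
  "bounded_density p \<longleftrightarrow>
     (\<forall>X\<in>HS. integrable M\<Omega> (p X)) \<and> bounded_form (\<lambda>X. \<integral>x. p X x \<partial>M\<Omega>)"

lemma bounded_density_weighted: "bounded_op D \<Longrightarrow> bounded_density (\<lambda>X x. w x * (norm (D X x))\<^sup>2)"
  unfolding bounded_density_def
  by (intro conjI ballI weighted_integrable bounded_op_L2 bounded_form_weighted)

lemma bounded_density_add:
  assumes p: "bounded_density p" and q: "bounded_density q"
  shows "bounded_density (\<lambda>X x. p X x + q X x)"
proof -
  have int: "integrable M\<Omega> (p X)" "integrable M\<Omega> (q X)" if "X \<in> HS" for X
    using p q that unfolding bounded_density_def by blast+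
  have "bounded_form (\<lambda>X. (\<integral>x. p X x \<partial>M\<Omega>) + (\<integral>x. q X x \<partial>M\<Omega>))"
    using p q unfolding bounded_density_def by (intro bounded_form_add) blast+
  then have "bounded_form (\<lambda>X. \<integral>x. p X x + q X x \<partial>M\<Omega>)"
    by (rule bounded_form_cong) (rule Bochner_Integration.integral_add[OF int])
  then show ?thesis
    unfolding bounded_density_def using int by (intro conjI ballI Bochner_Integration.integrable_add)
qed

lemma bounded_density_sum:
  "(\<And>i. i \<in> I \<Longrightarrow> bounded_density (p i)) \<Longrightarrow> bounded_density (\<lambda>X x. \<Sum>i\<in>I. p i X x)"
proof (induction I rule: infinite_finite_induct)
  case (insert i I)
  then show ?case by (simp add: bounded_density_add)
qed (use bounded_density_weighted[OF bounded_op_zero] in simp_all)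

lemma bounded_form_first_order:
  "bounded_form (\<lambda>X. \<integral>x. w x * (\<Sum>n\<le>N. (norm (fst X n x))\<^sup>2 +
     (\<Sum>i\<in>Basis. (norm (grad (component i (fst X n)) x))\<^sup>2) +
     (snd X n x)\<^sup>2 + (norm (grad (snd X n) x))\<^sup>2) \<partial>M\<Omega>)"
proof -
  have "bounded_density (\<lambda>X x. \<Sum>n\<le>N. w x * (norm (fst X n x))\<^sup>2 +
     (\<Sum>i\<in>Basis. w x * (norm (grad (component i (fst X n)) x))\<^sup>2) +
     w x * (norm (snd X n x))\<^sup>2 + w x * (norm (grad (snd X n) x))\<^sup>2)"
    by (intro bounded_density_sum bounded_density_add bounded_density_weighted bounded_op_velocity
        bounded_op_velocity_grad bounded_op_pressure bounded_op_pressure_grad) simp_all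
  then show ?thesis
    by (simp add: bounded_density_def sum_distrib_left distrib_left)
qed

text \<open>
  The bounds \<open>c HN \<le> p \<le> C HN\<close> make the norm \<open>sqrt p\<close> equivalent
  to the \<open>H\<close> norm. The admissible set, which is closed in the complete space
  \<open>H\<close>, is therefore complete for it.
\<close>
lemma contraction_fixed_point_admissible:
  assumes p: "bounded_form p" and c: "0 < c" and lower: "\<And>X. X \<in> HS \<Longrightarrow> c * HN X \<le> p X"
    and nrm: "\<And>X. nrm X = sqrt (p X)"
    and A: "A = admissible \<Omega> \<nu> s N m T g h\<^sub>1 h\<^sub>2" and ne: "A \<noteq> {}"
    and f: "\<And>a. a \<in> A \<Longrightarrow> f a \<in> A" and contr: "contraction_wrt nrm A f"
  shows "\<exists>a\<in>A. f a = a \<and> (\<forall>b\<in>A. f b = b \<longrightarrow> b = a) \<and>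
    (\<forall>X. X 0 \<in> A \<and> (\<forall>n. X (Suc n) = f (X n)) \<longrightarrow> (\<lambda>n. nrm (X n - a)) \<longlonglongrightarrow> 0)"
proof -
  have form: "quad_form scomb HS p" using p unfolding bounded_form_def by blast
  obtain C where C_bounds: "\<forall>X\<in>HS. 0 \<le> p X \<and> p X \<le> C * HN X"
    using bounded_form_bounds[OF p] by blast
  have C: "0 \<le> p X" "p X \<le> C * HN X" if "X \<in> HS" for X
    using bspec[OF C_bounds that] by simp_all
  obtain \<theta> where \<theta>_mem: "\<theta> \<in> {0<..<1}" and contr': "\<forall>a\<in>A. \<forall>b\<in>A. nrm (f a - f b) \<le> \<theta> * nrm (a - b)"
    using contr unfolding contraction_wrt_def by blast
  have \<theta>: "0 < \<theta>" "\<theta> < 1" using \<theta>_mem by simp_all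
  have contr: "nrm (f a - f b) \<le> \<theta> * nrm (a - b)" if "a \<in> A" "b \<in> A" for a b
    using contr' that by blast
  have AH: "X \<in> HS" if "X \<in> A" for X by (rule admissibleD(1)[OF that[unfolded A]])
  have D: "X - Y \<in> HS" if "X \<in> A" "Y \<in> A" for X Y by (rule H_space_diff[OF AH[OF that(1)] AH[OF that(2)]])
  show ?thesis
  proof (rule contraction_fixed_point[where d = "\<lambda>a b. nrm (a - b)", OF ne f _ _ _ _ _ \<theta> contr])
    show "0 \<le> nrm (a - b)" if "a \<in> A" "b \<in> A" for a b
      unfolding nrm by (rule real_sqrt_ge_zero[OF C(1)[OF D[OF that]]])
    show "nrm (a - b) = nrm (b - a)" if ab: "a \<in> A" "b \<in> A" for a b
    proof -
      obtain K where K: "\<And>t r. p (scomb t a r b) = t\<^sup>2 * p a + 2 * t * r * K + r\<^sup>2 * p b"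
        using quad_formE[OF form AH[OF ab(1)] AH[OF ab(2)]] by blast
      have "b - a = scomb (- 1) a 1 b"
        by (simp add: scomb_def fcomb_def prod_eq_iff fun_eq_iff)
      then show ?thesis unfolding nrm by (simp add: state_diff[of a b] K)
    qed
    show "nrm (a - b) = 0 \<longleftrightarrow> a = b" if ab: "a \<in> A" "b \<in> A" for a b
    proof
      assume "nrm (a - b) = 0"
      then have "c * HN (a - b) \<le> 0" using lower[OF D[OF ab]] unfolding nrm by simp
      then have "HN (a - b) \<le> 0" using c by (simp add: mult_le_0_iff)
      then show "a = b" by (rule H_eq_of_norm2[OF AH[OF ab(1)] AH[OF ab(2)]])
    next
      assume "a = b"
      obtain K where K: "\<And>t r. p (scomb t a r a) = t\<^sup>2 * p a + 2 * t * r * K + r\<^sup>2 * p a"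
        using quad_formE[OF form AH[OF ab(1)] AH[OF ab(1)]] by blast
      \<comment> \<open>The zero state, as a combination of admissible states, to which the quadratic form applies.\<close>
      have "a - b = scomb 0 a 0 a"
        using \<open>a = b\<close> by (simp add: scomb_def fcomb_def prod_eq_iff fun_eq_iff)
      then show "nrm (a - b) = 0" unfolding nrm by (simp add: K)
    qed
    show "nrm (a - e) \<le> nrm (a - b) + nrm (b - e)" if "a \<in> A" "b \<in> A" "e \<in> A" for a b e
    proof -
      have "a - e = scomb 1 (a - b) 1 (b - e)"
        by (simp add: scomb_def fcomb_def prod_eq_iff fun_eq_iff)
      then show ?thesis
        using quad_form_triangle[OF form D[OF that(1,2)] D[OF that(2,3)], of 1 1] unfolding nrm by simp
    qed
    fix X :: "nat \<Rightarrow> 'a state"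
    assume X: "\<And>n. X n \<in> A" and Cauchy: "\<And>e. 0 < e \<Longrightarrow> \<exists>K. \<forall>i\<ge>K. \<forall>j\<ge>K. nrm (X i - X j) < e"
    have "\<exists>K. \<forall>i\<ge>K. \<forall>j\<ge>K. HN (X i - X j) < e" if e: "0 < e" for e
    proof -
      have "0 < sqrt (c * e)" using c e by simp
      from Cauchy[OF this]
      obtain K where K: "\<And>i j. K \<le> i \<Longrightarrow> K \<le> j \<Longrightarrow> nrm (X i - X j) < sqrt (c * e)"
        by blast
      have "HN (X i - X j) < e" if "K \<le> i" "K \<le> j" for i j
      proof -
        have "p (X i - X j) < c * e" using K[OF that] unfolding nrm by simp
        then have "c * HN (X i - X j) < c * e" using order.strict_trans1[OF lower[OF D[OF X X]]] by blast
        then show ?thesis using c by simp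
      qed
      then show ?thesis by blast
    qed
    then have "\<exists>a\<in>HS. (\<lambda>k. HN (X k - a)) \<longlonglongrightarrow> 0"
      by (rule H_complete[OF AH[OF X]])
    then obtain a where a: "a \<in> HS" "(\<lambda>k. HN (X k - a)) \<longlonglongrightarrow> 0" by blast
    have aA: "a \<in> A" unfolding A by (rule admissible_closed[OF X[unfolded A] a])
    have "(\<lambda>n. nrm (X n - a)) \<longlonglongrightarrow> 0"
    proof (rule tendsto_sandwich[OF _ _ tendsto_const])
      show "\<forall>\<^sub>F n in sequentially. 0 \<le> nrm (X n - a)"
        unfolding nrm using C(1)[OF D[OF X aA]] by simp
      show "\<forall>\<^sub>F n in sequentially. nrm (X n - a) \<le> sqrt (C * HN (X n - a))"
        unfolding nrm using C(2)[OF D[OF X aA]] by simp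
      have "(\<lambda>n. sqrt (C * HN (X n - a))) \<longlonglongrightarrow> sqrt (C * 0)"
        by (intro tendsto_real_sqrt tendsto_mult tendsto_const a(2))
      then show "(\<lambda>n. sqrt (C * HN (X n - a))) \<longlonglongrightarrow> 0" by simp
    qed
    then show "\<exists>a\<in>A. (\<lambda>n. nrm (X n - a)) \<longlonglongrightarrow> 0" using aA by blast
  qed
qed

text \<open>
  For a fixed state \<open>a\<close> the residuals in \<open>J_functional\<close> split into an
  operator of order at most two applied to the unknown state, and a square integrable right-hand
  side built from \<open>a\<close>. The matrix inverses act as constant coefficients.
\<close>
lemma J_functional_minimizer:
  assumes w: "w = carleman_weight x\<^sub>0 \<beta> lam" and \<epsilon>: "0 < \<epsilon>"
    and A: "A = admissible \<Omega> \<nu> s N M T g h\<^sub>1 h\<^sub>2" and a: "a \<in> A"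
  shows "\<exists>!X. is_arg_min (J_functional \<Omega> s N T \<mu> x\<^sub>0 \<beta> lam \<epsilon> a) (\<lambda>b. b \<in> A) X"
proof -
  let ?K = "mat_inverse N (\<lambda>i j. \<mu> * s_coeff T i j)"
  define D where "D m X x = vec_laplacian (fst X m) x -
      mat_act N ?K (\<lambda>l. mat_act N (r_coeff T) (\<lambda>n. fst X n x) l) m" for m and X :: "'a state" and x
  define f where "f m x = mat_act N ?K
      (\<lambda>l. F_term T N (fst a) l x + mat_act N (s_coeff T) (\<lambda>n. grad (snd a n) x) l) m" for m x
  define E where "E m X = laplacian (snd X m)" for m and X :: "'a state"
  define h where "h m x = mat_act N (mat_inverse N (s_coeff T)) (\<lambda>l. G_term T N (fst a) l x) m" for m x
  have aH: "a \<in> HS" by (rule admissibleD(1)[OF a[unfolded A]])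
  show ?thesis
  proof (rule least_squares_minimizer[where D = D and E = E and f = f and h = h and \<epsilon> = \<epsilon>, OF _ _ _ _ \<epsilon> A])
    fix m assume m: "m \<le> N"
    show "bounded_op (D m)"
      unfolding D_def[abs_def]
      by (intro bounded_op_diff bounded_op_velocity_laplacian m bounded_op_mat_act bounded_op_velocity)
    show "bounded_op (E m)"
      unfolding E_def[abs_def] by (rule bounded_op_pressure_laplacian[OF m])
    show "L2 M\<Omega> (f m)"
      unfolding f_def[abs_def]
      by (intro L2_mat_act L2_add F_term_L2 aH bounded_op_L2[OF bounded_op_pressure_grad aH])
    show "L2 M\<Omega> (h m)"
      unfolding h_def[abs_def] by (intro L2_mat_act G_term_L2 aH)
  next
    show "A \<noteq> {}" using a by blast
    fix X :: "'a state"
    have "vec_laplacian (fst X m) x - mat_act N ?K (\<lambda>l. mat_act N (r_coeff T) (\<lambda>n. fst X n x) l +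
        F_term T N (fst a) l x + mat_act N (s_coeff T) (\<lambda>n. grad (snd a n) x) l) m = D m X x - f m x" for m x
      unfolding D_def f_def add.assoc mat_act_add[of N ?K "\<lambda>l. mat_act N (r_coeff T) (\<lambda>n. fst X n x) l"]
      by (simp only: diff_diff_eq)
    then show "J_functional \<Omega> s N T \<mu> x\<^sub>0 \<beta> lam \<epsilon> a X =
        (\<integral>x. w x * (\<Sum>m\<le>N. (norm (D m X x - f m x))\<^sup>2) \<partial>M\<Omega>) +
        (\<integral>x. w x * (\<Sum>m\<le>N. (norm (E m X x - h m x))\<^sup>2) \<partial>M\<Omega>) + \<epsilon> * HN X"
      unfolding J_functional_def case_prod_beta set_integral_eq prod.collapse w E_def h_def
      by (simp only: real_norm_def power2_abs)
  qed
qed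

end

theorem corollary1:
  fixes \<Omega> :: "'a::euclidean_space set" and \<nu> :: "'a \<Rightarrow> 'a" and x\<^sub>0 :: 'a
    and g :: "'a \<Rightarrow> real \<Rightarrow> 'a" and h\<^sub>1 h\<^sub>2 :: "'a \<Rightarrow> real \<Rightarrow> real"
    and T \<mu> s M \<beta>\<^sub>0 \<beta> lam \<epsilon> :: real and lam\<^sub>0 :: "real \<Rightarrow> real" and N :: nat
    and \<A> :: "'a state set" and \<T> :: "'a state \<Rightarrow> 'a state" and nrm :: "'a state \<Rightarrow> real"
  assumes dim: "DIM('a) \<ge> 2"
    and domain: "open \<Omega>" "connected \<Omega>" "\<Omega> \<noteq> {}"
    and normal: "\<forall>x\<in>frontier \<Omega>. outward_unit_normal \<Omega> x (\<nu> x)"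
    and T_pos: "T > 0" and mu_pos: "\<mu> > 0"
    and data: "\<forall>x\<in>frontier \<Omega>. set_integrable lborel {0<..<T} (g x) \<and>
        set_integrable lborel {0<..<T} (h\<^sub>1 x) \<and> set_integrable lborel {0<..<T} (h\<^sub>2 x)"
    and s_large: "s > real DIM('a) / 2 + 2" and embedding: "embeds_into_C2 \<Omega> s"
    and M_pos: "M > 0"
    and A_eq: "\<A> = admissible \<Omega> \<nu> s N M T g h\<^sub>1 h\<^sub>2" and A_nonempty: "\<A> \<noteq> {}"
    and x0: "x\<^sub>0 \<notin> closure \<Omega>" "\<forall>x\<in>\<Omega>. norm (x - x\<^sub>0) > 1"
    and carleman: "carleman_estimate \<Omega> \<nu> x\<^sub>0 \<beta>\<^sub>0 lam\<^sub>0"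
    and params: "\<beta> > \<beta>\<^sub>0" "lam > lam\<^sub>0 \<beta>" "\<epsilon> > 0"
    and T_eq: "\<T> = T_operator \<Omega> s N T \<mu> x\<^sub>0 \<beta> lam \<epsilon> \<A>"
    and nrm_eq: "nrm = weighted_norm \<Omega> s N x\<^sub>0 \<beta> lam \<epsilon>"
    and contraction: "contraction_wrt nrm \<A> \<T>"
  shows "\<exists>a\<in>\<A>. \<T> a = a \<and> (\<forall>b\<in>\<A>. \<T> b = b \<longrightarrow> b = a) \<and>
    (\<forall>X. X 0 \<in> \<A> \<and> (\<forall>n. X (Suc n) = \<T> (X n)) \<longrightarrow> (\<lambda>n. nrm (X n - a)) \<longlonglongrightarrow> 0)"
proof -
  have \<beta>: "0 < \<beta>" and lam: "0 < lam"
  proof -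
    have "\<beta>\<^sub>0 > 0" "\<forall>\<beta>\<ge>\<beta>\<^sub>0. lam\<^sub>0 \<beta> > 0" using carleman unfolding carleman_estimate_def by blast+
    then show "0 < \<beta>" "0 < lam" using params by (auto intro: less_trans dest: less_imp_le)
  qed
  have s2: "2 \<le> s" using s_large by (smt (verit) of_nat_0_le_iff divide_nonneg_nonneg)
  interpret state_space \<Omega> s N
    by unfold_locales (rule domain(1), rule embedding, rule s2)
  define w where "w = carleman_weight x\<^sub>0 \<beta> lam"
  interpret weighted_state_space \<Omega> s N w "exp (2 * lam)"
  proof
    have "w \<in> borel_measurable lborel"
      unfolding w_def carleman_weight_def carleman_exponent_def by measurable
    then show "w \<in> borel_measurable M\<Omega>" by (rule measurable_restrict_space1)
    show "0 \<le> w x \<and> w x \<le> exp (2 * lam)" if "x \<in> \<Omega>" for x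
    proof -
      have "norm (x - x\<^sub>0) powr (- \<beta>) \<le> norm (x - x\<^sub>0) powr 0"
        using x0(2) that \<beta> by (intro powr_mono) (auto intro: less_imp_le)
      also have "\<dots> \<le> 1" by simp
      finally show ?thesis
        using lam by (simp add: w_def carleman_weight_def carleman_exponent_def)
    qed
  qed simp
  let ?q = "\<lambda>X. \<integral>x. w x * (\<Sum>n\<le>N. (norm (fst X n x))\<^sup>2 +
     (\<Sum>i\<in>Basis. (norm (grad (component i (fst X n)) x))\<^sup>2) +
     (snd X n x)\<^sup>2 + (norm (grad (snd X n) x))\<^sup>2) \<partial>M\<Omega>"
  have c: "0 < \<epsilon> / lam" using params lam by simp
  have form: "bounded_form (\<lambda>X. ?q X + \<epsilon> / lam * HN X)"
    by (intro bounded_form_add bounded_form_first_order bounded_form_H less_imp_le[OF c])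
  have q_nonneg: "0 \<le> ?q X" if "X \<in> HS" for X
    using bounded_form_bounds[OF bounded_form_first_order] that by blast
  have nrm: "nrm X = sqrt (?q X + \<epsilon> / lam * HN X)" for X
    unfolding nrm_eq weighted_norm_def case_prod_beta set_integral_eq prod.collapse w_def ..
  have "\<T> a \<in> \<A>" if a: "a \<in> \<A>" for a
  proof -
    have "is_arg_min (J_functional \<Omega> s N T \<mu> x\<^sub>0 \<beta> lam \<epsilon> a) (\<lambda>b. b \<in> \<A>) (\<T> a)"
      unfolding T_eq T_operator_def by (rule theI'[OF J_functional_minimizer[OF w_def params(3) A_eq a]])
    then show ?thesis unfolding is_arg_min_def by blast
  qed
  then show ?thesis
    by (intro contraction_fixed_point_admissible[OF form c _ nrm A_eq A_nonempty _ contraction])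
       (use q_nonneg in simp_all)
qed

end
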